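(* Let $d\ge 1$ and let $M(1)=\bigoplus_{n\ge 0}M(1)_n$ be the $d$-free boson vertex operator algebra. Then for every integer $k>0$ the homogeneous space $M(1)_k$ has strength $3$; that is, $M(1)_k$ is a conformal $3$-design (with respect to $M(1)$) but is not a conformal $4$-design.
   Context: Vertex operator algebras (VOAs) are over $\mathbb{C}$. A VOA $V=(V,Y,\mathbf{1},\omega)$ has vertex operators $Y(v,z)=\sum_{n\in\mathbb{Z}}v(n)z^{-n-1}$ for $v\in V$, vacuum vector $\mathbf{1}$ and Virasoro element $\omega$, with $Y(\omega,z)=\sum_{n\in\mathbb{Z}}L(n)z^{-n-2}$. It is graded by $L(0)$-eigenvalues, $V=\bigoplus_{n\in\mathbb{Z}}V_n$; $n$ is called the degree of the elements of $V_n$, and $V_n$ is a homogeneous space of $V$. It is assumed that $V_n=0$ for $n<0$, that $V_0=\mathbb{C}\mathbf{1}$, and that $V$ is a direct sum of highest weight modules for the Virasoro algebra generated by the $L(n)$. Let $V_\omega\subset V$ be the sub-VOA generated by $\omega$. Then $V=\bigoplus_{n\ge 0}V(n)$, where $V(n)$ is the sum of the highest weight $V_\omega$-modules in $V$ of highest weight $n$, and $V(0)=V_\omega$. (Note that $V(n)$ is different from the graded piece $V_n$.) Let $\pi:V\to V_\omega$ be the projection with kernel $\bigoplus_{n>0}V(n)$. For $v\in V_n$, put $o(v)=v(n-1)$; this operator is homogeneous of degree $0$, i.e. it preserves the graded pieces of $V$ and of any $V$-module. Conformal design: let $X$ be a degree $h$ subspace (an $L(0)$-eigenspace of eigenvalue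 $h$) of a module of $V$. For a positive integer $t$, $X$ is a conformal $t$-design if for all $n$ with $0\le n\le t$ and all $v\in V_n$ one has $\operatorname{tr}|_X o(v)=\operatorname{tr}|_X o(\pi(v))$. A homogeneous space $V_m$ of $V$ (regarded as the degree $m$ subspace of the module $V$ over $V$) has strength $t$ if it is a conformal $t$-design but not a conformal $(t+1)$-design. The $d$-free boson VOA $M(1)$: let $\mathfrak{h}$ be a $d$-dimensional complex vector space with a nondegenerate symmetric bilinear form $(\,,\,)$. Regard $\mathfrak{h}$ as an abelian Lie algebra and let $\hat{\mathfrak{h}}=\mathfrak{h}\otimes\mathbb{C}[t,t^{-1}]\oplus\mathbb{C}K$ with $[h\otimes t^m,h'\otimes t^n]=m(h,h')\delta_{m+n,0}K$ for $h,h'\in\mathfrak{h}$, $m,n\in\mathbb{Z}$, and $[K,\mathfrak{h}\otimes\mathbb{C}[t,t^{-1}]]=0$. Let $M(1)=\mathcal{U}(\hat{\mathfrak{h}})\otimes_{\mathcal{U}(\mathfrak{h}\otimes\mathbb{C}[t]\oplus\mathbb{C}K)}\mathbb{C}$, where $\mathfrak{h}\otimes\mathbb{C}[t]$ acts trivially on $\mathbb{C}$ and $K$ acts as $1$. Write $h(n)$ for the action of $h\otimes t^n$ on $M(1)$, and $\mathbf{1}=1\otimes 1$. $M(1)$ is spanned by the elements $a_1(-n_1)\cdots a_k(-n_k)\mathbf{1}$ with $a_i\in\mathfrak{h}$ and positive integers $n_i$. With $\{h_i\}_{i=1}^d$ an orthonormal basis of $\mathfrak{h}$ and $\omega=\frac12\sum_{i=1}^d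 h_i(-1)^2\mathbf{1}$, $(M(1),Y,\mathbf{1},\omega)$ is a VOA, where $Y$ is the standard vertex operator map, determined by $Y(h(-1)\mathbf{1},z)=\sum_{n\in\mathbb{Z}}h(n)z^{-n-1}$ for $h\in\mathfrak{h}$. Its degree $n$ piece $M(1)_n$ is spanned by the $a_1(-n_1)\cdots a_k(-n_k)\mathbf{1}$ with $\sum_i n_i=n$. *)

theory Defs
  imports Complex_Main "HOL-Library.Poly_Mapping" "HOL-Library.Product_Plus"
begin

section \<open>Traces on subspaces\<close>

text \<open>Meant for a finite-dimensional subspace \<open>X\<close> with \<open>f ` X \<subseteq> X\<close>; the value does not depend on
  the chosen basis.\<close>

definition (in vector_space) trace_on :: "'b set \<Rightarrow> ('b \<Rightarrow> 'b) \<Rightarrow> 'a" where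
  "trace_on X f =
     (let B = (SOME B. independent B \<and> span B = X) in \<Sum>b\<in>B. representation B (f b) b)"


section \<open>Vertex operator algebras and their modules\<close>

text \<open>\<open>Y u n\<close> is the mode \<open>u(n)\<close>, that is \<open>Y(u,z) = \<Sum>n. u(n) z\<^sup>-\<^sup>n\<^sup>-\<^sup>1\<close>.  The identity below is the
  component form of the Jacobi identity:
  \<open>\<Sum>i. (m choose i) (u(l+i)v)(m+n-i) =
   \<Sum>i. (-1)\<^sup>i (l choose i) (u(m+l-i) v(n+i) - (-1)\<^sup>l v(n+l-i) u(m+i))\<close>.
  Both sums are finite on each vector by the truncation axioms, so \<^const>\<open>Sum_any\<close> is their
  actual value.\<close>

definition borcherds_identity ::
  "(complex \<Rightarrow> 'w \<Rightarrow> 'w::ab_group_add) \<Rightarrow> ('v \<Rightarrow> int \<Rightarrow> 'v \<Rightarrow> 'v) \<Rightarrow> ('v \<Rightarrow> int \<Rightarrow> 'w \<Rightarrow> 'w) \<Rightarrow> bool" where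
  "borcherds_identity scaleW Y YW \<longleftrightarrow> (\<forall>u v w l m n.
     Sum_any (\<lambda>i::nat. scaleW (of_int m gchoose i) (YW (Y u (l + int i) v) (m + n - int i) w)) =
     Sum_any (\<lambda>i::nat. scaleW ((-1) ^ i * (of_int l gchoose i))
       (YW u (m + l - int i) (YW v (n + int i) w)
        - scaleW ((-1) powi l) (YW v (n + l - int i) (YW u (m + int i) w)))))"

locale vertex_algebra = vector_space scale
  for scale :: "complex \<Rightarrow> 'v \<Rightarrow> 'v::ab_group_add" (infixr \<open>*\<^sub>V\<close> 75) +
  fixes Y :: "'v \<Rightarrow> int \<Rightarrow> 'v \<Rightarrow> 'v"
    and vac :: 'v
  assumes Y_linear_left: "Vector_Spaces.linear (*\<^sub>V) (*\<^sub>V) (\<lambda>u. Y u n v)"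
    and Y_linear_right: "Vector_Spaces.linear (*\<^sub>V) (*\<^sub>V) (Y u n)"
    and truncation: "\<exists>N. \<forall>n\<ge>N. Y u n v = 0"
    and vacuum: "Y vac n v = (if n = -1 then v else 0)"
    and creation: "n \<ge> 0 \<Longrightarrow> Y v n vac = 0" "Y v (-1) vac = v"
    and borcherds: "borcherds_identity (*\<^sub>V) Y Y"

locale conformal_vector = vertex_algebra scale Y vac
  for scale :: "complex \<Rightarrow> 'v \<Rightarrow> 'v::ab_group_add" (infixr \<open>*\<^sub>V\<close> 75)
    and Y :: "'v \<Rightarrow> int \<Rightarrow> 'v \<Rightarrow> 'v"
    and vac :: 'v +
  fixes \<omega> :: 'v
begin

definition L :: "int \<Rightarrow> 'v \<Rightarrow> 'v" where
  "L n = Y \<omega> (n + 1)"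

definition homogeneous_space :: "int \<Rightarrow> 'v set" where
  "homogeneous_space n = {v. L 0 v = of_int n *\<^sub>V v}"

end

text \<open>Directness of the sum of the homogeneous spaces is automatic, as they are eigenspaces for
  distinct eigenvalues.\<close>

locale voa = conformal_vector scale Y vac \<omega>
  for scale :: "complex \<Rightarrow> 'v \<Rightarrow> 'v::ab_group_add" (infixr \<open>*\<^sub>V\<close> 75)
    and Y :: "'v \<Rightarrow> int \<Rightarrow> 'v \<Rightarrow> 'v"
    and vac :: 'v
    and \<omega> :: 'v +
  assumes virasoro: "\<exists>c::complex. \<forall>m n v.
      L m (L n v) - L n (L m v) =
        of_int (m - n) *\<^sub>V L (m + n) v
        + (if m + n = 0 then (of_int (m ^ 3 - m) / 12 * c) *\<^sub>V v else 0)"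
    and L_derivative: "Y (L (-1) u) n v = - (of_int n *\<^sub>V Y u (n - 1) v)"
    and graded: "span (\<Union>n. homogeneous_space n) = UNIV"
    and finite_dim_homogeneous: "\<exists>B. finite B \<and> homogeneous_space n \<subseteq> span B"
    and lower_bounded: "\<exists>N. \<forall>n<N. homogeneous_space n = {0}"
begin

text \<open>The sub-VOA generated by \<open>\<omega>\<close>.\<close>

definition V\<^sub>\<omega> :: "'v set" where
  "V\<^sub>\<omega> = \<Inter> {U. subspace U \<and> vac \<in> U \<and> \<omega> \<in> U \<and> (\<forall>u\<in>U. \<forall>v\<in>U. \<forall>n. Y u n v \<in> U)}"

definition highest_weight_vector :: "int \<Rightarrow> 'v \<Rightarrow> bool" where
  "highest_weight_vector n v \<longleftrightarrow> v \<noteq> 0 \<and> L 0 v = of_int n *\<^sub>V v \<and> (\<forall>m>0. L m v = 0)"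

definition V\<^sub>\<omega>_submodule :: "'v set \<Rightarrow> bool" where
  "V\<^sub>\<omega>_submodule M \<longleftrightarrow> subspace M \<and> (\<forall>u\<in>V\<^sub>\<omega>. \<forall>n. \<forall>w\<in>M. Y u n w \<in> M)"

definition highest_weight_submodule :: "int \<Rightarrow> 'v set \<Rightarrow> bool" where
  "highest_weight_submodule n M \<longleftrightarrow>
     (\<exists>v. highest_weight_vector n v \<and> M = \<Inter> {M'. V\<^sub>\<omega>_submodule M' \<and> v \<in> M'})"

text \<open>\<open>V(n)\<close>, not to be confused with the homogeneous space of degree \<open>n\<close>.\<close>

definition highest_weight_component :: "int \<Rightarrow> 'v set" where
  "highest_weight_component n = span (\<Union> {M. highest_weight_submodule n M})"

text \<open>The projection onto \<open>V\<^sub>\<omega>\<close> along the sum of the \<open>V(n)\<close>, \<open>n > 0\<close>.  The description is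
  meaningful when the homogeneous spaces of negative degree vanish, the one of degree \<open>0\<close> is
  spanned by the vacuum, and \<open>V\<close> is a direct sum of highest weight modules for the Virasoro
  algebra.  These conditions are not part of the locale.\<close>

definition \<pi> :: "'v \<Rightarrow> 'v" where
  "\<pi> v = (THE w. w \<in> V\<^sub>\<omega> \<and> v - w \<in> span (\<Union>n\<in>{1..}. highest_weight_component n))"

end

locale voa_module = voa scale Y vac \<omega> + W: vector_space scaleW
  for scale :: "complex \<Rightarrow> 'v \<Rightarrow> 'v::ab_group_add" (infixr \<open>*\<^sub>V\<close> 75)
    and Y :: "'v \<Rightarrow> int \<Rightarrow> 'v \<Rightarrow> 'v"
    and vac :: 'v
    and \<omega> :: 'v
    and scaleW :: "complex \<Rightarrow> 'w \<Rightarrow> 'w::ab_group_add" (infixr \<open>*\<^sub>W\<close> 75) +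
  fixes YW :: "'v \<Rightarrow> int \<Rightarrow> 'w \<Rightarrow> 'w"
  assumes YW_linear_left: "Vector_Spaces.linear (*\<^sub>V) (*\<^sub>W) (\<lambda>u. YW u n w)"
    and YW_linear_right: "Vector_Spaces.linear (*\<^sub>W) (*\<^sub>W) (YW u n)"
    and module_truncation: "\<exists>N. \<forall>n\<ge>N. YW u n w = 0"
    and module_vacuum: "YW vac n w = (if n = -1 then w else 0)"
    and module_borcherds: "borcherds_identity (*\<^sub>W) Y YW"
    and module_graded: "W.span (\<Union>h. {w. YW \<omega> 1 w = h *\<^sub>W w}) = UNIV"
    and finite_dim_module_degree: "\<exists>B. finite B \<and> {w. YW \<omega> 1 w = h *\<^sub>W w} \<subseteq> W.span B"
    and module_lower_bounded: "\<exists>N::nat. \<forall>n\<ge>N. {w. YW \<omega> 1 w = (h - of_nat n) *\<^sub>W w} = {0}"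
begin

text \<open>Degrees in a module may be arbitrary complex numbers; \<open>YW \<omega> 1\<close> is \<open>L(0)\<close> on the module.\<close>

definition degree_subspace :: "complex \<Rightarrow> 'w set" where
  "degree_subspace h = {w. YW \<omega> 1 w = h *\<^sub>W w}"

text \<open>The operator \<open>o(v)\<close> for \<open>v\<close> of degree \<open>n\<close>.\<close>

definition zero_mode :: "int \<Rightarrow> 'v \<Rightarrow> 'w \<Rightarrow> 'w" where
  "zero_mode n v = YW v (n - 1)"

text \<open>\<open>\<pi>\<close> preserves degrees, so \<open>o(\<pi> v)\<close> is formed with the degree of \<open>v\<close>.\<close>

definition conformal_design :: "nat \<Rightarrow> 'w set \<Rightarrow> bool" where
  "conformal_design t X \<longleftrightarrow> 0 < t \<and> (\<exists>h. X = degree_subspace h) \<and>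
     (\<forall>n::nat. n \<le> t \<longrightarrow> (\<forall>v\<in>homogeneous_space (int n).
        W.trace_on X (zero_mode (int n) v) = W.trace_on X (zero_mode (int n) (\<pi> v))))"

end

context voa
begin

lemma L0_eigenvalue_integer:
  assumes v: "L 0 v = h *\<^sub>V v" "v \<noteq> 0"
  shows "\<exists>n. h = of_int n"
proof (rule ccontr)
  assume nonint: "\<not> ?thesis"
  have L0: "L 0 (x + y) = L 0 x + L 0 y" "L 0 (c *\<^sub>V x) = c *\<^sub>V L 0 x" for x y c
    using Y_linear_right[of \<omega> 1] by (auto simp: L_def Vector_Spaces.linear_iff)
  have L00: "L 0 0 = 0"
    using L0(2)[of 0 0] by simp
  have L0d: "L 0 (x - y) = L 0 x - L 0 y" for x y
    using L0(1)[of "x - y" y] by (simp add: algebra_simps)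
  text \<open>Each vector is annihilated by a finite product of operators \<open>L 0 - n\<close>.\<close>
  define A where "A ns x = fold (\<lambda>n x. L 0 x - of_int n *\<^sub>V x) ns x" for ns :: "int list" and x
  have A_app: "A (ms @ ns) x = A ns (A ms x)" for ms ns x
    by (simp add: A_def)
  have A_eig: "A ns (c *\<^sub>V v) = (c * (\<Prod>n\<leftarrow>ns. h - of_int n)) *\<^sub>V v" for ns c
  proof (induction ns arbitrary: c)
    case (Cons n ns)
    have "L 0 (c *\<^sub>V v) - of_int n *\<^sub>V c *\<^sub>V v = (c * (h - of_int n)) *\<^sub>V v"
      by (simp add: L0 v algebra_simps)
    then show ?case
      using Cons[of "c * (h - of_int n)"] by (simp add: A_def mult.assoc)
  qed (simp add: A_def)
  have A_add: "A ns (x + y) = A ns x + A ns y" for ns x y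
  proof (induction ns arbitrary: x y)
    case (Cons n ns)
    have "L 0 (x + y) - of_int n *\<^sub>V (x + y) = (L 0 x - of_int n *\<^sub>V x) + (L 0 y - of_int n *\<^sub>V y)"
      by (simp add: L0 algebra_simps)
    then show ?case
      using Cons[of "L 0 x - of_int n *\<^sub>V x" "L 0 y - of_int n *\<^sub>V y"] by (simp add: A_def)
  qed (simp add: A_def)
  have A_scale: "A ns (c *\<^sub>V x) = c *\<^sub>V A ns x" for ns c x
  proof (induction ns arbitrary: x)
    case (Cons n ns)
    have "L 0 (c *\<^sub>V x) - of_int n *\<^sub>V c *\<^sub>V x = c *\<^sub>V (L 0 x - of_int n *\<^sub>V x)"
      by (simp add: L0 scale_right_diff_distrib mult.commute)
    then show ?case using Cons by (simp add: A_def)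
  qed (simp add: A_def)
  have A0: "A ns 0 = 0" for ns
    using A_scale[of ns 0 0] by simp
  have A_comm: "A ms (A ns x) = A ns (A ms x)" for ms ns x
  proof -
    have 1: "A ns (L 0 x) = L 0 (A ns x)" for ns x
    proof (induction ns arbitrary: x)
      case (Cons n ns)
      have "L 0 (L 0 x) - of_int n *\<^sub>V L 0 x = L 0 (L 0 x - of_int n *\<^sub>V x)"
        by (simp add: L0d L0)
      then show ?case using Cons by (simp add: A_def)
    qed (simp add: A_def)
    have 2: "A ns (x - y) = A ns x - A ns y" for ns x y
      using A_add[of ns "x - y" y] by (simp add: algebra_simps)
    show ?thesis
    proof (induction ms arbitrary: x)
      case (Cons m ms)
      have "A ns (L 0 x - of_int m *\<^sub>V x) = L 0 (A ns x) - of_int m *\<^sub>V A ns x"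
        by (simp add: 1 2 A_scale)
      then show ?case using Cons[of "L 0 x - of_int m *\<^sub>V x"] by (simp add: A_def)
    qed (simp add: A_def)
  qed
  have "v \<in> span (\<Union>n. homogeneous_space n)"
    using graded by simp
  then have "\<exists>ns. A ns v = 0"
  proof (induction rule: span_induct_alt)
    case base
    then show ?case by (auto intro: A0)
  next
    case (step c x y)
    then obtain n ns where n: "L 0 x = of_int n *\<^sub>V x" and ns: "A ns y = 0"
      by (auto simp: homogeneous_space_def)
    have "A [n] (c *\<^sub>V x) = 0"
      by (simp add: A_scale) (simp add: A_def n)
    moreover have "A ([n] @ ns) (c *\<^sub>V x + y) = A ns (A [n] (c *\<^sub>V x)) + A [n] (A ns y)"
      using A_comm[of "[n]" ns y] by (simp only: A_app A_add)
    ultimately show ?case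
      using ns by (metis A0 add_0)
  qed
  then obtain ns where "A ns v = 0" by blast
  then have "(\<Prod>n\<leftarrow>ns. h - of_int n) = 0"
    using A_eig[of ns 1] v by simp
  then show False
    using nonint by (auto simp: prod_list_zero_iff)
qed

lemma L0_eigenspace:
  "{v. Y \<omega> 1 v = h *\<^sub>V v} = (if h \<in> \<int> then homogeneous_space \<lfloor>Re h\<rfloor> else {0})"
proof -
  have "Y \<omega> 1 0 = 0"
    using Y_linear_right[of \<omega> 1] by (metis Vector_Spaces.linear_iff scale_zero_left)
  then show ?thesis
    using L0_eigenvalue_integer[of _ h]
    by (force simp: homogeneous_space_def L_def elim!: Ints_cases)
qed

lemma adjoint_module: "voa_module scale Y vac \<omega> scale Y"
proof (intro voa_module.intro voa_module_axioms.intro)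
  show "span (\<Union>h. {w. Y \<omega> 1 w = h *\<^sub>V w}) = UNIV"
  proof -
    have "(\<Union>n. homogeneous_space n) \<subseteq> (\<Union>h. {w. Y \<omega> 1 w = h *\<^sub>V w})"
      by (auto simp: homogeneous_space_def L_def)
    from span_mono[OF this] show ?thesis
      using graded by auto
  qed
next
  fix h
  show "\<exists>B. finite B \<and> {w. Y \<omega> 1 w = h *\<^sub>V w} \<subseteq> span B"
    using finite_dim_homogeneous by (auto simp: L0_eigenspace span_zero)
next
  fix h :: complex
  obtain N where N: "\<And>n. n < N \<Longrightarrow> homogeneous_space n = {0}"
    using lower_bounded by blast
  show "\<exists>K. \<forall>n\<ge>K. {w. Y \<omega> 1 w = (h - of_nat n) *\<^sub>V w} = {0}"
  proof (intro exI allI impI)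
    fix n :: nat
    assume n: "n \<ge> nat (\<lfloor>Re h\<rfloor> - N + 1)"
    have "\<lfloor>Re h - real n\<rfloor> < N"
      using n by linarith
    then show "{w. Y \<omega> 1 w = (h - of_nat n) *\<^sub>V w} = {0}"
      unfolding L0_eigenspace by (simp add: N)
  qed
qed (use Y_linear_left Y_linear_right truncation vacuum borcherds voa_axioms
    vector_space_axioms in simp_all)

end

text \<open>The VOA as a module over itself.\<close>

sublocale voa \<subseteq> adjoint: voa_module scale Y vac \<omega> scale Y
  by (rule adjoint_module)

context voa
begin

lemma degree_subspace_adjoint: "adjoint.degree_subspace (of_int n) = homogeneous_space n"
  by (simp add: adjoint.degree_subspace_def homogeneous_space_def L_def)

definition has_strength :: "int \<Rightarrow> nat \<Rightarrow> bool" where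
  "has_strength m t \<longleftrightarrow>
     adjoint.conformal_design t (homogeneous_space m) \<and>
     \<not> adjoint.conformal_design (t + 1) (homogeneous_space m)"

end


section \<open>Induced modules of Lie algebras\<close>

text \<open>For a Lie algebra \<open>g\<close>, a subalgebra \<open>b\<close> and a character \<open>\<chi>\<close> of \<open>b\<close>, the module
  \<open>U(g) \<otimes>\<^bsub>U(b)\<^esub> \<complex>\<^sub>\<chi>\<close> is the quotient of the free vector space on words in elements of \<open>g\<close> by the
  relations below: the first two present the tensor algebra of \<open>g\<close>, the third the enveloping
  algebra, and the last the left ideal of \<open>U(g)\<close> generated by \<open>x - \<chi>(x)\<close>, \<open>x \<in> b\<close>.  The word
  \<open>[x\<^sub>1, \<dots>, x\<^sub>k]\<close> stands for \<open>x\<^sub>1 \<cdots> x\<^sub>k \<otimes> 1\<close>.\<close>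

type_synonym 'g words = "'g list \<Rightarrow>\<^sub>0 complex"

abbreviation word :: "'g list \<Rightarrow> 'g words" where
  "word xs \<equiv> Poly_Mapping.single xs 1"

definition words_scale :: "complex \<Rightarrow> 'g words \<Rightarrow> 'g words" where
  "words_scale c = Poly_Mapping.map ((*) c)"

lemma lookup_words_scale: "Poly_Mapping.lookup (words_scale c f) w = c * Poly_Mapping.lookup f w"
  by (simp add: words_scale_def Poly_Mapping.map.rep_eq when_def)

interpretation words: vector_space words_scale
  by unfold_locales
    (auto intro!: poly_mapping_eqI simp: lookup_words_scale lookup_add algebra_simps)

definition induced_relations ::
  "(complex \<Rightarrow> 'g \<Rightarrow> 'g::ab_group_add) \<Rightarrow> ('g \<Rightarrow> 'g \<Rightarrow> 'g) \<Rightarrow> 'g set \<Rightarrow> ('g \<Rightarrow> complex) \<Rightarrow> 'g words set"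
  where
  "induced_relations scaleg bracket b \<chi> =
     {word (u @ [x + y] @ v) - word (u @ [x] @ v) - word (u @ [y] @ v) | u x y v. True} \<union>
     {word (u @ [scaleg c x] @ v) - words_scale c (word (u @ [x] @ v)) | u c x v. True} \<union>
     {word (u @ [x, y] @ v) - word (u @ [y, x] @ v) - word (u @ [bracket x y] @ v) | u x y v. True} \<union>
     {word (u @ [x]) - words_scale (\<chi> x) (word u) | u x. x \<in> b}"

definition lie_representation ::
  "(complex \<Rightarrow> 'g \<Rightarrow> 'g::ab_group_add) \<Rightarrow> ('g \<Rightarrow> 'g \<Rightarrow> 'g) \<Rightarrow>
   (complex \<Rightarrow> 'v \<Rightarrow> 'v::ab_group_add) \<Rightarrow> ('g \<Rightarrow> 'v \<Rightarrow> 'v) \<Rightarrow> bool" where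
  "lie_representation scaleg bracket scale act \<longleftrightarrow>
     (\<forall>v. Vector_Spaces.linear scaleg scale (\<lambda>x. act x v)) \<and>
     (\<forall>x. Vector_Spaces.linear scale scale (act x)) \<and>
     (\<forall>x y v. act (bracket x y) v = act x (act y v) - act y (act x v))"

definition words_act ::
  "(complex \<Rightarrow> 'v \<Rightarrow> 'v::ab_group_add) \<Rightarrow> ('g \<Rightarrow> 'v \<Rightarrow> 'v) \<Rightarrow> 'v \<Rightarrow> 'g words \<Rightarrow> 'v" where
  "words_act scale act v0 f = (\<Sum>w\<in>Poly_Mapping.keys f. scale (Poly_Mapping.lookup f w) (foldr act w v0))"

text \<open>\<open>V\<close> is a copy of the induced module, with \<open>v0\<close> corresponding to \<open>1 \<otimes> 1\<close>: the map from the
  quotient to \<open>V\<close> sending the word \<open>[x\<^sub>1, \<dots>, x\<^sub>k]\<close> to \<open>x\<^sub>1 \<cdots> x\<^sub>k v0\<close> is an isomorphism.\<close>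

definition is_induced_module ::
  "(complex \<Rightarrow> 'g \<Rightarrow> 'g::ab_group_add) \<Rightarrow> ('g \<Rightarrow> 'g \<Rightarrow> 'g) \<Rightarrow> 'g set \<Rightarrow> ('g \<Rightarrow> complex) \<Rightarrow>
   (complex \<Rightarrow> 'v \<Rightarrow> 'v::ab_group_add) \<Rightarrow> ('g \<Rightarrow> 'v \<Rightarrow> 'v) \<Rightarrow> 'v \<Rightarrow> bool" where
  "is_induced_module scaleg bracket b \<chi> scale act v0 \<longleftrightarrow>
     lie_representation scaleg bracket scale act \<and>
     surj (words_act scale act v0) \<and>
     {f. words_act scale act v0 f = 0} = words.span (induced_relations scaleg bracket b \<chi>)"


section \<open>The free boson vertex operator algebra\<close>

text \<open>The element \<open>(p, a)\<close> of the following type is \<open>\<Sum>m. p m \<otimes> t\<^sup>m + a K\<close>.\<close>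

type_synonym 'h affine = "(int \<Rightarrow>\<^sub>0 'h) \<times> complex"

locale heisenberg = \<hh>: vector_space scaleh
  for scaleh :: "complex \<Rightarrow> 'h \<Rightarrow> 'h::ab_group_add" +
  fixes d :: nat
    and form :: "'h \<Rightarrow> 'h \<Rightarrow> complex"
  assumes dimension: "\<exists>B. finite B \<and> card B = d \<and> \<hh>.independent B \<and> \<hh>.span B = UNIV"
    and form_linear: "Vector_Spaces.linear scaleh (*) (form x)"
    and form_sym: "form x y = form y x"
    and form_nondegenerate: "(\<And>y. form x y = 0) \<Longrightarrow> x = 0"
begin

definition affine_scale :: "complex \<Rightarrow> 'h affine \<Rightarrow> 'h affine" where
  "affine_scale c X = (Poly_Mapping.map (scaleh c) (fst X), c * snd X)"

definition affine_bracket :: "'h affine \<Rightarrow> 'h affine \<Rightarrow> 'h affine" where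
  "affine_bracket X Z =
     (0, Sum_any (\<lambda>m. of_int m * form (Poly_Mapping.lookup (fst X) m) (Poly_Mapping.lookup (fst Z) (- m))))"

text \<open>\<open>h \<otimes> \<complex>[t] \<oplus> \<complex>K\<close> and its character, which kills \<open>h \<otimes> \<complex>[t]\<close> and sends \<open>K\<close> to \<open>1\<close>.\<close>

definition affine_nonneg :: "'h affine set" where
  "affine_nonneg = {X. \<forall>m<0. Poly_Mapping.lookup (fst X) m = 0}"

definition level_one :: "'h affine \<Rightarrow> complex" where
  "level_one X = snd X"

text \<open>\<open>h \<otimes> t\<^sup>n\<close>\<close>

definition mode :: "'h \<Rightarrow> int \<Rightarrow> 'h affine" where
  "mode h n = (Poly_Mapping.single n h, 0)"

lemma affine_bracket_mode:
  "affine_bracket (mode h m) (mode h' n) = (0, if m + n = 0 then of_int m * form h h' else 0)"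
proof -
  have form0: "form x 0 = 0" "form 0 x = 0" for x
    using form_linear[of x] form_sym[of x 0] Vector_Spaces.linear_iff \<hh>.scale_zero_left mult_zero_left by metis+
  have "Sum_any (\<lambda>k. of_int k * form (Poly_Mapping.lookup (Poly_Mapping.single m h) k)
          (Poly_Mapping.lookup (Poly_Mapping.single n h') (- k)))
        = Sum_any (\<lambda>k. (if m + n = 0 then of_int m * form h h' else 0) when k = m)"
    by (intro arg_cong[where f = Sum_any] ext) (auto simp: lookup_single when_def form0)
  then show ?thesis
    by (simp add: affine_bracket_def mode_def)
qed

definition orthonormal_basis :: "(nat \<Rightarrow> 'h) \<Rightarrow> bool" where
  "orthonormal_basis hs \<longleftrightarrow>
     inj_on hs {..<d} \<and> \<hh>.independent (hs ` {..<d}) \<and> \<hh>.span (hs ` {..<d}) = UNIV \<and>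
     (\<forall>i<d. \<forall>j<d. form (hs i) (hs j) = (if i = j then 1 else 0))"

end

text \<open>The \<open>d\<close>-free boson VOA.  The vertex operator map is pinned down by the values on the
  generating vectors \<open>h(-1)\<^bold>1\<close>, together with the VOA axioms.\<close>

locale free_boson_voa =
  heisenberg scaleh d form +
  voa scale Y vac \<omega>
  for scaleh :: "complex \<Rightarrow> 'h \<Rightarrow> 'h::ab_group_add"
    and d :: nat
    and form :: "'h \<Rightarrow> 'h \<Rightarrow> complex"
    and scale :: "complex \<Rightarrow> 'v \<Rightarrow> 'v::ab_group_add" (infixr \<open>*\<^sub>V\<close> 75)
    and Y :: "'v \<Rightarrow> int \<Rightarrow> 'v \<Rightarrow> 'v"
    and vac :: 'v
    and \<omega> :: 'v +
  fixes act :: "'h affine \<Rightarrow> 'v \<Rightarrow> 'v"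
    and hs :: "nat \<Rightarrow> 'h"
  assumes induced:
      "is_induced_module affine_scale affine_bracket affine_nonneg level_one (*\<^sub>V) act vac"
    and Y_generators: "Y (act (mode h (-1)) vac) n = act (mode h n)"
    and basis: "orthonormal_basis hs"
    and omega: "\<omega> = (1/2) *\<^sub>V (\<Sum>i<d. act (mode (hs i) (-1)) (act (mode (hs i) (-1)) vac))"

end

theory Submission
  imports Defs "HOL-Library.Function_Algebras" "HOL-Library.Multiset"
begin

text \<open>Write \<open>\<alpha> i n\<close> for the modes of an orthonormal basis.  The Fock model carries a positive definite
  Hermitian form for which \<open>\<alpha> i n\<close> and \<open>L n\<close> are adjoint to \<open>\<alpha> i (-n)\<close> and \<open>L (-n)\<close>.  Highest weight
  vectors of positive weight are orthogonal to \<open>V\<^sub>\<omega>\<close>, so by definiteness \<open>\<pi> v = w\<close> as soon as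
  \<open>w \<in> V\<^sub>\<omega>\<close> and \<open>v - w\<close> lies in the sum of the \<open>V(n)\<close>, \<open>n > 0\<close>.

  All traces are obtained by cyclicity: moving \<open>A\<close> of degree \<open>s\<close> around in \<open>tr (A B)\<close> relates the traces
  on degree \<open>k\<close> and \<open>k - s\<close>, and iterating the commutator \<open>[B, A]\<close> gives a sum over the multiples of
  \<open>s\<close>.  In degrees up to three every vector is a sum of derivatives \<open>L (-1) u\<close>, an element of \<open>V\<^sub>\<omega>\<close>
  and a vector in the sum of the \<open>V(n)\<close>, \<open>n > 0\<close>, whose trace vanishes by this argument.

  In degree four consider \<open>B = \<Sum>i. \<alpha> i (-1) (\<alpha> i (-3) vac)\<close>.  Its projection is a combination of
  \<open>L (-2) \<omega>\<close> and \<open>L (-4) vac\<close>, whose traces only need the Virasoro relations.  With the convolution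
  identity for \<open>\<sigma>\<^sub>1\<close> (Ramanujan's \<open>q dE\<^sub>2/dq = (E\<^sub>2\<^sup>2 - E\<^sub>4)/12\<close>) the difference of the traces of \<open>B\<close> and
  \<open>\<pi> B\<close> on degree \<open>k\<close> becomes \<open>6d(d+2)/(5d+22) \<Sum>m. m \<sigma>\<^sub>1(m) dim V\<^sub>k\<^sub>-\<^sub>m\<close>, which is positive.\<close>

subsection \<open>Traces\<close>

text \<open>The projection \<open>\<pi>\<close> is a definite description, and the decomposition
  that makes it denote is not part of the locale. The obstacle is therefore uniqueness of the
  candidate \<open>w\<close>, and this is what the Fock model is for. A Hermitian form is taken
  rather than the bilinear contravariant one because over the complex numbers only the former can be
  definite; the orthonormal basis serves as its real structure. Definiteness also yields that
  negative degrees vanish and that degree 0 is spanned by \<open>vac\<close>. Strength is claimed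
  for every single \<open>k\<close>, so generating functions in \<open>q\<close> are replaced by
  identities between their coefficients. No nonvanishing result for coefficients of modular forms
  enters: the final sum has nonnegative terms, and its term \<open>m = k\<close> is positive. The
  denominator \<open>5 * d + 22\<close> is a factor of the Gram determinant of
  \<open>L (-2) \<omega>\<close> and \<open>L (-4) vac\<close> at central charge \<open>d\<close>;
  it appears on solving for the projection of the test vector.\<close>

definition (in vector_space) fin_subspace :: "'b set \<Rightarrow> bool" where
  "fin_subspace X \<longleftrightarrow> subspace X \<and> (\<exists>B. finite B \<and> X \<subseteq> span B)"

definition (in vector_space) basis_of :: "'b set \<Rightarrow> 'b set" where
  "basis_of X = (SOME B. independent B \<and> span B = X)"

context vector_space
begin

lemma trace_on_eq:
  "trace_on X f = (\<Sum>b\<in>basis_of X. representation (basis_of X) (f b) b)"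
  by (simp add: trace_on_def basis_of_def Let_def)

lemma basis_of:
  assumes "fin_subspace X"
  shows "independent (basis_of X)" "span (basis_of X) = X" "finite (basis_of X)"
    "basis_of X \<subseteq> X" "card (basis_of X) = dim X"
proof -
  have X: "subspace X" using assms by (simp add: fin_subspace_def)
  obtain B where B: "B \<subseteq> X" "independent B" "X \<subseteq> span B"
    by (rule basis_exists)
  then have "span B = X"
    using X by (simp add: span_minimal subset_antisym)
  with B have "\<exists>B. independent B \<and> span B = X" by blast
  then have *: "independent (basis_of X) \<and> span (basis_of X) = X"
    unfolding basis_of_def by (rule someI_ex)
  then show 1: "independent (basis_of X)" "span (basis_of X) = X" by auto
  then show "basis_of X \<subseteq> X" using span_superset by blast
  show "finite (basis_of X)"
    using assms 1 independent_span_bound unfolding fin_subspace_def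
    by (metis \<open>basis_of X \<subseteq> X\<close> subset_trans)
  show "card (basis_of X) = dim X"
    using 1 dim_eq_card by (metis span_span)
qed

lemma trace_on_cong:
  assumes "fin_subspace X" "\<And>x. x \<in> X \<Longrightarrow> f x = g x"
  shows "trace_on X f = trace_on X g"
  unfolding trace_on_eq using basis_of(4)[OF assms(1)] assms(2)
  by (intro sum.cong) auto

lemma trace_on_add:
  assumes "fin_subspace X" "f ` X \<subseteq> X" "g ` X \<subseteq> X"
  shows "trace_on X (\<lambda>x. f x + g x) = trace_on X f + trace_on X g"
proof -
  note b = basis_of[OF assms(1)]
  have "representation (basis_of X) (f x + g x) = (\<lambda>b. representation (basis_of X) (f x) b + representation (basis_of X) (g x) b)"
    if "x \<in> basis_of X" for x
    using that assms b by (intro representation_add) (simp_all, blast+)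
  then show ?thesis
    unfolding trace_on_eq by (simp add: sum.distrib[symmetric] cong: sum.cong)
qed

lemma trace_on_scale:
  assumes "fin_subspace X" "f ` X \<subseteq> X"
  shows "trace_on X (\<lambda>x. c *s f x) = c * trace_on X f"
proof -
  note b = basis_of[OF assms(1)]
  have "representation (basis_of X) (c *s f x) = (\<lambda>b. c * representation (basis_of X) (f x) b)"
    if "x \<in> basis_of X" for x
    using that assms b by (intro representation_scale) (simp_all, blast+)
  then show ?thesis
    unfolding trace_on_eq by (simp add: sum_distrib_left cong: sum.cong)
qed

lemma trace_on_zero:
  assumes "fin_subspace X" "\<And>x. x \<in> X \<Longrightarrow> f x = 0"
  shows "trace_on X f = 0"
  using trace_on_cong[OF assms(1), of f "\<lambda>x. 0"] assms(2)
  by (simp add: trace_on_eq representation_zero)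

lemma trace_on_sum:
  assumes "fin_subspace X" "finite I" "\<And>i. i \<in> I \<Longrightarrow> f i ` X \<subseteq> X"
  shows "trace_on X (\<lambda>x. \<Sum>i\<in>I. f i x) = (\<Sum>i\<in>I. trace_on X (f i))"
  using assms(2,3)
proof (induction I rule: finite_induct)
  case empty
  then show ?case using assms(1) by (simp add: trace_on_zero)
next
  case (insert i I)
  have X: "subspace X" using assms(1) by (simp add: fin_subspace_def)
  have "(\<lambda>x. \<Sum>i\<in>I. f i x) ` X \<subseteq> X"
    using insert.prems by (auto intro!: subspace_sum[OF X])
  then show ?case
    using insert trace_on_add[OF assms(1), of "f i" "\<lambda>x. \<Sum>i\<in>I. f i x"] by simp
qed

lemma trace_on_const:
  assumes "fin_subspace X"
  shows "trace_on X (\<lambda>x. c *s x) = c * of_nat (dim X)"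
proof -
  note b = basis_of[OF assms(1)]
  have "trace_on X (\<lambda>x. x) = of_nat (dim X)"
    unfolding trace_on_eq using b by (simp add: representation_basis)
  then show ?thesis
    using trace_on_scale[OF assms, of "\<lambda>x. x"] by simp
qed

text \<open>Cyclicity in rectangular form: \<open>X\<close> and \<open>Z\<close> will be homogeneous
  spaces of different degrees.\<close>

lemma trace_on_cycle:
  assumes X: "fin_subspace X" and Z: "fin_subspace Z"
    and f: "Vector_Spaces.linear scale scale f" "f ` Z \<subseteq> X"
    and g: "Vector_Spaces.linear scale scale g" "g ` X \<subseteq> Z"
  shows "trace_on X (\<lambda>x. f (g x)) = trace_on Z (\<lambda>x. g (f x))"
proof -
  \<comment> \<open>Matrix multiplication, with maps and spaces generalized so that it serves both
    products.\<close>
  have expand: "representation (basis_of X) (f (g x)) b =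
      (\<Sum>c\<in>basis_of Z. representation (basis_of Z) (g x) c * representation (basis_of X) (f c) b)"
    if X: "fin_subspace X" and Z: "fin_subspace Z"
    and f: "Vector_Spaces.linear scale scale f" "f ` Z \<subseteq> X" and g: "g ` X \<subseteq> Z" and x: "x \<in> X"
    for f g X Z x b
  proof -
    note bX = basis_of[OF X] and bZ = basis_of[OF Z]
    interpret f: Vector_Spaces.linear scale scale f by (rule f)
    have "g x \<in> span (basis_of Z)" using x g bZ by auto
    then have "g x = (\<Sum>c\<in>basis_of Z. representation (basis_of Z) (g x) c *s c)"
      using sum_representation_eq[OF bZ(1) _ bZ(3) order_refl] by metis
    then have "f (g x) = (\<Sum>c\<in>basis_of Z. representation (basis_of Z) (g x) c *s f c)"
      by (metis (no_types, lifting) f.scale f.sum sum.cong)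
    moreover have "representation (basis_of X) (\<Sum>c\<in>basis_of Z. representation (basis_of Z) (g x) c *s f c)
      = (\<lambda>b. \<Sum>c\<in>basis_of Z. representation (basis_of X) (representation (basis_of Z) (g x) c *s f c) b)"
      using bX bZ f(2) by (intro representation_sum span_scale) (simp, blast)
    moreover have "representation (basis_of X) (representation (basis_of Z) (g x) c *s f c) b =
        representation (basis_of Z) (g x) c * representation (basis_of X) (f c) b" if "c \<in> basis_of Z" for c
      using that bX bZ f(2) by (subst representation_scale) (simp_all, blast)
    ultimately show ?thesis by simp
  qed
  have "trace_on X (\<lambda>x. f (g x)) = (\<Sum>b\<in>basis_of X. \<Sum>c\<in>basis_of Z.
      representation (basis_of Z) (g b) c * representation (basis_of X) (f c) b)"
    unfolding trace_on_eq
    using basis_of(4)[OF X] by (intro sum.cong refl expand X Z f g) auto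
  also have "\<dots> = (\<Sum>c\<in>basis_of Z. \<Sum>b\<in>basis_of X.
      representation (basis_of X) (f c) b * representation (basis_of Z) (g b) c)"
    by (subst sum.swap) (simp add: mult.commute)
  also have "\<dots> = trace_on Z (\<lambda>x. g (f x))"
    unfolding trace_on_eq
    using basis_of(4)[OF Z] by (intro sum.cong refl expand[symmetric] X Z f g) auto
  finally show ?thesis .
qed

end

subsection \<open>A convolution identity for divisor sums\<close>

definition sigma :: "nat \<Rightarrow> nat \<Rightarrow> real" where
  "sigma j m = (\<Sum>s | s dvd m. real s ^ j)"

lemma sigma_nonneg: "sigma j m \<ge> 0"
  by (simp add: sigma_def sum_nonneg)

lemma sigma_pos: "m > 0 \<Longrightarrow> sigma j m > 0"
  unfolding sigma_def by (rule sum_pos2[where i = 1]) auto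

text \<open>\<open>a\<close> and \<open>b\<close> are divisors, \<open>x\<close> and
  \<open>y\<close> their cofactors: a quadruple splits \<open>m\<close> into two positive parts and
  chooses a divisor of each.\<close>

definition quads :: "nat \<Rightarrow> (nat \<times> nat \<times> nat \<times> nat) set" where
  "quads m = {(a, x, b, y). 0 < a \<and> 0 < x \<and> 0 < b \<and> 0 < y \<and> a * x + b * y = m}"

lemma finite_quads: "finite (quads m)"
proof (rule finite_subset)
  show "quads m \<subseteq> {..m} \<times> {..m} \<times> {..m} \<times> {..m}"
  proof
    fix q assume "q \<in> quads m"
    then obtain a x b y where q: "q = (a, x, b, y)" "0 < a" "0 < x" "0 < b" "0 < y" "a * x + b * y = m"
      by (auto simp: quads_def)
    then have "a \<le> a * x" "x \<le> a * x" "b \<le> b * y" "y \<le> b * y" by auto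
    with q(6) have "a \<le> m" "x \<le> m" "b \<le> m" "y \<le> m" by linarith+
    then show "q \<in> {..m} \<times> {..m} \<times> {..m} \<times> {..m}"
      using q(1) by auto
  qed
qed auto

lemma sum_quads_mult:
  "(\<Sum>(a, x, b, y)\<in>quads m. real a * real b) = (\<Sum>l\<in>{1..<m}. sigma 1 l * sigma 1 (m - l))"
proof -
  have "(\<Sum>l\<in>{1..<m}. sigma 1 l * sigma 1 (m - l)) =
      (\<Sum>l\<in>{1..<m}. \<Sum>(a, b)\<in>{a. a dvd l} \<times> {b. b dvd m - l}. real a * real b)"
    by (simp add: sigma_def sum_product sum.cartesian_product)
  also have "\<dots> = (\<Sum>(l, a, b)\<in>Sigma {1..<m} (\<lambda>l. {a. a dvd l} \<times> {b. b dvd m - l}). real a * real b)"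
    by (subst sum.Sigma) auto
  also have "\<dots> = (\<Sum>(a, x, b, y)\<in>quads m. real a * real b)"
    by (rule sum.reindex_bij_witness[where
          j = "\<lambda>(l, a, b). (a, l div a, b, (m - l) div b)" and i = "\<lambda>(a, x, b, y). (a * x, a, b)"])
      (auto simp: quads_def elim!: dvdE intro!: Nat.gr0I, auto split: if_splits)
  finally show ?thesis by simp
qed

text \<open>With \<open>a = b\<close> the equation becomes \<open>a * (x + y) = m\<close>, so each
  divisor \<open>a\<close> leaves \<open>m div a - 1\<close> choices of \<open>x\<close>.\<close>

lemma sum_quads_diag_left:
  assumes "m > 0"
  shows "(\<Sum>(a, x, b, y)\<in>{(a, x, b, y) \<in> quads m. a = b}. real a ^ 2) = real m * sigma 1 m - sigma 2 m"
proof -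
  have "(\<Sum>(a, x, b, y)\<in>{(a, x, b, y) \<in> quads m. a = b}. real a ^ 2) =
      (\<Sum>(a, x)\<in>Sigma {a. a dvd m} (\<lambda>a. {1..<m div a}). real a ^ 2)"
    by (rule sum.reindex_bij_witness[where
          i = "\<lambda>(a, x). (a, x, a, m div a - x)" and j = "\<lambda>(a, x, b, y). (a, x)"])
      (use assms in \<open>auto simp: quads_def simp flip: distrib_left elim!: dvdE\<close>)
  also have "\<dots> = (\<Sum>a | a dvd m. real (m div a - 1) * real a ^ 2)"
    using assms by (subst sum.Sigma[symmetric]) auto
  also have "\<dots> = (\<Sum>a | a dvd m. real m * real a - real a ^ 2)"
  proof (intro sum.cong refl)
    fix a assume "a \<in> {a. a dvd m}"
    then obtain b where b: "m = a * b" by auto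
    then have "a > 0" "b > 0" using assms by auto
    then show "real (m div a - 1) * real a ^ 2 = real m * real a - real a ^ 2"
      using b by (simp add: of_nat_diff algebra_simps power2_eq_square)
  qed
  finally show ?thesis
    by (simp add: sigma_def sum_subtractf sum_distrib_left)
qed

lemma sum_form_fixed_sum:
  "(\<Sum>a\<in>{1..<c}. real a ^ 2 + real a * real (c - a) + real (c - a) ^ 2) =
    5 / 6 * real c ^ 3 - real c ^ 2 + real c / 6"
proof -
  have s1: "(\<Sum>a\<in>{1..<c}. real a) = real c * (real c - 1) / 2"
  proof (induction c)
    case (Suc c)
    then show ?case by (cases "c = 0") (auto simp: field_simps)
  qed auto
  have s2: "(\<Sum>a\<in>{1..<c}. real a ^ 2) = real c * (real c - 1) * (2 * real c - 1) / 6"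
  proof (induction c)
    case (Suc c)
    then show ?case by (cases "c = 0") (auto simp: field_simps power2_eq_square)
  qed auto
  have "(\<Sum>a\<in>{1..<c}. real a ^ 2 + real a * real (c - a) + real (c - a) ^ 2) =
      (\<Sum>a\<in>{1..<c}. real c ^ 2 - real c * real a + real a ^ 2)"
    by (intro sum.cong refl) (auto simp: of_nat_diff algebra_simps power2_eq_square)
  also have "\<dots> = real (c - 1) * real c ^ 2 - real c * (\<Sum>a\<in>{1..<c}. real a) + (\<Sum>a\<in>{1..<c}. real a ^ 2)"
    by (simp add: sum.distrib sum_subtractf sum_distrib_left)
  also have "\<dots> = 5 / 6 * real c ^ 3 - real c ^ 2 + real c / 6"
    unfolding s1 s2 by (cases "c = 0") (auto simp: of_nat_diff field_simps power2_eq_square power3_eq_cube)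
  finally show ?thesis .
qed

text \<open>With \<open>x = y\<close> the equation becomes \<open>(a + b) * x = m\<close>:
  \<open>c = a + b\<close> runs through the divisors of \<open>m\<close>, and
  \<open>sum_form_fixed_sum\<close> evaluates the splittings of each \<open>c\<close>.\<close>

lemma sum_quads_diag_right:
  assumes "m > 0"
  shows "(\<Sum>(a, x, b, y)\<in>{(a, x, b, y) \<in> quads m. x = y}. real a ^ 2 + real a * real b + real b ^ 2) =
    5 / 6 * sigma 3 m - sigma 2 m + sigma 1 m / 6"
proof -
  have "(\<Sum>(a, x, b, y)\<in>{(a, x, b, y) \<in> quads m. x = y}. real a ^ 2 + real a * real b + real b ^ 2) =
      (\<Sum>(c, a)\<in>Sigma {c. c dvd m} (\<lambda>c. {1..<c}). real a ^ 2 + real a * real (c - a) + real (c - a) ^ 2)"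
    by (rule sum.reindex_bij_witness[where
          i = "\<lambda>(c, a). (a, m div c, c - a, m div c)" and j = "\<lambda>(a, x, b, y). (a + b, a)"])
      (use assms in \<open>auto simp: quads_def simp flip: distrib_left distrib_right elim!: dvdE\<close>)
  also have "\<dots> = (\<Sum>c | c dvd m. \<Sum>a\<in>{1..<c}. real a ^ 2 + real a * real (c - a) + real (c - a) ^ 2)"
    using assms by (subst sum.Sigma) auto
  finally show ?thesis
    by (simp only: sum_form_fixed_sum) (simp add: sigma_def sum.distrib sum_subtractf sum_distrib_left sum_divide_distrib)
qed

text \<open>With \<open>F a b = a\<^sup>2 + a b + b\<^sup>2\<close> one has \<open>F a c - F a (c - a) = 2 a c\<close>.  Splitting the sum of \<open>F\<close>
  over \<open>a x + b y = m\<close> once according to the order of \<open>a\<close> and \<open>b\<close> and once according to the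
  order of \<open>x\<close> and \<open>y\<close>, where \<open>(a, x, b, y)\<close> with \<open>x > y\<close> becomes \<open>(a, x - y, a + b, y)\<close>, isolates
  the sum of \<open>a b\<close>.\<close>

lemma sigma_convolution:
  assumes "m > 0"
  shows "(\<Sum>l\<in>{1..<m}. sigma 1 l * sigma 1 (m - l)) =
    5 / 12 * sigma 3 m + sigma 1 m / 12 - real m * sigma 1 m / 2"
proof -
  define F where "F a b = real a ^ 2 + real a * real b + real b ^ 2" for a b
  define S where "S P f = (\<Sum>(a, x, b, y)\<in>{(a, x, b, y) \<in> quads m. P a x b y}. f a b)"
    for P :: "nat \<Rightarrow> nat \<Rightarrow> nat \<Rightarrow> nat \<Rightarrow> bool" and f :: "nat \<Rightarrow> nat \<Rightarrow> real"
  have fin: "finite {(a, x, b, y) \<in> quads m. P a x b y}" for P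
    by (rule finite_subset[OF _ finite_quads[of m]]) auto
  have split: "S P f = S (\<lambda>a x b y. P a x b y \<and> R a x b y) f + S (\<lambda>a x b y. P a x b y \<and> \<not> R a x b y) f"
    for P R f
    unfolding S_def
    by (subst sum.union_disjoint[symmetric]) (auto intro!: fin sum.cong)
  have swap: "S P f = S (\<lambda>a x b y. P b y a x) (\<lambda>a b. f b a)" for P f
    unfolding S_def
    by (rule sum.reindex_bij_witness[where i = "\<lambda>(a, x, b, y). (b, y, a, x)" and j = "\<lambda>(a, x, b, y). (b, y, a, x)"])
      (auto simp: quads_def)
  have by_left: "S (\<lambda>_ _ _ _. True) f = S (\<lambda>a x b y. a = b) f + 2 * S (\<lambda>a x b y. a < b) f"
    if "\<And>a b. f a b = f b a" for f
  proof -
    have "S (\<lambda>a x b y. b < a) f = S (\<lambda>a x b y. a < b) f"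
      using swap[of "\<lambda>a x b y. b < a" f] that by simp
    moreover have "(\<lambda>a x b y. a \<noteq> b \<and> \<not> a < b) = (\<lambda>(a::nat) (x::nat) b (y::nat). b < a)"
      "(\<lambda>a x b y. a \<noteq> b \<and> a < b) = (\<lambda>(a::nat) (x::nat) b (y::nat). a < b)"
      by (auto simp: fun_eq_iff)
    ultimately show ?thesis
      using split[of "\<lambda>_ _ _ _. True" f "\<lambda>a x b y. a = b"]
        split[of "\<lambda>a x b y. a \<noteq> b" f "\<lambda>a x b y. a < b"] by simp
  qed
  have by_right: "S (\<lambda>_ _ _ _. True) f = S (\<lambda>a x b y. x = y) f + 2 * S (\<lambda>a x b y. y < x) f"
    if "\<And>a b. f a b = f b a" for f
  proof -
    have "S (\<lambda>a x b y. x < y) f = S (\<lambda>a x b y. y < x) f"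
      using swap[of "\<lambda>a x b y. x < y" f] that by simp
    moreover have "(\<lambda>a x b y. x \<noteq> y \<and> \<not> y < x) = (\<lambda>(a::nat) (x::nat) (b::nat) (y::nat). x < y)"
      "(\<lambda>a x b y. x \<noteq> y \<and> y < x) = (\<lambda>(a::nat) (x::nat) (b::nat) (y::nat). y < x)"
      by (auto simp: fun_eq_iff)
    ultimately show ?thesis
      using split[of "\<lambda>_ _ _ _. True" f "\<lambda>a x b y. x = y"]
        split[of "\<lambda>a x b y. x \<noteq> y" f "\<lambda>a x b y. y < x"] by simp
  qed
  have shear: "S (\<lambda>a x b y. y < x) F = S (\<lambda>a x b y. a < b) (\<lambda>a b. F a (b - a))"
    unfolding S_def
    by (rule sum.reindex_bij_witness[where
          i = "\<lambda>(a, x, c, y). (a, x + y, c - a, y)" and j = "\<lambda>(a, x, b, y). (a, x - y, a + b, y)"])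
      (auto simp: quads_def algebra_simps diff_mult_distrib diff_mult_distrib2 intro!: mult_le_mono1,
        metis le_add_diff_inverse less_imp_le mult_le_mono2 trans_le_add1)
  have diff: "S (\<lambda>a x b y. a < b) F - S (\<lambda>a x b y. a < b) (\<lambda>a b. F a (b - a)) =
      2 * S (\<lambda>a x b y. a < b) (\<lambda>a b. real a * real b)"
    unfolding S_def sum_subtractf[symmetric] sum_distrib_left F_def
    by (intro sum.cong refl) (auto simp: of_nat_diff algebra_simps power2_eq_square)
  have sym: "F a b = F b a" for a b by (simp add: F_def)
  have e1: "S (\<lambda>a x b y. a = b) (\<lambda>a b. real a * real b) = real m * sigma 1 m - sigma 2 m"
    unfolding sum_quads_diag_left[OF assms, symmetric] S_def
    by (intro sum.cong) (auto simp: power2_eq_square)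
  have e2: "S (\<lambda>a x b y. a = b) F = 3 * (real m * sigma 1 m - sigma 2 m)"
    unfolding sum_quads_diag_left[OF assms, symmetric] S_def sum_distrib_left
    by (intro sum.cong) (auto simp: power2_eq_square F_def)
  have e3: "S (\<lambda>a x b y. x = y) F = 5 / 6 * sigma 3 m - sigma 2 m + sigma 1 m / 6"
    unfolding sum_quads_diag_right[OF assms, symmetric] S_def F_def ..
  have e4: "S (\<lambda>_ _ _ _. True) (\<lambda>a b. real a * real b) = (\<Sum>l\<in>{1..<m}. sigma 1 l * sigma 1 (m - l))"
    unfolding sum_quads_mult[symmetric] S_def by simp
  \<comment> \<open>Equating the two splittings of the sum of \<open>F\<close> expresses four times
    the sum of \<open>a * b\<close> over \<open>a < b\<close> as the value in \<open>e3\<close>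
    minus the value in \<open>e2\<close>. Half of this plus the diagonal \<open>e1\<close> is the
    convolution, and the \<open>sigma 2\<close> terms cancel.\<close>
  show ?thesis
    using by_left[of F, OF sym] by_right[of F, OF sym] by_left[of "\<lambda>a b. real a * real b"] shear diff e1 e2 e3 e4
    by (simp add: field_simps)
qed

subsection \<open>The universal property of induced modules\<close>

lemma words_act_superset:
  assumes "vector_space sc" "finite K" "Poly_Mapping.keys f \<subseteq> K"
  shows "words_act sc act v0 f = (\<Sum>w\<in>K. sc (Poly_Mapping.lookup f w) (foldr act w v0))"
proof -
  interpret vector_space sc by (rule assms)
  show ?thesis
    unfolding words_act_def
    by (rule sum.mono_neutral_left) (use assms in \<open>auto simp: in_keys_iff\<close>)
qed

lemma linear_words_act:
  assumes "vector_space sc"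
  shows "Vector_Spaces.linear words_scale sc (words_act sc act v0)"
proof -
  interpret vector_space sc by (rule assms)
  have "words_act sc act v0 (f + g) = words_act sc act v0 f + words_act sc act v0 g" for f g
  proof -
    let ?K = "Poly_Mapping.keys f \<union> Poly_Mapping.keys g"
    have "Poly_Mapping.keys (f + g) \<subseteq> ?K" by (rule keys_add)
    then show ?thesis
      by (simp add: words_act_superset[OF assms, of ?K] lookup_add scale_left_distrib sum.distrib)
  qed
  moreover have "words_act sc act v0 (words_scale c f) = sc c (words_act sc act v0 f)" for c f
  proof -
    have "Poly_Mapping.keys (words_scale c f) \<subseteq> Poly_Mapping.keys f"
      by (auto simp: in_keys_iff lookup_words_scale)
    then show ?thesis
      by (simp add: words_act_superset[OF assms, of "Poly_Mapping.keys f"] lookup_words_scale scale_sum_right)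
  qed
  ultimately show ?thesis
    unfolding Vector_Spaces.linear_iff using words.vector_space_axioms vector_space_axioms by blast
qed

lemma words_act_word:
  assumes "vector_space sc"
  shows "words_act sc act v0 (word xs) = foldr act xs v0"
proof -
  interpret vector_space sc by (rule assms)
  show ?thesis by (simp add: words_act_def)
qed

lemma words_act_kills_relations:
  assumes rep: "lie_representation sg br sc act" and \<chi>: "\<And>x. x \<in> b \<Longrightarrow> act x v0 = sc (\<chi> x) v0"
    and vs: "vector_space sc" and f: "f \<in> words.span (induced_relations sg br b \<chi>)"
  shows "words_act sc act v0 f = 0"
proof -
  interpret vector_space sc by (rule vs)
  interpret w: Vector_Spaces.linear words_scale sc "words_act sc act v0" by (rule linear_words_act[OF vs])
  have add1: "act (x + y) v = act x v + act y v" and sc1: "act (sg c x) v = sc c (act x v)"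
    and add2: "act x (v + w) = act x v + act x w" and sc2: "act x (sc c v) = sc c (act x v)"
    and brk: "act (br x y) v = act x (act y v) - act y (act x v)" for x y v w c
    using rep unfolding lie_representation_def Vector_Spaces.linear_iff by blast+
  have diff2: "act x (v - w) = act x v - act x w" for x v w
    using add2[of x "v - w" w] by (simp add: algebra_simps)
  have f_add: "foldr act u (v + w) = foldr act u v + foldr act u w" for u v w
    by (induction u) (simp_all add: add2)
  have f_sc: "foldr act u (sc c v) = sc c (foldr act u v)" for u c v
    by (induction u) (simp_all add: sc2)
  have f_diff: "foldr act u (v - w) = foldr act u v - foldr act u w" for u v w
    by (induction u) (simp_all add: diff2)
  have "words_act sc act v0 r = 0" if "r \<in> induced_relations sg br b \<chi>" for r
    using that unfolding induced_relations_def
    by (auto simp: w.diff w.scale words_act_word[OF vs] add1 sc1 f_add f_sc brk f_diff \<chi>)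
  moreover have "words.subspace {f. words_act sc act v0 f = 0}"
    by (auto simp: words.subspace_def w.add w.scale)
  ultimately show ?thesis
    using words.span_minimal[of "induced_relations sg br b \<chi>" "{f. words_act sc act v0 f = 0}"] f by blast
qed

text \<open>Frobenius reciprocity. The map from words to the second module kills the relations,
  which span the kernel of the map to the first, so it factors through that surjection.\<close>

lemma induced_module_universal:
  assumes ind: "is_induced_module sg br b \<chi> sc act v0" and vs: "vector_space sc"
    and rep': "lie_representation sg br sc' act'" and \<chi>': "\<And>x. x \<in> b \<Longrightarrow> act' x v0' = sc' (\<chi> x) v0'"
    and vs': "vector_space sc'"
  shows "\<exists>\<Phi>. Vector_Spaces.linear sc sc' \<Phi> \<and> \<Phi> v0 = v0' \<and> (\<forall>x v. \<Phi> (act x v) = act' x (\<Phi> v))"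
proof -
  interpret V: vector_space sc by (rule vs)
  interpret V': vector_space sc' by (rule vs')
  let ?w = "words_act sc act v0" and ?w' = "words_act sc' act' v0'"
  interpret w: Vector_Spaces.linear words_scale sc ?w by (rule linear_words_act[OF vs])
  interpret w': Vector_Spaces.linear words_scale sc' ?w' by (rule linear_words_act[OF vs'])
  have surj: "surj ?w" and ker: "{f. ?w f = 0} = words.span (induced_relations sg br b \<chi>)"
    and rep: "lie_representation sg br sc act"
    using ind unfolding is_induced_module_def by auto
  have wd: "?w' f = ?w' g" if "?w f = ?w g" for f g
  proof -
    have "f - g \<in> words.span (induced_relations sg br b \<chi>)"
      using that unfolding ker[symmetric] by (simp add: w.diff)
    then have "?w' (f - g) = 0"
      by (rule words_act_kills_relations[OF rep' _ vs', rotated]) (rule \<chi>')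
    then show ?thesis by (simp add: w'.diff)
  qed
  define \<Phi> where "\<Phi> v = ?w' (SOME f. ?w f = v)" for v
  have \<Phi>: "\<Phi> (?w f) = ?w' f" for f
    unfolding \<Phi>_def by (rule wd) (metis (mono_tags, lifting) someI)
  have ex: "\<exists>f. v = ?w f" for v using surj by (metis surjD)
  have "\<Phi> (v + v') = \<Phi> v + \<Phi> v'" for v v'
    using ex[of v] ex[of v'] by (auto simp: \<Phi> w'.add simp flip: w.add)
  moreover have "\<Phi> (sc c v) = sc' c (\<Phi> v)" for c v
    using ex[of v] by (auto simp: \<Phi> w'.scale simp flip: w.scale)
  ultimately have lin: "Vector_Spaces.linear sc sc' \<Phi>"
    unfolding Vector_Spaces.linear_iff using vs vs' by blast
  have "\<Phi> v0 = v0'"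
    using \<Phi>[of "word []"] by (simp add: words_act_word[OF vs] words_act_word[OF vs'])
  moreover have "\<Phi> (act x v) = act' x (\<Phi> v)" for x v
  proof -
    obtain f where f: "v = ?w f" using ex by blast
    \<comment> \<open>\<open>g\<close> is \<open>f\<close> with the letter \<open>x\<close> put in
      front of every word.\<close>
    define g where "g = (\<Sum>w\<in>Poly_Mapping.keys f. words_scale (Poly_Mapping.lookup f w) (word (x # w)))"
    interpret a: Vector_Spaces.linear sc sc "act x"
      using rep by (simp add: lie_representation_def)
    interpret a': Vector_Spaces.linear sc' sc' "act' x"
      using rep' by (simp add: lie_representation_def)
    have "act x (?w f) = ?w g"
      unfolding g_def w.sum w.scale words_act_word[OF vs] by (simp add: words_act_def a.sum a.scale)
    moreover have "act' x (?w' f) = ?w' g"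
      unfolding g_def w'.sum w'.scale words_act_word[OF vs'] by (simp add: words_act_def a'.sum a'.scale)
    ultimately show ?thesis using f \<Phi> by simp
  qed
  ultimately show ?thesis using lin by blast
qed

subsection \<open>The Fock representation of the Heisenberg algebra\<close>

text \<open>The function \<open>f\<close> stands for the polynomial \<open>\<Sum>M. f M * (\<Prod>s\<in>#M. x\<^sub>s) / \<Prod>s (count M s)!\<close>, so
  the annihilation operators are the partial derivatives and the creation operators are the
  multiplications by the variables.\<close>

type_synonym fock = "(nat \<times> nat) multiset \<Rightarrow> complex"

definition fock_scale :: "complex \<Rightarrow> fock \<Rightarrow> fock" where
  "fock_scale c f = (\<lambda>M. c * f M)"

interpretation fock: vector_space fock_scale
  by unfold_locales (auto simp: fock_scale_def fun_eq_iff algebra_simps)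

definition fock_vac :: fock where
  "fock_vac = (\<lambda>M. if M = {#} then 1 else 0)"

text \<open>The scalar \<open>m\<close> of the Heisenberg relation sits entirely on the
  annihilators. Creation needs no membership test: if the variable does not occur in
  \<open>M\<close>, its count is 0 and the value of \<open>f\<close> at the truncated difference is
  irrelevant. Mode 0 is zero, as it is on \<open>M(1)\<close>.\<close>

definition fock_mode :: "nat \<Rightarrow> int \<Rightarrow> fock \<Rightarrow> fock" where
  "fock_mode i m f =
     (\<lambda>M. if m > 0 then of_int m * f (add_mset (i, nat m) M)
          else if m < 0 then of_nat (count M (i, nat (- m))) * f (M - {#(i, nat (- m))#})
          else 0)"

lemma fock_mode_commutator:
  "fock_mode i m (fock_mode j n f) M - fock_mode j n (fock_mode i m f) M =
     (if i = j \<and> m + n = 0 then of_int m * f M else 0)"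
proof -
  have create: "count M s * count (M - {#s#}) t * f (M - {#s#} - {#t#}) =
      count M t * count (M - {#t#}) s * f (M - {#t#} - {#s#})" for s t
    by (cases "s = t") (auto simp: diff_right_commute add_mset_commute)
  \<comment> \<open>The Leibniz rule: differentiation by variable \<open>s\<close> against
    multiplication by variable \<open>t\<close>, without the scalar \<open>m\<close>.\<close>
  have mixed: "of_nat (count (add_mset s M) t) * f (add_mset s M - {#t#}) -
      of_nat (count M t) * f (add_mset s (M - {#t#})) = (if s = t then f M else 0)" for s t
  proof (cases "s = t")
    case True
    show ?thesis
    proof (cases "t \<in># M")
      case True
      then show ?thesis using \<open>s = t\<close> by (simp add: algebra_simps)
    next
      case False
      then show ?thesis using \<open>s = t\<close> by (simp add: not_in_iff)
    qed
  next
    case False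
    show ?thesis
    proof (cases "t \<in># M")
      case True
      then show ?thesis using \<open>s \<noteq> t\<close> by (simp add: diff_union_swap2)
    next
      case False
      then show ?thesis using \<open>s \<noteq> t\<close> by (simp add: not_in_iff)
    qed
  qed
  consider "m = 0 \<or> n = 0" | "m > 0" "n > 0" | "m < 0" "n < 0" | "m > 0" "n < 0" | "m < 0" "n > 0"
    by linarith
  then show ?thesis
  proof cases
    case 3
    then show ?thesis
      using create[of "(i, nat (- m))" "(j, nat (- n))"] by (auto simp: fock_mode_def mult.assoc)
  next
    case 4
    then have "fock_mode i m (fock_mode j n f) M - fock_mode j n (fock_mode i m f) M =
        of_int m * (if (i, nat m) = (j, nat (- n)) then f M else 0)"
      unfolding mixed[symmetric] by (simp add: fock_mode_def algebra_simps)
    then show ?thesis using 4 by (auto simp: nat_eq_iff)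
  next
    case 5
    then have "fock_mode i m (fock_mode j n f) M - fock_mode j n (fock_mode i m f) M =
        - of_int n * (if (j, nat n) = (i, nat (- m)) then f M else 0)"
      unfolding mixed[symmetric] by (simp add: fock_mode_def algebra_simps)
    then show ?thesis using 5 by (auto simp: nat_eq_iff)
  qed (auto simp: fock_mode_def add_mset_commute)
qed

context heisenberg
begin

lemma form_add: "form x (y + z) = form x y + form x z" "form (y + z) x = form y x + form z x"
  and form_scale: "form x (scaleh c y) = c * form x y" "form (scaleh c y) x = c * form y x"
  using form_linear[of x] form_sym unfolding Vector_Spaces.linear_iff by metis+

lemma form_0: "form x 0 = 0" "form 0 x = 0"
  using form_scale(1)[of x 0 0] form_scale(2)[of 0 0 x] by simp_all

lemma form_orthonormal_expansion:
  assumes "orthonormal_basis hs"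
  shows "form x y = (\<Sum>i<d. form x (hs i) * form y (hs i))"
proof -
  have "x \<in> \<hh>.span (hs ` {..<d})" using assms by (simp add: orthonormal_basis_def)
  then show ?thesis
  proof (induction rule: \<hh>.span_induct_alt)
    case base
    then show ?case by (simp add: form_0)
  next
    case (step c u z)
    then obtain j where j: "j < d" "u = hs j" by auto
    have "(\<Sum>i<d. form u (hs i) * form y (hs i)) = (\<Sum>i<d. if i = j then form y (hs i) else 0)"
      using assms j by (intro sum.cong) (auto simp: orthonormal_basis_def)
    also have "\<dots> = form u y" using j by (simp add: form_sym)
    finally show ?case
      using step by (simp add: form_add form_scale sum.distrib distrib_right mult.assoc flip: sum_distrib_left)
  qed
qed

definition fock_act :: "(nat \<Rightarrow> 'h) \<Rightarrow> 'h affine \<Rightarrow> fock \<Rightarrow> fock" where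
  "fock_act hs X f = (\<lambda>M. snd X * f M +
     (\<Sum>i<d. \<Sum>m\<in>Poly_Mapping.keys (fst X). form (Poly_Mapping.lookup (fst X) m) (hs i) * fock_mode i m f M))"

lemma fock_act_superset:
  assumes "finite K" "Poly_Mapping.keys (fst X) \<subseteq> K"
  shows "fock_act hs X f = (\<lambda>M. snd X * f M +
     (\<Sum>(i, m)\<in>{..<d} \<times> K. form (Poly_Mapping.lookup (fst X) m) (hs i) * fock_mode i m f M))"
proof -
  have "(\<Sum>m\<in>Poly_Mapping.keys (fst X). form (Poly_Mapping.lookup (fst X) m) (hs i) * fock_mode i m f M) =
    (\<Sum>m\<in>K. form (Poly_Mapping.lookup (fst X) m) (hs i) * fock_mode i m f M)" for i M
    by (rule sum.mono_neutral_left) (use assms in \<open>auto simp: in_keys_iff form_0\<close>)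
  then show ?thesis by (simp add: fock_act_def sum.cartesian_product)
qed

lemma fock_mode_linear:
  "fock_mode i m (f + g) = fock_mode i m f + fock_mode i m g"
  "fock_mode i m (fock_scale c f) = fock_scale c (fock_mode i m f)"
  by (auto simp: fock_mode_def fock_scale_def fun_eq_iff algebra_simps)

lemma fock_mode_lincomb:
  assumes "finite S"
  shows "fock_mode i m (\<lambda>M. c * f M + (\<Sum>s\<in>S. z s * F s M)) M =
    c * fock_mode i m f M + (\<Sum>s\<in>S. z s * fock_mode i m (F s) M)"
  by (auto simp: fock_mode_def algebra_simps sum_distrib_left)

lemma affine_vector_space: "vector_space affine_scale"
  by unfold_locales
    (auto intro!: poly_mapping_eqI simp: affine_scale_def Poly_Mapping.map.rep_eq lookup_add when_def
      algebra_simps \<hh>.scale_right_distrib \<hh>.scale_left_distrib prod_eq_iff simp flip: \<hh>.scale_right_distrib)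

text \<open>Both operators are scalars plus finite combinations of modes, so only pairs
  \<open>(i, m)\<close>, \<open>(i, - m)\<close> contribute to the commutator. Orthonormality then
  reassembles the sum over \<open>i\<close> into \<open>form\<close>.\<close>

lemma fock_act_bracket:
  assumes "orthonormal_basis hs"
  shows "fock_act hs (affine_bracket X Z) f = fock_act hs X (fock_act hs Z f) - fock_act hs Z (fock_act hs X f)"
proof
  fix M
  define K where "K = Poly_Mapping.keys (fst X) \<union> Poly_Mapping.keys (fst Z) \<union> uminus ` Poly_Mapping.keys (fst Z)"
  define S where "S = {..<d} \<times> K"
  define x z where "x = (\<lambda>(i, m). form (Poly_Mapping.lookup (fst X) m) (hs i))"
    and "z = (\<lambda>(i, m). form (Poly_Mapping.lookup (fst Z) m) (hs i))"
  define E where "E = (\<lambda>(i, m). fock_mode i m)"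
  have fin: "finite K" "finite S" by (auto simp: K_def S_def)
  have aX: "fock_act hs X g = (\<lambda>M. snd X * g M + (\<Sum>s\<in>S. x s * E s g M))"
    and aZ: "fock_act hs Z g = (\<lambda>M. snd Z * g M + (\<Sum>s\<in>S. z s * E s g M))" for g
    by (subst fock_act_superset[OF fin(1)];
        auto simp: K_def S_def x_def z_def E_def case_prod_unfold)+
  have lin: "E s (\<lambda>M. c * g M + (\<Sum>t\<in>S. u t * E t g M)) M = c * E s g M + (\<Sum>t\<in>S. u t * E s (E t g) M)" for s c g u
    unfolding E_def case_prod_unfold by (rule fock_mode_lincomb[OF fin(2)])
  have "(fock_act hs X (fock_act hs Z f) - fock_act hs Z (fock_act hs X f)) M =
      (\<Sum>s\<in>S. \<Sum>t\<in>S. x s * z t * E s (E t f) M) - (\<Sum>s\<in>S. \<Sum>t\<in>S. x t * z s * E s (E t f) M)"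
    unfolding minus_apply aX aZ lin
    by (simp add: algebra_simps sum.distrib sum_distrib_left)
  also have "\<dots> = (\<Sum>s\<in>S. \<Sum>t\<in>S. x s * z t * (E s (E t f) M - E t (E s f) M))"
    by (subst (2) sum.swap) (simp add: sum_subtractf algebra_simps)
  also have "\<dots> = (\<Sum>s\<in>S. \<Sum>t\<in>S. if t = (fst s, - snd s) then x s * z t * of_int (snd s) * f M else 0)"
    by (intro sum.cong refl) (auto simp: E_def case_prod_unfold fock_mode_commutator prod_eq_iff)
  also have "\<dots> = (\<Sum>s\<in>S. x s * z (fst s, - snd s) * of_int (snd s) * f M)"
  proof (intro sum.cong refl)
    fix s assume s: "s \<in> S"
    have "z (fst s, - snd s) = 0" if "(fst s, - snd s) \<notin> S"
    proof -
      have "- snd s \<notin> Poly_Mapping.keys (fst Z)"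
        using that s by (auto simp: S_def K_def)
      then show ?thesis by (simp add: z_def in_keys_iff form_0)
    qed
    then show "(\<Sum>t\<in>S. if t = (fst s, - snd s) then x s * z t * of_int (snd s) * f M else 0) =
        x s * z (fst s, - snd s) * of_int (snd s) * f M"
      using fin(2) by auto
  qed
  also have "\<dots> = (\<Sum>m\<in>K. \<Sum>i<d. x (i, m) * z (i, - m) * of_int m * f M)"
    unfolding S_def by (subst sum.swap, subst sum.cartesian_product) (simp add: case_prod_unfold)
  also have "\<dots> = (\<Sum>m\<in>K. of_int m * form (Poly_Mapping.lookup (fst X) m) (Poly_Mapping.lookup (fst Z) (- m)) * f M)"
    by (intro sum.cong refl, subst form_orthonormal_expansion[OF assms])
      (simp add: x_def z_def sum_distrib_left sum_distrib_right algebra_simps)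
  also have "\<dots> = snd (affine_bracket X Z) * f M"
  proof -
    have "Sum_any (\<lambda>m. of_int m * form (Poly_Mapping.lookup (fst X) m) (Poly_Mapping.lookup (fst Z) (- m))) =
      (\<Sum>m\<in>K. of_int m * form (Poly_Mapping.lookup (fst X) m) (Poly_Mapping.lookup (fst Z) (- m)))"
    proof (rule Sum_any.expand_superset[OF fin(1)])
      show "{a. of_int a * form (Poly_Mapping.lookup (fst X) a) (Poly_Mapping.lookup (fst Z) (- a)) \<noteq> 0} \<subseteq> K"
        by (auto simp: K_def in_keys_iff form_0)
    qed
    then show ?thesis by (simp add: affine_bracket_def sum_distrib_right)
  qed
  finally show "fock_act hs (affine_bracket X Z) f M =
      (fock_act hs X (fock_act hs Z f) - fock_act hs Z (fock_act hs X f)) M"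
    by (simp add: fock_act_def affine_bracket_def)
qed

lemma fock_representation:
  assumes "orthonormal_basis hs"
  shows "lie_representation affine_scale affine_bracket fock_scale (fock_act hs)"
proof -
  have "fock_act hs (X + Z) f = fock_act hs X f + fock_act hs Z f" for X Z f
  proof -
    let ?K = "Poly_Mapping.keys (fst X) \<union> Poly_Mapping.keys (fst Z)"
    have "Poly_Mapping.keys (fst (X + Z)) \<subseteq> ?K" by (simp add: keys_add)
    then show ?thesis
      by (simp add: fock_act_superset[of ?K] lookup_add form_add fun_eq_iff case_prod_unfold
          sum.distrib algebra_simps)
  qed
  moreover have "fock_act hs (affine_scale c X) f = fock_scale c (fock_act hs X f)" for c X f
  proof -
    let ?K = "Poly_Mapping.keys (fst X)"
    have l: "Poly_Mapping.lookup (fst (affine_scale c X)) m = scaleh c (Poly_Mapping.lookup (fst X) m)" for m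
      by (simp add: affine_scale_def Poly_Mapping.map.rep_eq when_def)
    have "Poly_Mapping.keys (fst (affine_scale c X)) \<subseteq> ?K"
      by (auto simp: in_keys_iff l)
    then show ?thesis
      by (simp add: fock_act_superset[of ?K] l form_scale fun_eq_iff case_prod_unfold fock_scale_def
          sum_distrib_left algebra_simps) (simp add: affine_scale_def)
  qed
  moreover have "fock_act hs X (f + g) = fock_act hs X f + fock_act hs X g"
    "fock_act hs X (fock_scale c f) = fock_scale c (fock_act hs X f)" for X f g c
    by (auto simp: fock_act_def fock_mode_linear fun_eq_iff sum.distrib algebra_simps)
      (auto simp: fock_scale_def sum_distrib_left algebra_simps)
  ultimately show ?thesis
    unfolding lie_representation_def Vector_Spaces.linear_iff
    using affine_vector_space fock.vector_space_axioms fock_act_bracket[OF assms] by blast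
qed

lemma fock_act_mode:
  assumes "orthonormal_basis hs" "i < d"
  shows "fock_act hs (mode (hs i) m) f = fock_mode i m f"
proof
  fix M
  have "fock_act hs (mode (hs i) m) f M = (\<Sum>j<d. form (hs i) (hs j) * fock_mode j m f M)"
    by (subst fock_act_superset[of "{m}"]) (auto simp: mode_def sum.cartesian_product[symmetric])
  also have "\<dots> = (\<Sum>j<d. if j = i then fock_mode j m f M else 0)"
    using assms by (intro sum.cong) (auto simp: orthonormal_basis_def)
  finally show "fock_act hs (mode (hs i) m) f M = fock_mode i m f M"
    using assms by simp
qed

lemma fock_act_nonneg:
  assumes "X \<in> affine_nonneg"
  shows "fock_act hs X fock_vac = fock_scale (level_one X) fock_vac"
  using assms unfolding affine_nonneg_def
  by (force simp: fock_act_def fock_mode_def fock_vac_def fock_scale_def level_one_def fun_eq_iff in_keys_iff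
      intro!: sum.neutral)

end

subsection \<open>The Shapovalov-type form on the Fock space\<close>

text \<open>The squared norm that the contravariant form gives to a monomial divided by the
  factorials of its multiplicities. The \<open>max 1\<close> keeps it positive on variables with
  second index 0.\<close>

definition fock_weight :: "(nat \<times> nat) multiset \<Rightarrow> real" where
  "fock_weight M = (\<Prod>s\<in>#M. real (max 1 (snd s))) / (\<Prod>s\<in>set_mset M. fact (count M s))"

lemma fock_weight_pos: "fock_weight M > 0"
proof -
  have "(\<Prod>s\<in>#M. real (max 1 (snd s))) > 0"
    by (induction M) (auto simp: max_def)
  then show ?thesis
    by (auto simp: fock_weight_def intro!: divide_pos_pos prod_pos)
qed

lemma fock_weight_add_mset:
  "fock_weight (add_mset s M) * real (count M s + 1) = real (max 1 (snd s)) * fock_weight M"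
proof -
  define P :: "(nat \<times> nat) multiset \<Rightarrow> real" where "P N = (\<Prod>t\<in>insert s (set_mset M). fact (count N t))" for N
  have P: "P N = (\<Prod>t\<in>set_mset N. fact (count N t))" if "set_mset N \<subseteq> insert s (set_mset M)" for N
    unfolding P_def using that
    by (intro prod.mono_neutral_right) (auto simp: not_in_iff)
  have "P N = fact (count N s) * (\<Prod>t\<in>set_mset M - {s}. fact (count N t))" for N
    unfolding P_def by (subst prod.insert_remove) auto
  moreover have "(\<Prod>t\<in>set_mset M - {s}. fact (count (add_mset s M) t)) =
      (\<Prod>t\<in>set_mset M - {s}. fact (count M t) :: real)"
    by (intro prod.cong) auto
  ultimately have "P (add_mset s M) = real (count M s + 1) * P M"
    by (simp add: algebra_simps)
  then have "fock_weight (add_mset s M) =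
      real (max 1 (snd s)) * (\<Prod>s\<in>#M. real (max 1 (snd s))) / (real (count M s + 1) * P M)"
    unfolding fock_weight_def P[of "add_mset s M", symmetric, OF eq_refl[OF set_mset_add_mset_insert]] by simp
  moreover have "fock_weight M = (\<Prod>s\<in>#M. real (max 1 (snd s))) / P M"
    unfolding fock_weight_def by (subst P[symmetric]) auto
  ultimately show ?thesis by (simp del: of_nat_add)
qed

text \<open>Conjugate linear in the second argument. Since \<open>Sum_any\<close> returns 0 on
  infinite support, additivity and definiteness below carry finiteness hypotheses;
  \<open>\<Phi>_finite_support\<close> supplies them on the image of the VOA.\<close>

definition fock_form :: "fock \<Rightarrow> fock \<Rightarrow> complex" where
  "fock_form f g = Sum_any (\<lambda>M. complex_of_real (fock_weight M) * f M * cnj (g M))"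

lemma fock_form_cnj: "fock_form g f = cnj (fock_form f g)"
proof -
  have "{M. complex_of_real (fock_weight M) * g M * cnj (f M) \<noteq> 0} = {M. complex_of_real (fock_weight M) * f M * cnj (g M) \<noteq> 0}"
    by auto
  then show ?thesis
    unfolding fock_form_def Sum_any.expand_set by (simp add: mult_ac)
qed

lemma fock_form_superset:
  assumes "finite K" "{M. f M \<noteq> 0} \<subseteq> K"
  shows "fock_form f g = (\<Sum>M\<in>K. complex_of_real (fock_weight M) * f M * cnj (g M))"
  unfolding fock_form_def using assms by (intro Sum_any.expand_superset) auto

lemma fock_form_add:
  assumes "finite {M. f M \<noteq> 0}" "finite {M. f' M \<noteq> 0}"
  shows "fock_form (f + f') g = fock_form f g + fock_form f' g"
proof -
  have "{M. (f + f') M \<noteq> 0} \<subseteq> {M. f M \<noteq> 0} \<union> {M. f' M \<noteq> 0}" by auto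
  then show ?thesis
    using assms
    by (simp add: fock_form_superset[of "{M. f M \<noteq> 0} \<union> {M. f' M \<noteq> 0}"] algebra_simps sum.distrib)
qed

lemma fock_form_scale: "fock_form (fock_scale c f) g = c * fock_form f g"
proof (cases "c = 0")
  case True
  then show ?thesis by (simp add: fock_form_def fock_scale_def)
next
  case False
  then have "{M. complex_of_real (fock_weight M) * fock_scale c f M * cnj (g M) \<noteq> 0} = {M. complex_of_real (fock_weight M) * f M * cnj (g M) \<noteq> 0}"
    by (auto simp: fock_scale_def)
  then show ?thesis
    unfolding fock_form_def Sum_any.expand_set by (simp add: fock_scale_def sum_distrib_left mult_ac)
qed

text \<open>For \<open>m > 0\<close> both sides are one sum, indexed on the left by \<open>M\<close>
  and on the right by \<open>add_mset (i, nat m) M\<close>; multisets without this variable have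
  creation coefficient 0. Negative \<open>m\<close> follows by conjugate symmetry.\<close>

lemma fock_form_adjoint: "fock_form (fock_mode i m f) g = fock_form f (fock_mode i (- m) g)"
proof -
  have pos: "fock_form (fock_mode i m f) g = fock_form f (fock_mode i (- m) g)" if "m > 0" for m f g
  proof -
    let ?s = "(i, nat m)"
    define H where "H N = complex_of_real (fock_weight N) * f N * cnj (fock_mode i (- m) g N)" for N
    have H: "complex_of_real (fock_weight M) * fock_mode i m f M * cnj (g M) = H (add_mset ?s M)" for M
    proof -
      have "fock_weight M * of_int m = fock_weight (add_mset ?s M) * of_nat (count M ?s + 1)"
        using fock_weight_add_mset[of ?s M] that
        by (simp add: mult.commute max_absorb2 Suc_le_eq)
      then have "complex_of_real (fock_weight M) * of_int m =
          complex_of_real (fock_weight (add_mset ?s M)) * of_nat (count M ?s + 1)"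
        by (metis of_real_mult of_real_of_int_eq of_real_of_nat_eq)
      moreover have "complex_of_real (fock_weight M) * fock_mode i m f M * cnj (g M) =
          (complex_of_real (fock_weight M) * of_int m) * (f (add_mset ?s M) * cnj (g M))"
        using that by (simp add: fock_mode_def)
      ultimately show ?thesis
        using that by (simp add: H_def fock_mode_def)
    qed
    have "N \<in> add_mset ?s ` {M. H (add_mset ?s M) \<noteq> 0}" if "H N \<noteq> 0" for N
    proof -
      have "?s \<in># N"
        using \<open>m > 0\<close> that by (auto simp: H_def fock_mode_def not_in_iff)
      then have "N = add_mset ?s (N - {#?s#})" by simp
      then show ?thesis using that by (metis (mono_tags, lifting) image_eqI mem_Collect_eq)
    qed
    then have "{N. H N \<noteq> 0} = add_mset ?s ` {M. H (add_mset ?s M) \<noteq> 0}" by blast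
    then have "Sum_any H = Sum_any (\<lambda>M. H (add_mset ?s M))"
      unfolding Sum_any.expand_set by (simp add: sum.reindex inj_on_def)
    then show ?thesis
      unfolding fock_form_def H by (simp add: H_def)
  qed
  consider "m > 0" | "m = 0" | "m < 0" by linarith
  then show ?thesis
  proof cases
    case 1
    then show ?thesis by (rule pos)
  next
    case 2
    then show ?thesis by (simp add: fock_form_def fock_mode_def)
  next
    case 3
    then show ?thesis
      using pos[of "- m" g f] fock_form_cnj[of g "fock_mode i m f"] fock_form_cnj[of f "fock_mode i (- m) g"]
      by simp
  qed
qed

lemma fock_form_nonneg:
  "Re (fock_form f f) \<ge> 0" "Im (fock_form f f) = 0"
proof -
  have "fock_form f f = (\<Sum>M | complex_of_real (fock_weight M) * f M * cnj (f M) \<noteq> 0. complex_of_real (fock_weight M * (cmod (f M))\<^sup>2))"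
    unfolding fock_form_def Sum_any.expand_set
    by (intro sum.cong refl) (simp add: mult.assoc complex_norm_square del: of_real_power)
  then have "fock_form f f = complex_of_real (\<Sum>M | complex_of_real (fock_weight M) * f M * cnj (f M) \<noteq> 0. fock_weight M * (cmod (f M))\<^sup>2)"
    by simp
  then show "Re (fock_form f f) \<ge> 0" "Im (fock_form f f) = 0"
    using fock_weight_pos by (auto intro!: sum_nonneg simp: less_imp_le)
qed

lemma fock_form_definite:
  assumes "fock_form f f = 0" "finite {M. f M \<noteq> 0}"
  shows "f = 0"
proof -
  have "fock_form f f = complex_of_real (\<Sum>M | f M \<noteq> 0. fock_weight M * (cmod (f M))\<^sup>2)"
    unfolding fock_form_superset[OF assms(2) order_refl]
    by (simp add: mult.assoc complex_norm_square del: of_real_power)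
  then have "(\<Sum>M | f M \<noteq> 0. fock_weight M * (cmod (f M))\<^sup>2) = 0"
    using assms(1) by (metis of_real_eq_0_iff)
  then have *: "\<forall>M\<in>{M. f M \<noteq> 0}. fock_weight M * (cmod (f M))\<^sup>2 = 0"
    using assms(2) fock_weight_pos by (subst (asm) sum_nonneg_eq_0_iff) (auto simp: less_imp_le)
  show ?thesis
  proof
    fix M
    show "f M = 0 M"
      using *[rule_format, of M] fock_weight_pos[of M] by (cases "f M = 0") auto
  qed
qed

subsection \<open>Mode identities in a vertex algebra\<close>

lemma Sum_any_nat_eq:
  fixes f :: "nat \<Rightarrow> 'a::comm_monoid_add"
  assumes "\<And>i. i \<ge> N \<Longrightarrow> f i = 0"
  shows "Sum_any f = (\<Sum>i<N. f i)"
  using assms by (intro Sum_any.expand_superset) (auto simp: not_less[symmetric])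

context vertex_algebra
begin

lemma Y_add_left: "Y (u + u') n v = Y u n v + Y u' n v"
  and Y_scale_left: "Y (c *\<^sub>V u) n v = c *\<^sub>V Y u n v"
  and Y_add_right: "Y u n (v + v') = Y u n v + Y u n v'"
  and Y_scale_right: "Y u n (c *\<^sub>V v) = c *\<^sub>V Y u n v"
  using Y_linear_left Y_linear_right unfolding Vector_Spaces.linear_iff by blast+

lemma Y_zero_left: "Y 0 n v = 0" and Y_zero_right: "Y u n 0 = 0"
  using Y_scale_left[of 0 0 n v] Y_scale_right[of u n 0 0] by simp_all

lemma Y_diff_right: "Y u n (v - v') = Y u n v - Y u n v'"
  using Y_add_right[of u n "v - v'" v'] by (simp add: algebra_simps)

lemma Y_uminus_right: "Y u n (- v) = - Y u n v"
  using Y_diff_right[of u n 0 v] by (simp add: Y_zero_right)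

lemma Y_sum_left: "Y (\<Sum>i\<in>I. f i) n v = (\<Sum>i\<in>I. Y (f i) n v)"
  and Y_sum_right: "Y u n (\<Sum>i\<in>I. g i) = (\<Sum>i\<in>I. Y u n (g i))"
  by (induction I rule: infinite_finite_induct)
    (auto simp: Y_add_left Y_add_right Y_zero_left Y_zero_right)

text \<open>The Borcherds identity at \<open>m = 0\<close>, where only \<open>i = 0\<close> survives
  on the left. Setting \<open>l = 0\<close> instead gives the commutator formula below.\<close>

lemma iterate_formula:
  "Y (Y u l v) n w = Sum_any (\<lambda>i::nat. ((-1) ^ i * (of_int l gchoose i)) *\<^sub>V
     (Y u (l - int i) (Y v (n + int i) w) - (-1) powi l *\<^sub>V Y v (n + l - int i) (Y u (int i) w)))"
proof -
  have "Sum_any (\<lambda>i::nat. (of_int 0 gchoose i) *\<^sub>V Y (Y u (l + int i) v) (0 + n - int i) w) = Y (Y u l v) n w"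
    by (subst Sum_any_nat_eq[of 1]) (auto simp: gbinomial_0(2) gr0_conv_Suc Suc_le_eq)
  then show ?thesis
    using borcherds[unfolded borcherds_identity_def, rule_format, of 0 u l v n w] by simp
qed

lemma commutator_formula:
  "Y u m (Y v n w) - Y v n (Y u m w) =
     Sum_any (\<lambda>i::nat. (of_int m gchoose i) *\<^sub>V Y (Y u (int i) v) (m + n - int i) w)"
proof -
  have "Sum_any (\<lambda>i::nat. ((-1) ^ i * (of_int 0 gchoose i)) *\<^sub>V
      (Y u (m + 0 - int i) (Y v (n + int i) w) - (-1) powi 0 *\<^sub>V Y v (n + 0 - int i) (Y u (m + int i) w))) =
      Y u m (Y v n w) - Y v n (Y u m w)"
    by (subst Sum_any_nat_eq[of 1]) (auto simp: gbinomial_0(2) gr0_conv_Suc Suc_le_eq)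
  then show ?thesis
    using borcherds[unfolded borcherds_identity_def, rule_format, of m u 0 v n w] by simp
qed

end

subsection \<open>The modes of the free boson\<close>

context free_boson_voa
begin

lemma act_linear:
  "act (X + Z) v = act X v + act Z v" "act (affine_scale c X) v = c *\<^sub>V act X v"
  "act X (v + w) = act X v + act X w" "act X (c *\<^sub>V v) = c *\<^sub>V act X v"
  "act (affine_bracket X Z) v = act X (act Z v) - act Z (act X v)"
  using induced unfolding is_induced_module_def lie_representation_def Vector_Spaces.linear_iff by blast+

lemma act_zero: "act 0 v = 0" "act X 0 = 0"
  using act_linear(1)[of 0 0 v] act_linear(4)[of X 0 0] by simp_all

lemma act_sum: "act (\<Sum>i\<in>I. f i) v = (\<Sum>i\<in>I. act (f i) v)"
  by (induction I rule: infinite_finite_induct) (auto simp: act_linear act_zero)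

lemma act_vac:
  assumes "X \<in> affine_nonneg"
  shows "act X vac = level_one X *\<^sub>V vac"
proof -
  interpret w: Vector_Spaces.linear words_scale scale "words_act scale act vac"
    by (rule linear_words_act) (rule vector_space_axioms)
  have "word ([] @ [X]) - words_scale (level_one X) (word []) \<in>
      induced_relations affine_scale affine_bracket affine_nonneg level_one"
    using assms unfolding induced_relations_def by blast
  then have "word ([] @ [X]) - words_scale (level_one X) (word []) \<in> {f. words_act scale act vac f = 0}"
    using induced words.span_superset unfolding is_induced_module_def by blast
  then show ?thesis
    by (simp add: w.diff w.scale words_act_word[OF vector_space_axioms])
qed

lemma act_induct:
  assumes "subspace U" "vac \<in> U" "\<And>X v. v \<in> U \<Longrightarrow> act X v \<in> U"
  shows "v \<in> U"
proof -
  obtain f where f: "v = words_act scale act vac f"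
    using induced unfolding is_induced_module_def by (metis surjD)
  have "foldr act xs vac \<in> U" for xs
    by (induction xs) (auto simp: assms)
  then show ?thesis
    unfolding f words_act_def by (intro subspace_sum subspace_scale assms(1))
qed

text \<open>A central element commutes with the whole action, so its scalar on the cyclic vector
  \<open>vac\<close> propagates. This covers both \<open>K\<close> and the modes of index 0.\<close>

lemma act_central:
  assumes "\<And>Z. affine_bracket X Z = 0" "act X vac = c *\<^sub>V vac"
  shows "act X v = c *\<^sub>V v"
proof -
  have "v \<in> {v. act X v = c *\<^sub>V v}"
  proof (rule act_induct)
    show "subspace {v. act X v = c *\<^sub>V v}"
      by (auto simp: subspace_def act_linear act_zero scale_right_distrib mult.commute)
    show "vac \<in> {v. act X v = c *\<^sub>V v}" using assms by simp
    fix Z v assume "v \<in> {v. act X v = c *\<^sub>V v}"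
    then show "act Z v \<in> {v. act X v = c *\<^sub>V v}"
      using act_linear(5)[of X Z v] assms(1) by (simp add: act_linear act_zero)
  qed
  then show ?thesis by simp
qed

lemma act_K: "act (0, c) v = c *\<^sub>V v"
  by (rule act_central)
    (auto simp: affine_bracket_def form_0 zero_prod_def act_vac affine_nonneg_def level_one_def)

definition \<alpha> :: "nat \<Rightarrow> int \<Rightarrow> 'v \<Rightarrow> 'v" where
  "\<alpha> i n = act (mode (hs i) n)"

lemma \<alpha>_eq_Y: "\<alpha> i n = Y (\<alpha> i (-1) vac) n"
  by (simp add: \<alpha>_def Y_generators)

lemma \<alpha>_add: "\<alpha> i n (v + w) = \<alpha> i n v + \<alpha> i n w"
  and \<alpha>_scale: "\<alpha> i n (c *\<^sub>V v) = c *\<^sub>V \<alpha> i n v"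
  and \<alpha>_zero: "\<alpha> i n 0 = 0"
  and \<alpha>_diff: "\<alpha> i n (v - w) = \<alpha> i n v - \<alpha> i n w"
  and \<alpha>_uminus: "\<alpha> i n (- v) = - \<alpha> i n v"
  and \<alpha>_sum: "\<alpha> i n (\<Sum>k\<in>I. g k) = (\<Sum>k\<in>I. \<alpha> i n (g k))"
  by (simp_all only: \<alpha>_eq_Y[of i n] Y_add_right Y_scale_right Y_zero_right Y_diff_right Y_uminus_right Y_sum_right)

lemma \<alpha>_linear: "Vector_Spaces.linear scale scale (\<alpha> i n)"
  by (simp only: \<alpha>_eq_Y[of i n] Y_linear_right)

lemma \<alpha>_truncation: "\<exists>N. \<forall>n\<ge>N. \<alpha> i n v = 0"
  using truncation[of "\<alpha> i (-1) vac" v] by (simp only: \<alpha>_eq_Y[symmetric])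

lemma \<alpha>_vac: "n \<ge> 0 \<Longrightarrow> \<alpha> i n vac = 0"
  by (subst \<alpha>_eq_Y) (rule creation)

lemma \<alpha>_0: "\<alpha> i 0 v = 0"
proof -
  have "Sum_any (\<lambda>m. of_int m * form (Poly_Mapping.lookup (Poly_Mapping.single 0 (hs i)) m) (z m)) = 0" for z
  proof -
    have "(\<lambda>m. of_int m * form (Poly_Mapping.lookup (Poly_Mapping.single 0 (hs i)) m) (z m)) = (\<lambda>m. 0)"
      by (auto simp: lookup_single when_def form_0)
    from arg_cong[OF this, of Sum_any] show ?thesis by simp
  qed
  then have "affine_bracket (mode (hs i) 0) Z = 0" for Z
    by (simp add: affine_bracket_def mode_def zero_prod_def)
  moreover have "act (mode (hs i) 0) vac = 0 *\<^sub>V vac"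
    using \<alpha>_vac[of 0 i] by (simp add: \<alpha>_def)
  ultimately have "act (mode (hs i) 0) v = 0 *\<^sub>V v"
    by (rule act_central)
  then show ?thesis by (simp add: \<alpha>_def)
qed

lemma hs_orthonormal: "i < d \<Longrightarrow> j < d \<Longrightarrow> form (hs i) (hs j) = (if i = j then 1 else 0)"
  using basis by (simp add: orthonormal_basis_def)

lemma \<alpha>_commutator:
  assumes "i < d" "j < d"
  shows "\<alpha> i m (\<alpha> j n v) = \<alpha> j n (\<alpha> i m v) + (if i = j \<and> m + n = 0 then of_int m *\<^sub>V v else 0)"
  using act_linear(5)[of "mode (hs i) m" "mode (hs j) n" v] assms
  by (cases "m + n = 0") (auto simp: affine_bracket_mode hs_orthonormal act_K \<alpha>_def algebra_simps)

lemma h_expansion: "h = (\<Sum>i<d. scaleh (form h (hs i)) (hs i))"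
proof -
  have "form (\<Sum>i<d. scaleh (form h (hs i)) (hs i)) y = (\<Sum>i<d. form h (hs i) * form (hs i) y)" for y
    using sum_comp_morphism[of "\<lambda>x. form x y" "\<lambda>i. scaleh (form h (hs i)) (hs i)" "{..<d}"]
    by (simp add: form_0 form_add form_scale o_def)
  then have "form (\<Sum>i<d. scaleh (form h (hs i)) (hs i)) y = form h y" for y
    by (subst (2) form_orthonormal_expansion[OF basis]) (simp add: form_sym[of y])
  moreover have "form (h - x) y = form h y - form x y" for x y
    using form_add(2)[of "h - x" x y] by simp
  ultimately show ?thesis
    using form_nondegenerate[of "h - (\<Sum>i<d. scaleh (form h (hs i)) (hs i))"] by simp
qed

text \<open>Every element of the affine algebra is a finite combination of modes of the basis
  \<open>hs\<close> and a multiple of \<open>K\<close>, which acts as a scalar.\<close>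

lemma act_in_subspace:
  assumes U: "subspace U" "v \<in> U" and \<alpha>: "\<And>i m. i < d \<Longrightarrow> \<alpha> i m v \<in> U"
  shows "act X v \<in> U"
proof -
  have "act (mode h m) v = (\<Sum>i<d. form h (hs i) *\<^sub>V \<alpha> i m v)" for h m
  proof -
    have "mode h m = (\<Sum>i<d. affine_scale (form h (hs i)) (mode (hs i) m))"
    proof -
      have s: "mode (x + y) m = mode x m + mode y m" "mode 0 m = 0"
        "mode (scaleh c x) m = affine_scale c (mode x m)" for x y c
        by (auto simp: mode_def single_add zero_prod_def affine_scale_def intro!: poly_mapping_eqI)
      have "mode (\<Sum>i<d. scaleh (form h (hs i)) (hs i)) m = (\<Sum>i<d. affine_scale (form h (hs i)) (mode (hs i) m))"
        using sum_comp_morphism[of "\<lambda>x. mode x m" "\<lambda>i. scaleh (form h (hs i)) (hs i)" "{..<d}"]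
        by (simp add: s o_def)
      then show ?thesis
        using arg_cong[OF h_expansion, of "\<lambda>x. mode x m" h] by (rule trans[rotated])
    qed
    then show ?thesis by (simp add: act_sum act_linear \<alpha>_def)
  qed
  then have m: "act (mode h m) v \<in> U" for h m
    using \<alpha> by (auto intro!: subspace_sum[OF U(1)] subspace_scale[OF U(1)])
  have "X = (\<Sum>m\<in>Poly_Mapping.keys (fst X). mode (Poly_Mapping.lookup (fst X) m) m) + (0, snd X)"
  proof -
    have "fst X = (\<Sum>m\<in>Poly_Mapping.keys (fst X). Poly_Mapping.single m (Poly_Mapping.lookup (fst X) m))"
      by (rule poly_mapping_eqI) (auto simp: lookup_sum lookup_single when_def in_keys_iff)
    moreover have "fst (\<Sum>m\<in>K. mode (f m) m) = (\<Sum>m\<in>K. Poly_Mapping.single m (f m))"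
      "snd (\<Sum>m\<in>K. mode (f m) m) = 0" for f K
      by (induction K rule: infinite_finite_induct) (auto simp: mode_def)
    ultimately show ?thesis by (simp add: prod_eq_iff)
  qed
  from arg_cong[OF this, of "\<lambda>X. act X v"]
  have "act X v = (\<Sum>m\<in>Poly_Mapping.keys (fst X). act (mode (Poly_Mapping.lookup (fst X) m) m) v) + snd X *\<^sub>V v"
    by (rule trans) (simp only: act_linear(1) act_sum act_K)
  then show ?thesis
    using m U by (auto intro!: subspace_add subspace_sum subspace_scale)
qed

definition creation_index :: "(nat \<times> nat) set" where
  "creation_index = {..<d} \<times> {1..}"

definition creation_word :: "(nat \<times> nat) list \<Rightarrow> 'v" where
  "creation_word ws = foldr (\<lambda>(i, m). \<alpha> i (- int m)) ws vac"

lemma creation_word_simps: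
  "creation_word [] = vac" "creation_word ((i, m) # ws) = \<alpha> i (- int m) (creation_word ws)"
  by (simp_all add: creation_word_def)

text \<open>The span contains \<open>vac\<close> and is stable under creation by construction.
  Nonnegative modes are commuted to the right until they kill \<open>vac\<close>, leaving shorter
  words.\<close>

lemma span_creation_words: "span (creation_word ` lists creation_index) = UNIV"
proof -
  define U where "U = span (creation_word ` lists creation_index)"
  have U: "subspace U" by (simp add: U_def)
  have word: "creation_word ws \<in> U" if "ws \<in> lists creation_index" for ws
    using that by (auto simp: U_def intro!: span_base)
  have neg: "\<alpha> i (- int m) v \<in> U" if "i < d" "m \<ge> 1" "v \<in> U" for i m v
    using that(3) unfolding U_def
  proof (induction rule: span_induct_alt)
    case base
    then show ?case by (simp add: \<alpha>_zero span_zero)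
  next
    case (step c x y)
    then obtain ws where ws: "ws \<in> lists creation_index" "x = creation_word ws" by blast
    then have eq: "\<alpha> i (- int m) x = creation_word ((i, m) # ws)" by (simp add: creation_word_simps)
    have "(i, m) # ws \<in> lists creation_index"
      using ws that by (simp add: creation_index_def)
    then have "\<alpha> i (- int m) x \<in> span (creation_word ` lists creation_index)"
      unfolding eq by (intro span_base imageI)
    then show ?case using step by (simp add: \<alpha>_add \<alpha>_scale span_add span_scale)
  qed
  have word_\<alpha>: "\<alpha> i m (creation_word ws) \<in> U" if "i < d" "m \<ge> 0" "ws \<in> lists creation_index" for i m ws
    using that(3)
  proof (induction ws)
    case Nil
    then show ?case using that U by (simp add: creation_word_simps \<alpha>_vac subspace_0)
  next
    case (Cons s ws)
    obtain j n where s: "s = (j, n)" "j < d" "n \<ge> 1" using Cons by (auto simp: creation_index_def)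
    then show ?case
      using Cons word[of ws] that neg[of j n "\<alpha> i m (creation_word ws)"]
        \<alpha>_commutator[of i j m "- int n" "creation_word ws"]
      by (auto simp: creation_word_simps intro!: subspace_add[OF U] subspace_scale[OF U] subspace_0[OF U])
  qed
  have \<alpha>: "\<alpha> i m v \<in> U" if "i < d" "v \<in> U" for i m v
  proof (cases "m \<ge> 0")
    case True
    show ?thesis
      using that(2) unfolding U_def
    proof (induction rule: span_induct_alt)
      case base
      then show ?case by (simp add: \<alpha>_zero span_zero)
    next
      case (step c x y)
      then show ?case using word_\<alpha>[OF that(1) True]
        by (auto simp: \<alpha>_add \<alpha>_scale U_def intro!: span_add span_scale)
    qed
  next
    case False
    then show ?thesis using neg[of i "nat (- m)" v] that by simp
  qed
  have "v \<in> U" for v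
    by (rule act_induct[OF U]) (use word[of "[]"] act_in_subspace[OF U] \<alpha> in \<open>auto simp: creation_word_simps\<close>)
  then show ?thesis by (auto simp: U_def)
qed

end

section \<open>Grading, the Virasoro subalgebra and highest weight submodules in a general
  VOA\<close>

context voa
begin

lemma homogeneous_subspace: "subspace (homogeneous_space n)"
  by (auto simp: subspace_def homogeneous_space_def L_def Y_zero_right Y_add_right Y_scale_right
      scale_right_distrib mult.commute)

lemma fin_subspace_homogeneous: "fin_subspace (homogeneous_space n)"
  using homogeneous_subspace finite_dim_homogeneous by (simp add: fin_subspace_def)

lemma L_add: "L n (v + w) = L n v + L n w"
  and L_scale: "L n (c *\<^sub>V v) = c *\<^sub>V L n v"
  and L_zero: "L n 0 = 0"
  and L_diff: "L n (v - w) = L n v - L n w"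
  and L_sum: "L n (\<Sum>k\<in>I. g k) = (\<Sum>k\<in>I. L n (g k))"
  by (simp_all add: L_def Y_add_right Y_scale_right Y_zero_right Y_diff_right Y_sum_right)

lemma L_linear: "Vector_Spaces.linear scale scale (L n)"
  by (simp add: L_def Y_linear_right)

lemma L_vac: "n \<ge> -1 \<Longrightarrow> L n vac = 0"
  by (simp add: L_def creation)

lemma L_minus_2_vac: "L (-2) vac = \<omega>"
  by (simp add: L_def creation)

text \<open>In the commutator with \<open>L 0\<close>, which is the mode \<open>\<omega>(1)\<close>,
  only \<open>i = 0\<close> and \<open>i = 1\<close> survive; the first is a derivative and
  contributes the shift by \<open>- m - 1\<close>.\<close>

lemma mode_homogeneous:
  assumes "u \<in> homogeneous_space n" "w \<in> homogeneous_space k"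
  shows "Y u m w \<in> homogeneous_space (k + n - m - 1)"
proof -
  have "Y \<omega> 1 (Y u m w) - Y u m (Y \<omega> 1 w) =
      Sum_any (\<lambda>i::nat. (of_int 1 gchoose i) *\<^sub>V Y (Y \<omega> (int i) u) (1 + m - int i) w)"
    by (rule commutator_formula)
  also have "\<dots> = (\<Sum>i<2. (of_int 1 gchoose i) *\<^sub>V Y (Y \<omega> (int i) u) (1 + m - int i) w)"
  proof (rule Sum_any_nat_eq)
    fix i :: nat assume "i \<ge> 2"
    then show "(of_int 1 gchoose i) *\<^sub>V Y (Y \<omega> (int i) u) (1 + m - int i) w = 0"
      using binomial_gbinomial[of 1 i, where ?'a = complex] by (simp add: binomial_eq_0)
  qed
  also have "\<dots> = Y (L (-1) u) (1 + m) w + Y (L 0 u) m w"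
    by (simp add: numeral_2_eq_2 L_def)
  also have "\<dots> = of_int (n - m - 1) *\<^sub>V Y u m w"
    using assms(1) by (simp add: L_derivative homogeneous_space_def Y_scale_left algebra_simps)
  finally have "L 0 (Y u m w) = Y u m (L 0 w) + of_int (n - m - 1) *\<^sub>V Y u m w"
    by (simp add: L_def algebra_simps)
  also have "\<dots> = of_int k *\<^sub>V Y u m w + of_int (n - m - 1) *\<^sub>V Y u m w"
    using assms(2) by (simp add: homogeneous_space_def Y_scale_right)
  also have "\<dots> = of_int (k + n - m - 1) *\<^sub>V Y u m w"
    by (simp add: algebra_simps)
  finally show ?thesis by (simp add: homogeneous_space_def)
qed

lemma L_homogeneous:
  assumes "w \<in> homogeneous_space k"
  shows "L m w \<in> homogeneous_space (k - m)"
proof -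
  obtain c :: complex where "L 0 (L m w) - L m (L 0 w) =
      of_int (0 - m) *\<^sub>V L (0 + m) w + (if 0 + m = 0 then (of_int (0 ^ 3 - 0) / 12 * c) *\<^sub>V w else 0)"
    using virasoro by blast
  then have "L 0 (L m w) = L m (L 0 w) - of_int m *\<^sub>V L m w"
    by (simp add: algebra_simps)
  also have "\<dots> = of_int (k - m) *\<^sub>V L m w"
    using assms by (simp add: homogeneous_space_def L_scale algebra_simps)
  finally show ?thesis by (simp add: homogeneous_space_def)
qed

lemma V\<^sub>\<omega>_closed: "vac \<in> V\<^sub>\<omega>" "\<omega> \<in> V\<^sub>\<omega>" "subspace V\<^sub>\<omega>" "u \<in> V\<^sub>\<omega> \<Longrightarrow> v \<in> V\<^sub>\<omega> \<Longrightarrow> Y u n v \<in> V\<^sub>\<omega>"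
  by (auto simp: V\<^sub>\<omega>_def subspace_def)

lemma L_V\<^sub>\<omega>: "u \<in> V\<^sub>\<omega> \<Longrightarrow> L n u \<in> V\<^sub>\<omega>"
  by (simp add: L_def V\<^sub>\<omega>_closed)

text \<open>The states all of whose modes preserve \<open>W\<close> contain \<open>vac\<close> and
  \<open>\<omega>\<close> and are closed under every product by \<open>iterate_formula\<close>.
  Hence they contain \<open>V\<^sub>\<omega>\<close>, and stability under the \<open>L n\<close>
  suffices.\<close>

lemma V\<^sub>\<omega>_submoduleI:
  assumes "subspace W" "\<And>n w. w \<in> W \<Longrightarrow> L n w \<in> W"
  shows "V\<^sub>\<omega>_submodule W"
proof -
  define U where "U = {x. \<forall>n. \<forall>w\<in>W. Y x n w \<in> W}"
  have "subspace U"
    using assms(1) by (auto simp: U_def subspace_def Y_zero_left Y_add_left Y_scale_left)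
  moreover have "vac \<in> U" using assms(1) by (simp add: U_def vacuum subspace_0)
  moreover have "\<omega> \<in> U"
  proof -
    have "Y \<omega> n w = L (n - 1) w" for n w by (simp add: L_def)
    then show ?thesis using assms(2) by (simp add: U_def)
  qed
  moreover have "Y u l v \<in> U" if "u \<in> U" "v \<in> U" for u v l
  proof -
    have "Y (Y u l v) n w \<in> W" if "w \<in> W" for n w
      unfolding iterate_formula Sum_any.expand_set
      using \<open>u \<in> U\<close> \<open>v \<in> U\<close> that assms(1)
      by (intro subspace_sum subspace_scale subspace_diff) (auto simp: U_def)
    then show ?thesis by (simp add: U_def)
  qed
  ultimately have "V\<^sub>\<omega> \<subseteq> U" unfolding V\<^sub>\<omega>_def by blast
  then show ?thesis using assms(1) by (auto simp: V\<^sub>\<omega>_submodule_def U_def)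
qed

definition nonvac_space :: "'v set" where
  "nonvac_space = span (\<Union>n\<in>{1..}. highest_weight_component n)"

lemma nonvac_subspace: "subspace nonvac_space"
  by (simp add: nonvac_space_def)

lemma highest_weight_submodule_subset:
  "n \<ge> 1 \<Longrightarrow> highest_weight_submodule n M \<Longrightarrow> M \<subseteq> nonvac_space"
  unfolding nonvac_space_def highest_weight_component_def
  by (smt (verit) UN_upper Union_upper atLeast_iff mem_Collect_eq span_superset subset_trans)

lemma nonvac_least:
  assumes "subspace P" "\<And>n M. n \<ge> 1 \<Longrightarrow> highest_weight_submodule n M \<Longrightarrow> M \<subseteq> P"
  shows "nonvac_space \<subseteq> P"
  unfolding nonvac_space_def highest_weight_component_def
  by (intro span_minimal assms(1) UN_least Union_least) (use assms in auto)

lemma L_nonvac: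
  assumes "x \<in> nonvac_space"
  shows "L n x \<in> nonvac_space"
proof -
  have "nonvac_space \<subseteq> {x. L n x \<in> nonvac_space}"
  proof (rule nonvac_least)
    show "subspace {x. L n x \<in> nonvac_space}"
      using nonvac_subspace by (auto simp: subspace_def L_add L_zero L_scale)
    fix k M assume k: "k \<ge> 1" "highest_weight_submodule k M"
    have "L n x \<in> M" if "x \<in> M" for x
      using k(2) that V\<^sub>\<omega>_closed(2) unfolding highest_weight_submodule_def V\<^sub>\<omega>_submodule_def L_def by blast
    then show "M \<subseteq> {x. L n x \<in> nonvac_space}"
      using highest_weight_submodule_subset[OF k] by blast
  qed
  then show ?thesis using assms by blast
qed

text \<open>\<open>L 1\<close> and \<open>L 2\<close> generate all positive modes: the commutator of
  \<open>L k\<close> and \<open>L 1\<close> is \<open>k - 1\<close> times \<open>L (k + 1)\<close>,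
  a nonzero factor from \<open>k = 2\<close> on.\<close>

lemma L_positive_annihilates:
  assumes "L 1 v = 0" "L 2 v = 0" "m > 0"
  shows "L m v = 0"
proof -
  have "L (int k + 1) v = 0" for k
  proof (induction k rule: less_induct)
    case (less k)
    consider "k = 0" | "k = 1" | "k \<ge> 2" by linarith
    then show ?case
    proof cases
      case 3
      obtain c :: complex where "L (int k) (L 1 v) - L 1 (L (int k) v) =
          of_int (int k - 1) *\<^sub>V L (int k + 1) v + (if int k + 1 = 0 then (of_int (int k ^ 3 - int k) / 12 * c) *\<^sub>V v else 0)"
        using virasoro by blast
      moreover have "L (int k) v = 0"
        using less[of "k - 1"] 3 by (simp add: of_nat_diff)
      ultimately have "of_int (int k - 1) *\<^sub>V L (int k + 1) v = 0"
        using assms(1) by (simp add: L_zero)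
      moreover have "(of_int (int k - 1) :: complex) \<noteq> 0"
        using 3 by (subst of_int_eq_0_iff) linarith
      ultimately show ?thesis by (simp only: scale_eq_0_iff) simp
    qed (use assms in auto)
  qed
  from this[of "nat (m - 1)"] show ?thesis using assms(3) by simp
qed

lemma highest_weight_in_nonvac:
  assumes "v \<in> homogeneous_space n" "n \<ge> 1" "L 1 v = 0" "L 2 v = 0"
  shows "v \<in> nonvac_space"
proof (cases "v = 0")
  case True
  then show ?thesis using nonvac_subspace by (simp add: subspace_0)
next
  case False
  then have "highest_weight_vector n v"
    using assms L_positive_annihilates by (auto simp: highest_weight_vector_def homogeneous_space_def)
  then have "highest_weight_submodule n (\<Inter> {M'. V\<^sub>\<omega>_submodule M' \<and> v \<in> M'})"
    unfolding highest_weight_submodule_def by blast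
  from highest_weight_submodule_subset[OF assms(2) this] show ?thesis by blast
qed

text \<open>The words are unordered: what matters is that they span, not that they are
  independent.\<close>

definition virasoro_words :: "'v set" where
  "virasoro_words = (\<lambda>ms. foldr L ms vac) ` lists {..<0}"

lemma L_span_virasoro_words:
  assumes "v \<in> span virasoro_words"
  shows "L n v \<in> span virasoro_words"
proof -
  let ?W = "span virasoro_words"
  have neg: "L n v \<in> ?W" if "n < 0" "v \<in> ?W" for n v
    using that(2)
  proof (induction rule: span_induct_alt)
    case base
    then show ?case by (simp add: L_zero span_zero)
  next
    case (step c x y)
    then obtain ms where "ms \<in> lists {..<0}" "x = foldr L ms vac" by (auto simp: virasoro_words_def)
    then have "n # ms \<in> lists {..<0}" "L n x = foldr L (n # ms) vac" using that by auto
    then have "L n x \<in> virasoro_words"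
      unfolding virasoro_words_def by (metis (no_types, lifting) imageI)
    then show ?case using step by (simp add: L_add L_scale span_add span_scale span_base)
  qed
  have word: "foldr L ms vac \<in> ?W" if "ms \<in> lists {..<0}" for ms
    using that by (auto simp: virasoro_words_def intro!: span_base)
  have "\<forall>n. L n (foldr L ms vac) \<in> ?W" if "ms \<in> lists {..<0}" for ms
    using that
  proof (induction ms)
    case Nil
    have "L n vac \<in> ?W" for n
      using neg[of n vac] word[of "[]"] L_vac[of n] by (cases "n < 0") (auto simp: span_zero)
    then show ?case by simp
  next
    case (Cons m ms)
    have "L n (L m x) \<in> ?W" if x: "x = foldr L ms vac" for n x
    proof -
      obtain c :: complex where c: "L n (L m x) - L m (L n x) =
          of_int (n - m) *\<^sub>V L (n + m) x + (if n + m = 0 then (of_int (n ^ 3 - n) / 12 * c) *\<^sub>V x else 0)"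
        using virasoro by blast
      have "L m (L n x) \<in> ?W" "L (n + m) x \<in> ?W" "x \<in> ?W"
        using Cons x word[of ms] by (auto intro: neg)
      moreover have "L n (L m x) = L m (L n x) + (of_int (n - m) *\<^sub>V L (n + m) x
          + (if n + m = 0 then (of_int (n ^ 3 - n) / 12 * c) *\<^sub>V x else 0))"
        using c by (metis add.commute diff_add_cancel)
      ultimately show ?thesis by (auto intro!: span_add span_scale span_zero)
    qed
    then show ?case by simp
  qed
  with assms show ?thesis
  proof (induction rule: span_induct_alt)
    case base
    then show ?case by (simp add: L_zero span_zero)
  next
    case (step c x y)
    then show ?case by (auto simp: virasoro_words_def L_add L_scale intro!: span_add span_scale)
  qed
qed

text \<open>The span is a submodule containing \<open>vac\<close>, and every \<open>u\<close> is
  recovered as \<open>Y u (-1) vac\<close>.\<close>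

lemma V\<^sub>\<omega>_subset: "V\<^sub>\<omega> \<subseteq> span virasoro_words"
proof
  fix u assume u: "u \<in> V\<^sub>\<omega>"
  have "V\<^sub>\<omega>_submodule (span virasoro_words)"
    by (rule V\<^sub>\<omega>_submoduleI) (auto simp: L_span_virasoro_words)
  moreover have "vac \<in> span virasoro_words"
    by (rule span_base) (auto simp: virasoro_words_def image_iff intro!: bexI[of _ "[]"])
  ultimately have "Y u (-1) vac \<in> span virasoro_words"
    using u by (simp add: V\<^sub>\<omega>_submodule_def)
  then show "u \<in> span virasoro_words" by (simp add: creation)
qed

end

context free_boson_voa
begin

subsection \<open>The Hermitian form\<close>

definition \<Phi> :: "'v \<Rightarrow> fock" where
  "\<Phi> = (SOME \<Phi>. Vector_Spaces.linear scale fock_scale \<Phi> \<and> \<Phi> vac = fock_vac \<and>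
    (\<forall>x v. \<Phi> (act x v) = fock_act hs x (\<Phi> v)))"

lemma \<Phi>: "Vector_Spaces.linear scale fock_scale \<Phi>" "\<Phi> vac = fock_vac"
    "\<Phi> (act x v) = fock_act hs x (\<Phi> v)"
proof -
  have "\<exists>\<Phi>. Vector_Spaces.linear scale fock_scale \<Phi> \<and> \<Phi> vac = fock_vac \<and> (\<forall>x v. \<Phi> (act x v) = fock_act hs x (\<Phi> v))"
    by (rule induced_module_universal[OF induced])
      (auto simp: fock_representation[OF basis] fock_act_nonneg vector_space_axioms fock.vector_space_axioms)
  from someI_ex[OF this, folded \<Phi>_def] show "Vector_Spaces.linear scale fock_scale \<Phi>" "\<Phi> vac = fock_vac"
    "\<Phi> (act x v) = fock_act hs x (\<Phi> v)" by blast+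
qed

lemma \<Phi>_add: "\<Phi> (v + w) = \<Phi> v + \<Phi> w" and \<Phi>_scale: "\<Phi> (c *\<^sub>V v) = fock_scale c (\<Phi> v)"
  using \<Phi>(1) unfolding Vector_Spaces.linear_iff by blast+

lemma \<Phi>_zero: "\<Phi> 0 = 0"
  using \<Phi>_scale[of 0 0] by (simp add: fock_scale_def zero_fun_def)

lemma \<Phi>_sum: "\<Phi> (\<Sum>k\<in>I. g k) = (\<Sum>k\<in>I. \<Phi> (g k))"
  by (induction I rule: infinite_finite_induct) (auto simp: \<Phi>_add \<Phi>_zero)

lemma \<Phi>_\<alpha>: "i < d \<Longrightarrow> \<Phi> (\<alpha> i m v) = fock_mode i m (\<Phi> v)"
  by (simp add: \<alpha>_def \<Phi> fock_act_mode[OF basis])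

lemma vac_nonzero: "vac \<noteq> 0"
proof
  assume "vac = 0"
  then have "fock_vac {#} = 0" using \<Phi>(2) \<Phi>_zero by simp
  then show False by (simp add: fock_vac_def)
qed

text \<open>Creation operators multiply by variables, so a word becomes a monomial. The constant
  builds up to the product of the factorials of the multiplicities, because of the divided
  normalization.\<close>

lemma \<Phi>_creation_word:
  assumes "ws \<in> lists creation_index"
  shows "\<exists>c. c \<noteq> 0 \<and> \<Phi> (creation_word ws) = (\<lambda>M. if M = mset ws then c else 0)"
  using assms
proof (induction ws)
  case Nil
  then show ?case by (auto simp: creation_word_simps \<Phi> fock_vac_def intro!: exI[of _ 1])
next
  case (Cons s ws)
  obtain i m where s: "s = (i, m)" "i < d" "m \<ge> 1" using Cons by (auto simp: creation_index_def)
  obtain c where c: "c \<noteq> 0" "\<Phi> (creation_word ws) = (\<lambda>M. if M = mset ws then c else 0)"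
    using Cons by auto
  have "\<Phi> (creation_word (s # ws)) M = (if M = mset (s # ws) then of_nat (count (mset ws) s + 1) * c else 0)" for M
  proof (cases "s \<in># M")
    case True
    then obtain N where "M = add_mset s N" by (metis insert_DiffM)
    then show ?thesis using s c by (simp add: creation_word_simps \<Phi>_\<alpha> fock_mode_def)
  next
    case False
    then have "M \<noteq> add_mset s (mset ws)" "count M s = 0" by (auto simp: not_in_iff)
    then show ?thesis using s c by (simp add: creation_word_simps \<Phi>_\<alpha> fock_mode_def)
  qed
  moreover have "of_nat (count (mset ws) s + 1) * c \<noteq> 0"
    unfolding mult_eq_0_iff of_nat_eq_0_iff using c(1) by simp
  ultimately show ?case by blast
qed

lemma \<Phi>_finite_support: "finite {M. \<Phi> v M \<noteq> 0}"
proof -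
  have "v \<in> span (creation_word ` lists creation_index)" by (simp add: span_creation_words)
  then show ?thesis
  proof (induction rule: span_induct_alt)
    case base
    then show ?case by (simp add: \<Phi>_zero)
  next
    case (step c x y)
    then obtain ws where "ws \<in> lists creation_index" "x = creation_word ws" by blast
    then have "finite {M. \<Phi> x M \<noteq> 0}" using \<Phi>_creation_word[of ws] by auto
    moreover have "{M. \<Phi> (c *\<^sub>V x + y) M \<noteq> 0} \<subseteq> {M. \<Phi> x M \<noteq> 0} \<union> {M. \<Phi> y M \<noteq> 0}"
      by (auto simp: \<Phi>_add \<Phi>_scale fock_scale_def)
    ultimately show ?case using step by (metis (no_types, lifting) finite_Un finite_subset)
  qed
qed

lemma creation_word_mset:
  assumes "ws \<in> lists creation_index" "mset ws = mset ws'"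
  shows "creation_word ws = creation_word ws'"
proof -
  have "fold (\<lambda>(i, m). \<alpha> i (- int m)) (rev ws) = fold (\<lambda>(i, m). \<alpha> i (- int m)) (rev ws')"
  proof (rule fold_multiset_equiv)
    show "mset (rev ws) = mset (rev ws')" using assms(2) by simp
    fix x y assume "x \<in> set (rev ws)" "y \<in> set (rev ws)"
    then have "x \<in> creation_index" "y \<in> creation_index" using assms(1) by auto
    then obtain i m j n where "x = (i, m)" "y = (j, n)" "i < d" "j < d" "m \<ge> 1" "n \<ge> 1"
      by (auto simp: creation_index_def)
    then show "(case x of (i, m) \<Rightarrow> \<alpha> i (- int m)) \<circ> (case y of (i, m) \<Rightarrow> \<alpha> i (- int m)) =
       (case y of (i, m) \<Rightarrow> \<alpha> i (- int m)) \<circ> (case x of (i, m) \<Rightarrow> \<alpha> i (- int m))"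
      using \<alpha>_commutator[of i j "- int m" "- int n"] by (auto simp: fun_eq_iff)
  qed
  then show ?thesis by (simp add: creation_word_def foldr_conv_fold)
qed

text \<open>Distinct creation words have distinct multisets of letters, hence distinct monomials.
  Evaluating at one multiset isolates one coefficient of a linear relation.\<close>

lemma \<Phi>_injective:
  assumes "\<Phi> v = 0"
  shows "v = 0"
proof -
  have "v \<in> span (creation_word ` lists creation_index)" by (simp add: span_creation_words)
  then obtain t r where t: "finite t" "t \<subseteq> creation_word ` lists creation_index" "v = (\<Sum>a\<in>t. r a *\<^sub>V a)"
    unfolding span_explicit by blast
  have "r a = 0" if a: "a \<in> t" for a
  proof -
    obtain ws where ws: "ws \<in> lists creation_index" "a = creation_word ws" using t(2) a by blast
    have "\<Phi> b (mset ws) = 0" if "b \<in> t" "b \<noteq> a" for b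
    proof -
      obtain ws' where ws': "ws' \<in> lists creation_index" "b = creation_word ws'" using t(2) \<open>b \<in> t\<close> by blast
      then have "mset ws \<noteq> mset ws'" using creation_word_mset[OF ws(1), of ws'] ws(2) \<open>b \<noteq> a\<close> by auto
      then show ?thesis using \<Phi>_creation_word[OF ws'(1)] ws'(2) by auto
    qed
    then have "(\<Sum>b\<in>t. r b * \<Phi> b (mset ws)) = (\<Sum>b\<in>t. if b = a then r a * \<Phi> a (mset ws) else 0)"
      by (intro sum.cong) auto
    moreover have "\<Phi> v (mset ws) = (\<Sum>b\<in>t. r b * \<Phi> b (mset ws))"
    proof -
      have "(\<Sum>b\<in>t. f b) M = (\<Sum>b\<in>t. f b M)" for f :: "'v \<Rightarrow> fock" and M
        by (induction t rule: infinite_finite_induct) auto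
      then show ?thesis by (simp add: t(3) \<Phi>_sum \<Phi>_scale fock_scale_def)
    qed
    ultimately have "r a * \<Phi> a (mset ws) = 0" using assms t(1) a by simp
    then show ?thesis using \<Phi>_creation_word[OF ws(1)] ws(2) by auto
  qed
  then show ?thesis using t by simp
qed

definition herm :: "'v \<Rightarrow> 'v \<Rightarrow> complex" where
  "herm u v = fock_form (\<Phi> u) (\<Phi> v)"

lemma herm_cnj: "herm v u = cnj (herm u v)"
  unfolding herm_def by (rule fock_form_cnj)

lemma herm_add_left: "herm (u + u') v = herm u v + herm u' v"
  by (simp add: herm_def \<Phi>_add fock_form_add \<Phi>_finite_support)

lemma herm_scale_left: "herm (c *\<^sub>V u) v = c * herm u v"
  by (simp add: herm_def \<Phi>_scale fock_form_scale)

lemma herm_add_right: "herm u (v + v') = herm u v + herm u v'"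
  by (subst (1 2 3) herm_cnj) (simp add: herm_add_left)

lemma herm_scale_right: "herm u (c *\<^sub>V v) = cnj c * herm u v"
  by (subst (1 2) herm_cnj) (simp add: herm_scale_left)

lemma herm_zero: "herm 0 v = 0" "herm u 0 = 0"
  using herm_scale_left[of 0 0 v] herm_scale_right[of u 0 0] by simp_all

lemma herm_sum_left: "herm (\<Sum>k\<in>I. g k) v = (\<Sum>k\<in>I. herm (g k) v)"
  and herm_sum_right: "herm u (\<Sum>k\<in>I. g k) = (\<Sum>k\<in>I. herm u (g k))"
  by (induction I rule: infinite_finite_induct) (auto simp: herm_add_left herm_add_right herm_zero)

lemma herm_\<alpha>: "i < d \<Longrightarrow> herm (\<alpha> i m u) v = herm u (\<alpha> i (- m) v)"
  by (simp add: herm_def \<Phi>_\<alpha> fock_form_adjoint)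

lemma herm_definite: "herm v v = 0 \<Longrightarrow> v = 0"
  unfolding herm_def using fock_form_definite[OF _ \<Phi>_finite_support] \<Phi>_injective by blast

lemma herm_nonneg: "Re (herm v v) \<ge> 0" "Im (herm v v) = 0"
  unfolding herm_def by (rule fock_form_nonneg)+

subsection \<open>The Virasoro operators of the free boson\<close>

lemma \<omega>_eq: "\<omega> = (1/2) *\<^sub>V (\<Sum>i<d. \<alpha> i (-1) (\<alpha> i (-1) vac))"
  using omega by (simp add: \<alpha>_def)

lemma \<alpha>_\<omega>:
  assumes "i < d" "r \<ge> 0"
  shows "\<alpha> i r \<omega> = (if r = 1 then \<alpha> i (-1) vac else 0)"
proof -
  have "\<alpha> i r (\<alpha> k (-1) (\<alpha> k (-1) vac)) = (if k = i then if r = 1 then 2 *\<^sub>V \<alpha> i (-1) vac else 0 else 0)"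
    if "k < d" for k
  proof -
    have "\<alpha> i r (\<alpha> k (-1) vac) = (if i = k \<and> r = 1 then vac else 0)"
      using \<alpha>_commutator[of i k r "-1" vac] assms that by (auto simp: \<alpha>_vac \<alpha>_zero)
    then show ?thesis
      using \<alpha>_commutator[of i k r "-1" "\<alpha> k (-1) vac"] assms that
      by (auto simp: \<alpha>_zero scale_left_distrib[of 1 1, simplified])
  qed
  then show ?thesis
    using assms by (simp add: \<omega>_eq \<alpha>_scale \<alpha>_sum)
qed

lemma \<alpha>_L_commutator:
  assumes "i < d"
  shows "\<alpha> i m (L n v) = L n (\<alpha> i m v) + of_int m *\<^sub>V \<alpha> i (m + n) v"
proof -
  let ?g = "\<alpha> i (-1) vac"
  have "Y ?g m (Y \<omega> (n + 1) v) - Y \<omega> (n + 1) (Y ?g m v) =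
     Sum_any (\<lambda>r::nat. (of_int m gchoose r) *\<^sub>V Y (Y ?g (int r) \<omega>) (m + (n + 1) - int r) v)"
    by (rule commutator_formula)
  also have "\<dots> = (\<Sum>r<2. (of_int m gchoose r) *\<^sub>V Y (Y ?g (int r) \<omega>) (m + (n + 1) - int r) v)"
    by (rule Sum_any_nat_eq) (use assms in \<open>simp add: \<alpha>_\<omega> Y_zero_left flip: \<alpha>_eq_Y\<close>)
  also have "\<dots> = of_int m *\<^sub>V \<alpha> i (m + n) v"
    using assms by (simp add: numeral_2_eq_2 \<alpha>_\<omega> Y_zero_left flip: \<alpha>_eq_Y)
  finally show ?thesis by (simp add: L_def algebra_simps flip: \<alpha>_eq_Y)
qed

lemma \<alpha>_homogeneous:
  assumes "i < d" "v \<in> homogeneous_space k"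
  shows "\<alpha> i m v \<in> homogeneous_space (k - m)"
proof -
  have "L 0 (\<alpha> i m v) = \<alpha> i m (L 0 v) - of_int m *\<^sub>V \<alpha> i m v"
    using \<alpha>_L_commutator[OF assms(1), of m 0 v] by simp
  then show ?thesis
    using assms(2) by (simp add: homogeneous_space_def \<alpha>_scale algebra_simps)
qed

lemma vac_homogeneous: "vac \<in> homogeneous_space 0"
  by (simp add: homogeneous_space_def L_vac)

text \<open>The axiom \<open>virasoro\<close> only provides some central charge. Computing
  \<open>L 2 \<omega>\<close> both from it and from the modes identifies it, as \<open>vac\<close>
  is nonzero.\<close>

lemma virasoro_central_charge:
  "L m (L n v) = L n (L m v) + of_int (m - n) *\<^sub>V L (m + n) v
     + (if m + n = 0 then (of_int (m ^ 3 - m) / 12 * of_nat d) *\<^sub>V v else 0)"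
proof -
  obtain c :: complex where c: "\<And>m n v. L m (L n v) - L n (L m v) =
        of_int (m - n) *\<^sub>V L (m + n) v
        + (if m + n = 0 then (of_int (m ^ 3 - m) / 12 * c) *\<^sub>V v else 0)"
    using virasoro by blast
  have "L 2 (L (-2) vac) = (c / 2) *\<^sub>V vac"
    using c[of 2 "-2" vac] by (simp add: L_vac L_zero)
  moreover have "L 2 (\<alpha> i (-1) (\<alpha> i (-1) vac)) = vac" if "i < d" for i
  proof -
    have 1: "L 2 (\<alpha> i (-1) v) = \<alpha> i (-1) (L 2 v) + \<alpha> i 1 v" for v
      using \<alpha>_L_commutator[OF that, of "-1" 2 v] by simp
    have "\<alpha> i 1 (\<alpha> i (-1) vac) = vac"
      using \<alpha>_commutator[OF that that, of 1 "-1" vac] by (simp add: \<alpha>_vac \<alpha>_zero)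
    then show ?thesis by (simp add: 1 L_vac \<alpha>_vac \<alpha>_zero)
  qed
  then have "L 2 (L (-2) vac) = (of_nat d / 2) *\<^sub>V vac"
    using arg_cong[OF \<omega>_eq, of "L 2"] by (simp add: L_minus_2_vac L_scale L_sum sum_constant_scale)
  ultimately have "c / 2 = of_nat d / 2"
    using vac_nonzero by (metis scale_cancel_right)
  then have "c = of_nat d" by simp
  then show ?thesis using c[of m n v] by (simp add: algebra_simps)
qed

text \<open>Removes the signs from \<open>iterate_formula\<close> at \<open>l = -1\<close>, leaving
  a normally ordered sum.\<close>

lemma gchoose_minus_one: "(-1) ^ j * ((-1 :: complex) gchoose j) = 1"
  using gbinomial_minus[of "1::complex" j] binomial_gbinomial[of j j, where 'a = complex]
  by (simp flip: power_mult_distrib)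

text \<open>The range may be enlarged at will, so that finitely many expansions can be brought to
  one common length.\<close>

lemma normal_ordered_pair:
  assumes "i < d" "j < d"
  shows "\<exists>N0. \<forall>N\<ge>N0. Y (\<alpha> i (-1) (\<alpha> j (-1) vac)) (n + 1) v =
    (\<Sum>r<N. \<alpha> i (- 1 - int r) (\<alpha> j (n + 1 + int r) v) + \<alpha> j (n - int r) (\<alpha> i (int r) v))"
proof -
  obtain N1 N2 where N1: "\<And>n. n \<ge> N1 \<Longrightarrow> \<alpha> j n v = 0" and N2: "\<And>n. n \<ge> N2 \<Longrightarrow> \<alpha> i n v = 0"
    using \<alpha>_truncation by meson
  have "Y (\<alpha> i (-1) (\<alpha> j (-1) vac)) (n + 1) v =
    (\<Sum>r<N. \<alpha> i (- 1 - int r) (\<alpha> j (n + 1 + int r) v) + \<alpha> j (n - int r) (\<alpha> i (int r) v))"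
    if "N \<ge> nat (max (N1 - n) N2)" for N
  proof -
    have "Y (Y (\<alpha> i (-1) vac) (-1) (\<alpha> j (-1) vac)) (n + 1) v = Sum_any (\<lambda>r::nat.
       \<alpha> i (- 1 - int r) (\<alpha> j (n + 1 + int r) v) + \<alpha> j (n - int r) (\<alpha> i (int r) v))"
      by (subst iterate_formula) (simp add: gchoose_minus_one flip: \<alpha>_eq_Y)
    also have "\<dots> = (\<Sum>r<N. \<alpha> i (- 1 - int r) (\<alpha> j (n + 1 + int r) v) + \<alpha> j (n - int r) (\<alpha> i (int r) v))"
      by (rule Sum_any_nat_eq) (use that in \<open>simp add: N1 N2 \<alpha>_zero\<close>)
    finally show ?thesis by (simp flip: \<alpha>_eq_Y)
  qed
  then show ?thesis by blast
qed

lemma \<alpha>_truncation_uniform: "\<exists>N. \<forall>i<d. \<forall>m\<ge>N. \<alpha> i m v = 0"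
proof -
  obtain K where K: "\<forall>i. \<forall>m\<ge>K i. \<alpha> i m v = 0"
    using choice[of "\<lambda>i N. \<forall>m\<ge>N. \<alpha> i m v = 0"] \<alpha>_truncation by blast
  have "K i \<le> (\<Sum>i<d. \<bar>K i\<bar>)" if "i < d" for i
    using member_le_sum[of i "{..<d}" "\<lambda>i. \<bar>K i\<bar>"] that by simp
  then show ?thesis using K by (meson order_trans)
qed

lemma L_expansion:
  "\<exists>N0. \<forall>N\<ge>N0. L n v = (1/2) *\<^sub>V
    (\<Sum>i<d. \<Sum>r<N. \<alpha> i (- 1 - int r) (\<alpha> i (n + 1 + int r) v) + \<alpha> i (n - int r) (\<alpha> i (int r) v))"
proof -
  have "\<forall>i\<in>{..<d}. \<exists>N0. \<forall>N\<ge>N0. Y (\<alpha> i (-1) (\<alpha> i (-1) vac)) (n + 1) v =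
    (\<Sum>r<N. \<alpha> i (- 1 - int r) (\<alpha> i (n + 1 + int r) v) + \<alpha> i (n - int r) (\<alpha> i (int r) v))"
    by (intro ballI normal_ordered_pair) auto
  from bchoice[OF this] obtain N0 where N0: "\<forall>i\<in>{..<d}. \<forall>N\<ge>N0 i. Y (\<alpha> i (-1) (\<alpha> i (-1) vac)) (n + 1) v =
    (\<Sum>r<N. \<alpha> i (- 1 - int r) (\<alpha> i (n + 1 + int r) v) + \<alpha> i (n - int r) (\<alpha> i (int r) v))"
    by blast
  have "L n v = (1/2) *\<^sub>V
    (\<Sum>i<d. \<Sum>r<N. \<alpha> i (- 1 - int r) (\<alpha> i (n + 1 + int r) v) + \<alpha> i (n - int r) (\<alpha> i (int r) v))"
    if "N \<ge> (\<Sum>i<d. N0 i)" for N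
  proof -
    have "N0 i \<le> N" if "i < d" for i
      using that \<open>N \<ge> _\<close> member_le_sum[of i "{..<d}" N0] by simp
    then have "Y (\<alpha> i (-1) (\<alpha> i (-1) vac)) (n + 1) v =
        (\<Sum>r<N. \<alpha> i (- 1 - int r) (\<alpha> i (n + 1 + int r) v) + \<alpha> i (n - int r) (\<alpha> i (int r) v))"
      if "i < d" for i
      using N0 that by blast
    then show ?thesis
      by (subst L_def, subst \<omega>_eq) (simp add: Y_scale_left Y_sum_left)
  qed
  then show ?thesis by blast
qed

text \<open>Taking adjoints interchanges the two halves of the normally ordered sum up to an index
  shift by one. The shift is harmless: the added term at 0 contains a mode of index 0, and the term
  at \<open>N\<close> vanishes by truncation, for which \<open>N\<close> is chosen large.\<close>

lemma herm_L: "herm (L n u) v = herm u (L (- n) v)"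
proof -
  obtain N1 where N1: "\<And>N. N \<ge> N1 \<Longrightarrow> L n u = (1/2) *\<^sub>V
    (\<Sum>i<d. \<Sum>r<N. \<alpha> i (- 1 - int r) (\<alpha> i (n + 1 + int r) u) + \<alpha> i (n - int r) (\<alpha> i (int r) u))"
    using L_expansion by meson
  obtain N2 where N2: "\<And>N. N \<ge> N2 \<Longrightarrow> L (- n) v = (1/2) *\<^sub>V
    (\<Sum>i<d. \<Sum>r<N. \<alpha> i (- 1 - int r) (\<alpha> i (- n + 1 + int r) v) + \<alpha> i (- n - int r) (\<alpha> i (int r) v))"
    using L_expansion by meson
  obtain N3 where N3: "\<And>i m. i < d \<Longrightarrow> m \<ge> N3 \<Longrightarrow> \<alpha> i m v = 0"
    using \<alpha>_truncation_uniform by blast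
  define N where "N = Suc (N1 + N2 + nat \<bar>N3\<bar> + nat \<bar>n\<bar>)"
  have N: "N \<ge> N1" "N \<ge> N2" by (auto simp: N_def)
  have "(\<Sum>r<N. herm (\<alpha> i (- 1 - int r) (\<alpha> i (n + 1 + int r) u)) v + herm (\<alpha> i (n - int r) (\<alpha> i (int r) u)) v) =
    (\<Sum>r<N. herm u (\<alpha> i (- 1 - int r) (\<alpha> i (- n + 1 + int r) v)) + herm u (\<alpha> i (- n - int r) (\<alpha> i (int r) v)))"
    if i: "i < d" for i
  proof -
    have "(\<Sum>r<N. herm (\<alpha> i (- 1 - int r) (\<alpha> i (n + 1 + int r) u)) v) =
        (\<Sum>r<N. herm u (\<alpha> i (- n - int (Suc r)) (\<alpha> i (int (Suc r)) v)))"
    proof (intro sum.cong refl)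
      fix r
      have "- (n + 1 + int r) = - n - int (Suc r)" "- (- 1 - int r) = int (Suc r)" by simp_all
      then show "herm (\<alpha> i (- 1 - int r) (\<alpha> i (n + 1 + int r) u)) v =
          herm u (\<alpha> i (- n - int (Suc r)) (\<alpha> i (int (Suc r)) v))"
        by (simp only: herm_\<alpha>[OF i])
    qed
    also have "\<dots> = (\<Sum>r<N. herm u (\<alpha> i (- n - int r) (\<alpha> i (int r) v)))"
    proof -
      have "\<alpha> i (int N) v = 0" using N3[OF i, of "int N"] by (simp add: N_def)
      then show ?thesis
        using sum.lessThan_Suc_shift[of "\<lambda>r. herm u (\<alpha> i (- n - int r) (\<alpha> i (int r) v))" N]
        by (simp add: \<alpha>_0 \<alpha>_zero herm_zero)
    qed
    finally have 1: "(\<Sum>r<N. herm (\<alpha> i (- 1 - int r) (\<alpha> i (n + 1 + int r) u)) v) =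
      (\<Sum>r<N. herm u (\<alpha> i (- n - int r) (\<alpha> i (int r) v)))" .
    have "(\<Sum>r<N. herm (\<alpha> i (n - int r) (\<alpha> i (int r) u)) v) =
        (\<Sum>r<N. herm u (\<alpha> i (- int r) (\<alpha> i (- n + int r) v)))"
      using i by (intro sum.cong refl) (simp add: herm_\<alpha> algebra_simps)
    also have "\<dots> = (\<Sum>r<N. herm u (\<alpha> i (- 1 - int r) (\<alpha> i (- n + 1 + int r) v)))"
    proof -
      have "\<alpha> i (- n + int N) v = 0" using N3[OF i, of "- n + int N"] by (simp add: N_def)
      then show ?thesis
        using sum.lessThan_Suc_shift[of "\<lambda>r. herm u (\<alpha> i (- int r) (\<alpha> i (- n + int r) v))" N]
        by (simp add: \<alpha>_0 \<alpha>_zero herm_zero algebra_simps)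
    qed
    finally show ?thesis using 1 by (simp add: sum.distrib)
  qed
  then show ?thesis
    unfolding N1[OF N(1)] N2[OF N(2)]
    by (simp add: herm_scale_left herm_scale_right herm_sum_left herm_sum_right herm_add_left herm_add_right)
qed

lemma L0_expansion:
  "\<exists>N0. \<forall>N\<ge>N0. L 0 v = (\<Sum>i<d. \<Sum>r\<in>{1..N}. \<alpha> i (- int r) (\<alpha> i (int r) v))"
proof -
  obtain N0 where N0: "\<And>N. N \<ge> N0 \<Longrightarrow> L 0 v = (1/2) *\<^sub>V
    (\<Sum>i<d. \<Sum>r<N. \<alpha> i (- 1 - int r) (\<alpha> i (0 + 1 + int r) v) + \<alpha> i (0 - int r) (\<alpha> i (int r) v))"
    using L_expansion by meson
  obtain N3 where N3: "\<And>i m. i < d \<Longrightarrow> m \<ge> N3 \<Longrightarrow> \<alpha> i m v = 0"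
    using \<alpha>_truncation_uniform by blast
  have "L 0 v = (\<Sum>i<d. \<Sum>r\<in>{1..N}. \<alpha> i (- int r) (\<alpha> i (int r) v))" if N: "N \<ge> N0 + nat \<bar>N3\<bar>" for N
  proof -
    have "(\<Sum>r<N. \<alpha> i (- 1 - int r) (\<alpha> i (0 + 1 + int r) v) + \<alpha> i (0 - int r) (\<alpha> i (int r) v)) =
       2 *\<^sub>V (\<Sum>r\<in>{1..N}. \<alpha> i (- int r) (\<alpha> i (int r) v))" if i: "i < d" for i
    proof -
      let ?f = "\<lambda>r. \<alpha> i (- int r) (\<alpha> i (int r) v)"
      have "(\<Sum>r<N. \<alpha> i (- 1 - int r) (\<alpha> i (0 + 1 + int r) v)) = (\<Sum>r<N. ?f (Suc r))"
        by (intro sum.cong refl) (simp add: algebra_simps)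
      also have "\<dots> = (\<Sum>r\<in>{1..N}. ?f r)"
        by (simp add: sum.atLeast1_atMost_eq)
      finally have 1: "(\<Sum>r<N. \<alpha> i (- 1 - int r) (\<alpha> i (0 + 1 + int r) v)) = (\<Sum>r\<in>{1..N}. ?f r)" .
      have "?f N = 0" using N3[OF i, of "int N"] N by (simp add: \<alpha>_zero)
      then have "(\<Sum>r<N. ?f r) = (\<Sum>r<N. ?f (Suc r))"
        using sum.lessThan_Suc_shift[of ?f N] by (simp add: \<alpha>_0 \<alpha>_zero)
      then have 2: "(\<Sum>r<N. \<alpha> i (0 - int r) (\<alpha> i (int r) v)) = (\<Sum>r\<in>{1..N}. ?f r)"
        by (simp add: sum.atLeast1_atMost_eq)
      show ?thesis
        unfolding sum.distrib 1 2 using scale_left_distrib[of 1 1] by simp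
    qed
    then show ?thesis
      using N by (simp add: N0[of N] scale_sum_right[symmetric])
  qed
  then show ?thesis by blast
qed

lemma herm_L0:
  "\<exists>N0. \<forall>N\<ge>N0. herm (L 0 v) v = (\<Sum>i<d. \<Sum>r\<in>{1..N}. herm (\<alpha> i (int r) v) (\<alpha> i (int r) v))"
proof -
  obtain N0 where N0: "\<And>N. N \<ge> N0 \<Longrightarrow> L 0 v = (\<Sum>i<d. \<Sum>r\<in>{1..N}. \<alpha> i (- int r) (\<alpha> i (int r) v))"
    using L0_expansion by meson
  have "herm (L 0 v) v = (\<Sum>i<d. \<Sum>r\<in>{1..N}. herm (\<alpha> i (int r) v) (\<alpha> i (int r) v))" if "N \<ge> N0" for N
    by (subst N0[OF that]) (simp add: herm_sum_left herm_\<alpha>)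
  then show ?thesis by blast
qed

text \<open>By \<open>herm_L0\<close>, \<open>k\<close> times the squared norm of \<open>v\<close>
  is a sum of squared norms, hence nonnegative.\<close>

lemma homogeneous_negative:
  assumes "k < 0"
  shows "homogeneous_space k = {0}"
proof -
  have "v = 0" if v: "v \<in> homogeneous_space k" for v
  proof -
    obtain N where "herm (L 0 v) v = (\<Sum>i<d. \<Sum>r\<in>{1..N}. herm (\<alpha> i (int r) v) (\<alpha> i (int r) v))"
      using herm_L0 by blast
    then have "Re (herm (L 0 v) v) \<ge> 0" by (simp add: sum_nonneg herm_nonneg)
    moreover have "herm (L 0 v) v = of_int k * herm v v"
      using v by (simp add: homogeneous_space_def herm_scale_left)
    ultimately have "of_int k * Re (herm v v) \<ge> 0" by simp
    then have "Re (herm v v) = 0"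
      using assms herm_nonneg(1)[of v] by (simp add: zero_le_mult_iff)
    then show ?thesis using herm_nonneg(2)[of v] by (intro herm_definite complex_eqI) auto
  qed
  then show ?thesis using homogeneous_subspace subspace_0 by blast
qed

lemma \<alpha>_above_degree:
  assumes "i < d" "v \<in> homogeneous_space k" "m > k"
  shows "\<alpha> i m v = 0"
  using \<alpha>_homogeneous[OF assms(1,2), of m] homogeneous_negative[of "k - m"] assms(3) by simp

lemma L_above_degree:
  assumes "v \<in> homogeneous_space k" "m > k"
  shows "L m v = 0"
  using L_homogeneous[OF assms(1), of m] homogeneous_negative[of "k - m"] assms(2) by simp

lemma herm_vac: "herm vac vac = 1"
proof -
  have "{M. fock_vac M \<noteq> 0} \<subseteq> {{#}}" by (auto simp: fock_vac_def)
  then show ?thesis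
    by (simp add: herm_def \<Phi> fock_form_superset[of "{{#}}"]) (simp add: fock_vac_def fock_weight_def)
qed

text \<open>After removing its vacuum component, \<open>v\<close> is orthogonal to
  \<open>vac\<close>; it is orthogonal to every other creation word because its annihilation modes
  land in negative degree.\<close>

lemma homogeneous_zero:
  assumes "v \<in> homogeneous_space 0"
  shows "v = herm v vac *\<^sub>V vac"
proof -
  have \<alpha>: "\<alpha> i (int m) v = 0" if "i < d" "m \<ge> 1" for i m
    using that \<alpha>_above_degree[OF _ assms] by simp
  let ?u = "v - herm v vac *\<^sub>V vac"
  have "herm x ?u = 0" for x
  proof -
    have "x \<in> span (creation_word ` lists creation_index)" by (simp add: span_creation_words)
    then show ?thesis
    proof (induction rule: span_induct_alt)
      case base
      then show ?case by (simp add: herm_zero)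
    next
      case (step c x y)
      then obtain ws where ws: "ws \<in> lists creation_index" "x = creation_word ws" by blast
      have "herm x ?u = 0"
      proof (cases ws)
        case Nil
        have "herm vac (u - c *\<^sub>V vac) = herm vac u - cnj c" for u c
          using herm_add_right[of vac "u - c *\<^sub>V vac" "c *\<^sub>V vac"] by (simp add: herm_scale_right herm_vac)
        then show ?thesis using ws Nil herm_cnj[of vac v] by (simp add: creation_word_simps)
      next
        case (Cons s ws')
        then obtain i m where "s = (i, m)" "i < d" "m \<ge> 1" using ws by (auto simp: creation_index_def)
        then show ?thesis
          using ws Cons by (simp add: creation_word_simps herm_\<alpha> \<alpha>_diff \<alpha>_scale \<alpha> \<alpha>_vac herm_zero)
      qed
      then show ?case using step by (simp add: herm_add_left herm_scale_left)
    qed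
  qed
  then have "?u = 0" by (intro herm_definite)
  then show ?thesis by simp
qed

text \<open>Euler's formula for the number operator \<open>L 0\<close> reduces the degree.\<close>

lemma homogeneous_span:
  assumes "k > 0" "v \<in> homogeneous_space (int k)"
  shows "v \<in> span {\<alpha> i (- int r) w | i r w. i < d \<and> 1 \<le> r \<and> r \<le> k \<and> w \<in> homogeneous_space (int (k - r))}"
    (is "_ \<in> ?S")
proof -
  obtain N where "L 0 v = (\<Sum>i<d. \<Sum>r\<in>{1..N}. \<alpha> i (- int r) (\<alpha> i (int r) v))"
    using L0_expansion by blast
  also have "\<dots> \<in> ?S"
  proof (intro span_sum)
    fix i r assume i: "i \<in> {..<d}" "r \<in> {1..N}"
    show "\<alpha> i (- int r) (\<alpha> i (int r) v) \<in> ?S"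
    proof (cases "r \<le> k")
      case True
      have *: "i < d" "1 \<le> r" using i by auto
      moreover have "\<alpha> i (int r) v \<in> homogeneous_space (int (k - r))"
        using \<alpha>_homogeneous[OF *(1) assms(2), of "int r"] True by (simp add: of_nat_diff)
      ultimately show ?thesis using True by (intro span_base) blast
    next
      case False
      then show ?thesis
        using \<alpha>_above_degree[OF _ assms(2), of i "int r"] i by (simp add: \<alpha>_zero span_zero)
    qed
  qed
  finally have "of_nat k *\<^sub>V v \<in> ?S" using assms(2) by (simp add: homogeneous_space_def)
  then have "(1 / of_nat k) *\<^sub>V of_nat k *\<^sub>V v \<in> ?S" by (rule span_scale)
  then show ?thesis using assms(1) by simp
qed

subsection \<open>The projection onto the Virasoro subalgebra\<close>

text \<open>The orthogonal complement of the Virasoro words is stable under all \<open>L n\<close>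
  by adjointness, so only the generating highest weight vector has to be tested. A nonempty word
  moves a positive mode onto it; the empty word is handled by \<open>L 0\<close>, whose eigenvalues
  on the two vectors are \<open>n > 0\<close> and 0.\<close>

lemma nonvac_orthogonal:
  assumes "x \<in> nonvac_space" "y \<in> V\<^sub>\<omega>"
  shows "herm x y = 0"
proof -
  let ?W = "span virasoro_words"
  define P where "P = {x. \<forall>y\<in>?W. herm x y = 0}"
  have P: "subspace P"
    by (auto simp: P_def subspace_def herm_zero herm_add_left herm_scale_left)
  have sub: "V\<^sub>\<omega>_submodule P"
    by (rule V\<^sub>\<omega>_submoduleI[OF P]) (auto simp: P_def herm_L L_span_virasoro_words)
  have "nonvac_space \<subseteq> P"
  proof (rule nonvac_least[OF P])
    fix n M assume n: "n \<ge> 1" "highest_weight_submodule n M"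
    then obtain v where v: "highest_weight_vector n v" "M = \<Inter> {M'. V\<^sub>\<omega>_submodule M' \<and> v \<in> M'}"
      by (auto simp: highest_weight_submodule_def)
    have "herm v y = 0" if "y \<in> ?W" for y
      using that
    proof (induction rule: span_induct_alt)
      case base
      then show ?case by (simp add: herm_zero)
    next
      case (step c x y)
      then obtain ms where ms: "ms \<in> lists {..<0}" "x = foldr L ms vac" by (auto simp: virasoro_words_def)
      have "herm v x = 0"
      proof (cases ms)
        case Nil
        have "of_int n * herm v vac = herm (L 0 v) vac"
          using v(1) by (simp add: highest_weight_vector_def herm_scale_left)
        also have "\<dots> = 0" by (simp add: herm_L L_vac herm_zero)
        finally show ?thesis using n(1) ms Nil by simp
      next
        case (Cons m ms')
        then have "m < 0" using ms by auto
        then have "L (- m) v = 0" using v(1) by (simp add: highest_weight_vector_def)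
        then show ?thesis using herm_L[of "- m" v "foldr L ms' vac"] ms Cons by (simp add: herm_zero)
      qed
      then show ?case using step by (simp add: herm_add_right herm_scale_right)
    qed
    then have "v \<in> P" by (simp add: P_def)
    then show "M \<subseteq> P" using v(2) sub by blast
  qed
  then show ?thesis using assms V\<^sub>\<omega>_subset by (auto simp: P_def)
qed

lemma \<pi>_eq:
  assumes "w \<in> V\<^sub>\<omega>" "v - w \<in> nonvac_space"
  shows "\<pi> v = w"
  unfolding \<pi>_def nonvac_space_def[symmetric]
proof (rule the_equality)
  fix w' assume w': "w' \<in> V\<^sub>\<omega> \<and> v - w' \<in> nonvac_space"
  have "(v - w) - (v - w') \<in> nonvac_space"
    using subspace_diff[OF nonvac_subspace assms(2)] w' by blast
  then have "w' - w \<in> nonvac_space" by simp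
  moreover have "w' - w \<in> V\<^sub>\<omega>" using subspace_diff[OF V\<^sub>\<omega>_closed(3)] assms(1) w' by blast
  ultimately have "herm (w' - w) (w' - w) = 0" by (rule nonvac_orthogonal)
  then show "w' = w" using herm_definite by fastforce
qed (use assms in auto)

end

subsection \<open>Traces over homogeneous spaces\<close>

lemma shift_recursion:
  fixes t g :: "nat \<Rightarrow> 'a::comm_monoid_add"
  assumes "s \<ge> 1" "\<And>k. t k = (if s \<le> k then t (k - s) + g (k - s) else 0)"
  shows "t k = (\<Sum>m | m \<in> {1..k} \<and> s dvd m. g (k - m))"
proof (induction k rule: less_induct)
  case (less k)
  show ?case
  proof (cases "s \<le> k")
    case True
    have "{m. m \<in> {1..k} \<and> s dvd m} = insert s ((+) s ` {m. m \<in> {1..k - s} \<and> s dvd m})"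
    proof (intro set_eqI iffI)
      fix m assume m: "m \<in> {m. m \<in> {1..k} \<and> s dvd m}"
      then obtain c where c: "m = s * c" by auto
      then have "c \<ge> 1" using m by (cases c) auto
      show "m \<in> insert s ((+) s ` {m. m \<in> {1..k - s} \<and> s dvd m})"
      proof (cases "c = 1")
        case False
        then have "m = s + s * (c - 1)" "s * (c - 1) \<in> {m. m \<in> {1..k - s} \<and> s dvd m}"
          using c m \<open>c \<ge> 1\<close> assms(1) by (auto simp: diff_mult_distrib2 Suc_le_eq)
        then show ?thesis by blast
      qed (use c in simp)
    qed (use True assms(1) in auto)
    moreover have "s \<notin> (+) s ` {m. m \<in> {1..k - s} \<and> s dvd m}" by auto
    ultimately have "(\<Sum>m | m \<in> {1..k} \<and> s dvd m. g (k - m)) =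
        g (k - s) + (\<Sum>m | m \<in> {1..k - s} \<and> s dvd m. g (k - s - m))"
      by (simp add: sum.reindex)
    then show ?thesis
      using less[of "k - s"] assms True by (simp add: add.commute)
  next
    case False
    then have "{m. m \<in> {1..k} \<and> s dvd m} = {}" by (auto dest: dvd_imp_le)
    then show ?thesis using assms(2)[of k] False by (simp only: sum.empty if_False)
  qed
qed

text \<open>Source of the divisor sums: the operators built from modes \<open>- s\<close> and
  \<open>s\<close> contribute at the multiples \<open>m\<close> of \<open>s\<close>, and collecting
  by \<open>m\<close> sums over its divisors.\<close>

lemma sum_divisors_swap:
  fixes w g :: "nat \<Rightarrow> 'a::semiring_0"
  shows "(\<Sum>s\<in>{1..k}. w s * (\<Sum>m | m \<in> {1..k} \<and> s dvd m. g m)) =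
    (\<Sum>m\<in>{1..k}. (\<Sum>s | s dvd m. w s) * g m)"
proof -
  have "(\<Sum>s\<in>{1..k}. w s * (\<Sum>m | m \<in> {1..k} \<and> s dvd m. g m)) =
      (\<Sum>s\<in>{1..k}. \<Sum>m\<in>{1..k}. if s dvd m then w s * g m else 0)"
    by (intro sum.cong refl) (simp add: sum.If_cases sum_distrib_left Int_def)
  also have "\<dots> = (\<Sum>m\<in>{1..k}. \<Sum>s\<in>{1..k}. if s dvd m then w s * g m else 0)"
    by (rule sum.swap)
  also have "\<dots> = (\<Sum>m\<in>{1..k}. (\<Sum>s | s dvd m. w s) * g m)"
  proof (intro sum.cong refl)
    fix m assume m: "m \<in> {1..k}"
    have "1 \<le> s \<and> s \<le> k" if "s dvd m" for s
      using m dvd_imp_le[OF that] dvd_pos_nat[OF _ that] by force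
    then have "{1..k} \<inter> {s. s dvd m} = {s. s dvd m}" by auto
    then show "(\<Sum>s\<in>{1..k}. if s dvd m then w s * g m else 0) = (\<Sum>s | s dvd m. w s) * g m"
      by (simp add: sum.If_cases sum_distrib_right)
  qed
  finally show ?thesis .
qed

context voa
begin

abbreviation tr :: "nat \<Rightarrow> ('v \<Rightarrow> 'v) \<Rightarrow> complex" where
  "tr k f \<equiv> trace_on (homogeneous_space (int k)) f"

definition zero_trace :: "nat \<Rightarrow> nat \<Rightarrow> 'v \<Rightarrow> complex" where
  "zero_trace k n v = tr k (Y v (int n - 1))"

lemma zero_mode_homogeneous:
  assumes "u \<in> homogeneous_space n"
  shows "Y u (n - 1) ` homogeneous_space k \<subseteq> homogeneous_space k"
  using mode_homogeneous[OF assms, of _ k "n - 1"] by auto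

lemma zero_trace_add:
  assumes "u \<in> homogeneous_space (int n)" "v \<in> homogeneous_space (int n)"
  shows "zero_trace k n (u + v) = zero_trace k n u + zero_trace k n v"
  unfolding zero_trace_def Y_add_left
  by (intro trace_on_add fin_subspace_homogeneous zero_mode_homogeneous assms)

lemma zero_trace_scale:
  assumes "u \<in> homogeneous_space (int n)"
  shows "zero_trace k n (c *\<^sub>V u) = c * zero_trace k n u"
  unfolding zero_trace_def Y_scale_left
  by (intro trace_on_scale fin_subspace_homogeneous zero_mode_homogeneous assms)

lemma zero_trace_zero: "zero_trace k n 0 = 0"
  unfolding zero_trace_def by (intro trace_on_zero fin_subspace_homogeneous) (simp add: Y_zero_left)

lemma zero_trace_diff:
  assumes "u \<in> homogeneous_space (int n)" "v \<in> homogeneous_space (int n)"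
  shows "zero_trace k n (u - v) = zero_trace k n u - zero_trace k n v"
  using zero_trace_add[of "u - v" n v k] assms subspace_diff[OF homogeneous_subspace assms] by simp

lemma zero_trace_sum:
  assumes "finite I" "\<And>i. i \<in> I \<Longrightarrow> f i \<in> homogeneous_space (int n)"
  shows "zero_trace k n (\<Sum>i\<in>I. f i) = (\<Sum>i\<in>I. zero_trace k n (f i))"
  using assms
proof (induction I rule: finite_induct)
  case (insert i I)
  then have "(\<Sum>i\<in>I. f i) \<in> homogeneous_space (int n)"
    by (intro subspace_sum homogeneous_subspace) auto
  then show ?case using insert by (simp add: zero_trace_add)
qed (simp add: zero_trace_zero)

lemma zero_trace_L_minus_1:
  assumes "u \<in> homogeneous_space (int n)"
  shows "zero_trace k (Suc n) (L (-1) u) = - of_nat n * zero_trace k n u"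
proof -
  have "zero_trace k (Suc n) (L (-1) u) = tr k (\<lambda>w. (- of_nat n) *\<^sub>V Y u (int n - 1) w)"
    unfolding zero_trace_def
    by (intro trace_on_cong fin_subspace_homogeneous) (simp add: L_derivative scale_minus_left)
  also have "\<dots> = - of_nat n * zero_trace k n u"
    unfolding zero_trace_def
    by (intro trace_on_scale fin_subspace_homogeneous zero_mode_homogeneous assms)
  finally show ?thesis .
qed

end

context free_boson_voa
begin

definition graded_dim :: "nat \<Rightarrow> nat" where
  "graded_dim k = dim (homogeneous_space (int k))"

lemma graded_dim_0: "graded_dim 0 > 0"
proof -
  have "graded_dim 0 \<noteq> 0"
  proof
    assume "graded_dim 0 = 0"
    then have "card (basis_of (homogeneous_space 0)) = 0"
      using basis_of(5)[OF fin_subspace_homogeneous, of 0] by (simp add: graded_dim_def)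
    then have "basis_of (homogeneous_space 0) = {}"
      using basis_of(3)[OF fin_subspace_homogeneous, of 0] by simp
    then have "homogeneous_space 0 = {0}"
      using basis_of(2)[OF fin_subspace_homogeneous, of 0] by simp
    then show False using vac_homogeneous vac_nonzero by auto
  qed
  then show ?thesis by simp
qed

lemma trace_shift:
  assumes f: "Vector_Spaces.linear scale scale f" "\<And>m v. v \<in> homogeneous_space m \<Longrightarrow> f v \<in> homogeneous_space (m + int s)"
    and g: "Vector_Spaces.linear scale scale g" "\<And>m v. v \<in> homogeneous_space m \<Longrightarrow> g v \<in> homogeneous_space (m - int s)"
  shows "tr k (\<lambda>v. f (g v)) = (if s \<le> k then tr (k - s) (\<lambda>v. g (f v)) else 0)"
proof (cases "s \<le> k")
  case True
  then have "int (k - s) = int k - int s" by simp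
  then have "tr k (\<lambda>v. f (g v)) = tr (k - s) (\<lambda>v. g (f v))"
    using f(2)[of _ "int k - int s"] g(2)[of _ "int k"]
    by (intro trace_on_cycle fin_subspace_homogeneous f(1) g(1)) (auto simp: image_subset_iff)
  then show ?thesis using True by simp
next
  case False
  interpret f: Vector_Spaces.linear scale scale f by (rule f)
  have "f (g v) = 0" if "v \<in> homogeneous_space (int k)" for v
    using g(2)[OF that] homogeneous_negative[of "int k - int s"] False f.zero by simp
  then show ?thesis using False by (simp add: trace_on_zero fin_subspace_homogeneous)
qed

text \<open>With zero commutator the trace descends unchanged from degree \<open>k\<close> to
  \<open>k - s\<close> and onwards, ending in negative degree.\<close>

lemma trace_shift_commuting:
  assumes f: "Vector_Spaces.linear scale scale f" "\<And>m v. v \<in> homogeneous_space m \<Longrightarrow> f v \<in> homogeneous_space (m + int s)"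
    and g: "Vector_Spaces.linear scale scale g" "\<And>m v. v \<in> homogeneous_space m \<Longrightarrow> g v \<in> homogeneous_space (m - int s)"
    and s: "s \<ge> 1" and comm: "\<And>v. g (f v) = f (g v)"
  shows "tr k (\<lambda>v. f (g v)) = 0"
proof -
  have "tr k (\<lambda>v. f (g v)) = (if s \<le> k then tr (k - s) (\<lambda>v. f (g v)) + 0 else 0)" for k
    using trace_shift[OF f g, of k] by (simp add: comm)
  from shift_recursion[OF s, of "\<lambda>k. tr k (\<lambda>v. f (g v))" "\<lambda>_. 0", OF this, of k] show ?thesis by simp
qed

lemma trace_\<alpha>\<alpha>:
  assumes "i < d" "s \<ge> 1"
  shows "tr k (\<lambda>v. \<alpha> i (- int s) (\<alpha> i (int s) v)) =
    of_nat s * (\<Sum>m | m \<in> {1..k} \<and> s dvd m. of_nat (graded_dim (k - m)))"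
proof -
  have deg: "\<alpha> i (- int s) v \<in> homogeneous_space (m + int s)" "\<alpha> i (int s) v \<in> homogeneous_space (m - int s)"
    if "v \<in> homogeneous_space m" for v m
    using \<alpha>_homogeneous[OF assms(1) that, of "- int s"] \<alpha>_homogeneous[OF assms(1) that, of "int s"] by simp_all
  have "tr k (\<lambda>v. \<alpha> i (- int s) (\<alpha> i (int s) v)) =
      (if s \<le> k then tr (k - s) (\<lambda>v. \<alpha> i (- int s) (\<alpha> i (int s) v)) + of_nat s * of_nat (graded_dim (k - s)) else 0)" for k
  proof -
    have "tr k (\<lambda>v. \<alpha> i (- int s) (\<alpha> i (int s) v)) =
        (if s \<le> k then tr (k - s) (\<lambda>v. \<alpha> i (int s) (\<alpha> i (- int s) v)) else 0)"
      by (rule trace_shift[OF \<alpha>_linear deg(1) \<alpha>_linear deg(2)])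
    also have "tr (k - s) (\<lambda>v. \<alpha> i (int s) (\<alpha> i (- int s) v)) =
        tr (k - s) (\<lambda>v. \<alpha> i (- int s) (\<alpha> i (int s) v) + of_nat s *\<^sub>V v)"
      using \<alpha>_commutator[OF assms(1,1), of "int s" "- int s"]
      by (intro trace_on_cong fin_subspace_homogeneous) simp
    also have "\<dots> = tr (k - s) (\<lambda>v. \<alpha> i (- int s) (\<alpha> i (int s) v)) + of_nat s * of_nat (graded_dim (k - s))"
      unfolding graded_dim_def trace_on_const[OF fin_subspace_homogeneous, symmetric]
      using deg(1)[OF deg(2)]
      by (intro trace_on_add fin_subspace_homogeneous) (auto intro: subspace_scale homogeneous_subspace)
    finally show ?thesis .
  qed
  from shift_recursion[OF assms(2), of "\<lambda>k. tr k (\<lambda>v. \<alpha> i (- int s) (\<alpha> i (int s) v))"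
      "\<lambda>k. of_nat s * of_nat (graded_dim k)", OF this, of k]
  show ?thesis by (simp add: sum_distrib_left)
qed

text \<open>On a fixed degree the commutator of \<open>L s\<close> and \<open>L (- s)\<close> is the
  scalar \<open>?c\<close>, since \<open>L 0\<close> is; the recursion therefore closes.\<close>

lemma trace_LL:
  assumes "s \<ge> 1"
  shows "tr k (\<lambda>v. L (- int s) (L (int s) v)) =
    (\<Sum>m | m \<in> {1..k} \<and> s dvd m.
      (2 * of_nat s * of_nat (k - m) + (of_nat s ^ 3 - of_nat s) / 12 * of_nat d) * of_nat (graded_dim (k - m)))"
proof -
  let ?c = "\<lambda>k. 2 * of_nat s * of_nat k + (of_nat s ^ 3 - of_nat s) / 12 * of_nat d :: complex"
  have deg: "L (- int s) v \<in> homogeneous_space (m + int s)" "L (int s) v \<in> homogeneous_space (m - int s)"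
    if "v \<in> homogeneous_space m" for v m
    using L_homogeneous[OF that, of "- int s"] L_homogeneous[OF that, of "int s"] by simp_all
  have "tr k (\<lambda>v. L (- int s) (L (int s) v)) =
      (if s \<le> k then tr (k - s) (\<lambda>v. L (- int s) (L (int s) v)) + ?c (k - s) * of_nat (graded_dim (k - s)) else 0)" for k
  proof -
    have "tr k (\<lambda>v. L (- int s) (L (int s) v)) =
        (if s \<le> k then tr (k - s) (\<lambda>v. L (int s) (L (- int s) v)) else 0)"
      by (rule trace_shift[OF L_linear deg(1) L_linear deg(2)])
    also have "tr (k - s) (\<lambda>v. L (int s) (L (- int s) v)) =
        tr (k - s) (\<lambda>v. L (- int s) (L (int s) v) + ?c (k - s) *\<^sub>V v)"
    proof (intro trace_on_cong fin_subspace_homogeneous)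
      fix v assume "v \<in> homogeneous_space (int (k - s))"
      then have "L 0 v = of_nat (k - s) *\<^sub>V v" by (simp add: homogeneous_space_def)
      then show "L (int s) (L (- int s) v) = L (- int s) (L (int s) v) + ?c (k - s) *\<^sub>V v"
        using virasoro_central_charge[of "int s" "- int s" v] by (simp add: algebra_simps)
    qed
    also have "\<dots> = tr (k - s) (\<lambda>v. L (- int s) (L (int s) v)) + ?c (k - s) * of_nat (graded_dim (k - s))"
      unfolding graded_dim_def trace_on_const[OF fin_subspace_homogeneous, symmetric]
      using deg(1)[OF deg(2)]
      by (intro trace_on_add fin_subspace_homogeneous) (auto intro: subspace_scale homogeneous_subspace)
    finally show ?thesis .
  qed
  from shift_recursion[OF assms, of "\<lambda>k. tr k (\<lambda>v. L (- int s) (L (int s) v))"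
      "\<lambda>k. ?c k * of_nat (graded_dim k)", OF this, of k]
  show ?thesis by simp
qed

lemma L0_homogeneous_expansion:
  assumes "v \<in> homogeneous_space (int k)"
  shows "(\<Sum>i<d. \<Sum>s\<in>{1..k}. \<alpha> i (- int s) (\<alpha> i (int s) v)) = of_nat k *\<^sub>V v"
proof -
  obtain N0 where N0: "\<And>N. N \<ge> N0 \<Longrightarrow> L 0 v = (\<Sum>i<d. \<Sum>r\<in>{1..N}. \<alpha> i (- int r) (\<alpha> i (int r) v))"
    using L0_expansion by meson
  have "(\<Sum>i<d. \<Sum>s\<in>{1..k}. \<alpha> i (- int s) (\<alpha> i (int s) v)) =
      (\<Sum>i<d. \<Sum>s\<in>{1..max k N0}. \<alpha> i (- int s) (\<alpha> i (int s) v))"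
    by (intro sum.cong refl sum.mono_neutral_left) (auto simp: \<alpha>_above_degree[OF _ assms] \<alpha>_zero)
  also have "\<dots> = L 0 v" by (rule N0[symmetric]) simp
  finally show ?thesis using assms by (simp add: homogeneous_space_def)
qed

text \<open>The trace of \<open>L 0\<close> taken twice, as the scalar \<open>k\<close> and as a sum
  of number operators. It is the coefficient form of the logarithmic derivative of the character,
  the product of the \<open>(1 - q^n)^(-d)\<close>.\<close>

lemma graded_dim_recursion: "real k * real (graded_dim k) = real d * (\<Sum>m\<in>{1..k}. sigma 1 m * real (graded_dim (k - m)))"
proof -
  have pres: "(\<lambda>v. \<alpha> i (- int s) (\<alpha> i (int s) v)) ` homogeneous_space (int k) \<subseteq> homogeneous_space (int k)"
    if "i < d" for i s
    using \<alpha>_homogeneous[OF that \<alpha>_homogeneous[OF that], of _ "int k" "- int s" "int s"] by auto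
  have pres': "(\<lambda>v. \<Sum>s\<in>{1..k}. \<alpha> i (- int s) (\<alpha> i (int s) v)) ` homogeneous_space (int k) \<subseteq> homogeneous_space (int k)"
    if "i < d" for i
    using pres[OF that] by (auto intro!: subspace_sum homogeneous_subspace)
  have "of_nat k * of_nat (graded_dim k) = tr k (\<lambda>v. of_nat k *\<^sub>V v)"
    by (simp add: trace_on_const fin_subspace_homogeneous graded_dim_def)
  also have "\<dots> = tr k (\<lambda>v. \<Sum>i<d. \<Sum>s\<in>{1..k}. \<alpha> i (- int s) (\<alpha> i (int s) v))"
    by (intro trace_on_cong fin_subspace_homogeneous L0_homogeneous_expansion[symmetric])
  also have "\<dots> = (\<Sum>i<d. tr k (\<lambda>v. \<Sum>s\<in>{1..k}. \<alpha> i (- int s) (\<alpha> i (int s) v)))"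
    by (rule trace_on_sum[OF fin_subspace_homogeneous finite_lessThan]) (rule pres', simp)
  also have "\<dots> = (\<Sum>i<d. \<Sum>s\<in>{1..k}. tr k (\<lambda>v. \<alpha> i (- int s) (\<alpha> i (int s) v)))"
    by (intro sum.cong refl trace_on_sum[OF fin_subspace_homogeneous finite_atLeastAtMost] pres) simp
  also have "\<dots> = (\<Sum>i<d. \<Sum>s\<in>{1..k}. of_nat s * (\<Sum>m | m \<in> {1..k} \<and> s dvd m. of_nat (graded_dim (k - m))))"
    by (intro sum.cong refl trace_\<alpha>\<alpha>) auto
  also have "\<dots> = of_nat d * (\<Sum>m\<in>{1..k}. (\<Sum>s | s dvd m. of_nat s) * of_nat (graded_dim (k - m)))"
    unfolding sum_divisors_swap by simp
  also have "\<dots> = complex_of_real (real d * (\<Sum>m\<in>{1..k}. sigma 1 m * real (graded_dim (k - m))))"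
    by (simp add: sigma_def)
  finally have "complex_of_real (real k * real (graded_dim k)) = complex_of_real (real d * (\<Sum>m\<in>{1..k}. sigma 1 m * real (graded_dim (k - m))))"
    by simp
  then show ?thesis by (simp only: of_real_eq_iff)
qed

text \<open>The \<open>r = 0\<close> terms vanish because \<open>\<alpha> i 0 = 0\<close>.\<close>

lemma zero_mode_product:
  assumes i: "i < d" and y: "y \<in> homogeneous_space (int n)" and v: "v \<in> homogeneous_space (int k)"
  shows "Y (\<alpha> i (-1) y) (int n) v =
    (\<Sum>r\<in>{1..k}. \<alpha> i (- int r) (Y y (int n - 1 + int r) v) + Y y (int n - 1 - int r) (\<alpha> i (int r) v))"
proof -
  have "Y (Y (\<alpha> i (-1) vac) (-1) y) (int n) v = Sum_any (\<lambda>r::nat.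
      \<alpha> i (- 1 - int r) (Y y (int n + int r) v) + Y y (int n - 1 - int r) (\<alpha> i (int r) v))"
    by (subst iterate_formula) (simp add: gchoose_minus_one flip: \<alpha>_eq_Y)
  also have "\<dots> = (\<Sum>r<Suc k. \<alpha> i (- 1 - int r) (Y y (int n + int r) v) + Y y (int n - 1 - int r) (\<alpha> i (int r) v))"
  proof (rule Sum_any_nat_eq)
    fix r assume r: "Suc k \<le> r"
    have "Y y (int n + int r) v \<in> homogeneous_space (int k + int n - (int n + int r) - 1)"
      by (rule mode_homogeneous[OF y v])
    then have "Y y (int n + int r) v = 0"
      using homogeneous_negative[of "int k + int n - (int n + int r) - 1"] r by simp
    moreover have "\<alpha> i (int r) v = 0" using \<alpha>_above_degree[OF i v, of "int r"] r by simp
    ultimately show "\<alpha> i (- 1 - int r) (Y y (int n + int r) v) + Y y (int n - 1 - int r) (\<alpha> i (int r) v) = 0"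
      by (simp add: \<alpha>_zero Y_zero_right)
  qed
  also have "\<dots> = (\<Sum>r\<in>{1..k}. \<alpha> i (- int r) (Y y (int n - 1 + int r) v)) +
      (\<Sum>r\<in>{1..k}. Y y (int n - 1 - int r) (\<alpha> i (int r) v))"
  proof -
    have "Y y (int n + int k) v \<in> homogeneous_space (int k + int n - (int n + int k) - 1)"
      by (rule mode_homogeneous[OF y v])
    then have "Y y (int n + int k) v = 0" using homogeneous_negative[of "-1"] by simp
    then have "(\<Sum>r<Suc k. \<alpha> i (- 1 - int r) (Y y (int n + int r) v)) =
        (\<Sum>r<k. \<alpha> i (- int (Suc r)) (Y y (int n - 1 + int (Suc r)) v))"
      by (simp add: \<alpha>_zero algebra_simps)
    moreover have "(\<Sum>r<Suc k. Y y (int n - 1 - int r) (\<alpha> i (int r) v)) =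
        (\<Sum>r<k. Y y (int n - 1 - int (Suc r)) (\<alpha> i (int (Suc r)) v))"
      unfolding sum.lessThan_Suc_shift by (simp add: \<alpha>_0 Y_zero_right)
    ultimately show ?thesis
      unfolding sum.distrib One_nat_def sum.atLeast1_atMost_eq by (simp only:)
  qed
  finally show ?thesis by (simp add: sum.distrib flip: \<alpha>_eq_Y)
qed

text \<open>Every summand of the zero mode is a product of two commuting operators of opposite
  nonzero degrees. The restriction on \<open>a + b\<close> matters for cubic vectors, where the
  commutator is a mode of \<open>\<alpha>\<close> and vanishes only at index 0.\<close>

lemma zero_trace_commuting:
  assumes i: "i < d" and y: "y \<in> homogeneous_space (int n)"
    and comm: "\<And>a b v. a + b = int n - 1 \<Longrightarrow> \<alpha> i a (Y y b v) = Y y b (\<alpha> i a v)"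
  shows "zero_trace k (Suc n) (\<alpha> i (-1) y) = 0"
proof -
  have \<alpha>1: "\<alpha> i (- int r) v \<in> homogeneous_space (m + int r)" "\<alpha> i (int r) v \<in> homogeneous_space (m - int r)"
    if "v \<in> homogeneous_space m" for v m r
    using \<alpha>_homogeneous[OF i that, of "- int r"] \<alpha>_homogeneous[OF i that, of "int r"] by simp_all
  have Y1: "Y y (int n - 1 + int r) v \<in> homogeneous_space (m - int r)"
    "Y y (int n - 1 - int r) v \<in> homogeneous_space (m + int r)" if "v \<in> homogeneous_space m" for v m r
    using mode_homogeneous[OF y that, of "int n - 1 + int r"] mode_homogeneous[OF y that, of "int n - 1 - int r"]
    by (simp_all add: algebra_simps)
  have 1: "tr k (\<lambda>v. \<alpha> i (- int r) (Y y (int n - 1 + int r) v)) = 0" if "r \<ge> 1" for r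
    by (rule trace_shift_commuting[OF \<alpha>_linear \<alpha>1(1) Y_linear_right Y1(1) that]) (auto simp: comm)
  have 2: "tr k (\<lambda>v. Y y (int n - 1 - int r) (\<alpha> i (int r) v)) = 0" if "r \<ge> 1" for r
    by (rule trace_shift_commuting[OF Y_linear_right Y1(2) \<alpha>_linear \<alpha>1(2) that]) (auto simp: comm)
  have p1: "(\<lambda>v. \<alpha> i (- int r) (Y y (int n - 1 + int r) v)) ` homogeneous_space (int k) \<subseteq> homogeneous_space (int k)"
    and p2: "(\<lambda>v. Y y (int n - 1 - int r) (\<alpha> i (int r) v)) ` homogeneous_space (int k) \<subseteq> homogeneous_space (int k)" for r
    using \<alpha>1(1)[OF Y1(1), of _ "int k" r r] Y1(2)[OF \<alpha>1(2), of _ "int k" r r] by auto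
  have "zero_trace k (Suc n) (\<alpha> i (-1) y) = tr k (\<lambda>v. \<Sum>r\<in>{1..k}.
      \<alpha> i (- int r) (Y y (int n - 1 + int r) v) + Y y (int n - 1 - int r) (\<alpha> i (int r) v))"
    unfolding zero_trace_def
    by (intro trace_on_cong fin_subspace_homogeneous) (simp add: zero_mode_product[OF i y])
  also have "\<dots> = (\<Sum>r\<in>{1..k}. tr k (\<lambda>v. \<alpha> i (- int r) (Y y (int n - 1 + int r) v) + Y y (int n - 1 - int r) (\<alpha> i (int r) v)))"
    using p1 p2
    by (intro trace_on_sum fin_subspace_homogeneous)
      (auto simp: image_subset_iff intro!: subspace_add homogeneous_subspace)
  also have "\<dots> = 0"
  proof (intro sum.neutral ballI)
    fix r assume "r \<in> {1..k}"
    then show "tr k (\<lambda>v. \<alpha> i (- int r) (Y y (int n - 1 + int r) v) + Y y (int n - 1 - int r) (\<alpha> i (int r) v)) = 0"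
      using 1 2 by (subst trace_on_add[OF fin_subspace_homogeneous p1 p2]) simp
  qed
  finally show ?thesis .
qed

section \<open>Evaluation on the vacuum and induction over low degrees\<close>

lemma L_\<alpha>: "i < d \<Longrightarrow> L n (\<alpha> i m v) = \<alpha> i m (L n v) - of_int m *\<^sub>V \<alpha> i (m + n) v"
  using \<alpha>_L_commutator[of i m n v] by simp

text \<open>The sign conditions orient \<open>\<alpha>_commutator\<close>: annihilators move right,
  so it can be used for rewriting without looping.\<close>

lemma \<alpha>_annihilate:
  assumes "i < d" "j < d" "m \<ge> 0" "n < 0"
  shows "\<alpha> i m (\<alpha> j n v) = \<alpha> j n (\<alpha> i m v) + (if i = j \<and> m + n = 0 then of_int m *\<^sub>V v else 0)"
  using \<alpha>_commutator assms by blast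

lemmas vac_simps = L_\<alpha> L_vac \<alpha>_vac \<alpha>_0 \<alpha>_zero L_zero \<alpha>_annihilate \<alpha>_diff \<alpha>_add \<alpha>_scale \<alpha>_uminus

lemma L_L_vac:
  "L (-1) \<omega> = L (-3) vac" "L (-1) (L (-3) vac) = 2 *\<^sub>V L (-4) vac" "L 1 \<omega> = 0" "L 2 \<omega> = (of_nat d / 2) *\<^sub>V vac"
  using virasoro_central_charge[of "-1" "-2" vac] virasoro_central_charge[of "-1" "-3" vac]
    virasoro_central_charge[of 1 "-2" vac] virasoro_central_charge[of 2 "-2" vac]
  by (simp_all add: L_minus_2_vac L_vac L_zero)

lemma \<omega>_homogeneous: "\<omega> \<in> homogeneous_space 2"
  using L_homogeneous[OF vac_homogeneous, of "-2"] by (simp add: L_minus_2_vac)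

lemma \<alpha>_vac_homogeneous: "i < d \<Longrightarrow> \<alpha> i (- int r) vac \<in> homogeneous_space (int r)"
  using \<alpha>_homogeneous[OF _ vac_homogeneous, of i "- int r"] by simp

lemma \<alpha>_creation_homogeneous:
  "i < d \<Longrightarrow> v \<in> homogeneous_space (int n) \<Longrightarrow> \<alpha> i (- int r) v \<in> homogeneous_space (int (n + r))"
  using \<alpha>_homogeneous[of i v "int n" "- int r"] by simp

lemma homogeneous_induct:
  assumes "k > 0" "subspace P"
    and "\<And>i r w. i < d \<Longrightarrow> 1 \<le> r \<Longrightarrow> r \<le> k \<Longrightarrow> w \<in> homogeneous_space (int (k - r)) \<Longrightarrow> \<alpha> i (- int r) w \<in> P"
    and "v \<in> homogeneous_space (int k)"
  shows "v \<in> P"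
proof -
  have "span {\<alpha> i (- int r) w | i r w. i < d \<and> 1 \<le> r \<and> r \<le> k \<and> w \<in> homogeneous_space (int (k - r))} \<subseteq> P"
    by (rule span_minimal) (use assms in auto)
  then show ?thesis using homogeneous_span[OF assms(1,4)] by blast
qed

lemma subspace_\<alpha>_vimage: "subspace P \<Longrightarrow> subspace {w. \<alpha> i n w \<in> P}"
  by (auto simp: subspace_def \<alpha>_zero \<alpha>_add \<alpha>_scale)

lemma \<alpha>_homogeneous_0:
  "subspace P \<Longrightarrow> \<alpha> i n vac \<in> P \<Longrightarrow> w \<in> homogeneous_space 0 \<Longrightarrow> \<alpha> i n w \<in> P"
  by (subst homogeneous_zero, assumption) (simp add: \<alpha>_scale subspace_scale)

lemma homogeneous_1_induct:
  assumes P: "subspace P" and "\<And>i. i < d \<Longrightarrow> \<alpha> i (-1) vac \<in> P" and "v \<in> homogeneous_space 1"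
  shows "v \<in> P"
proof (rule homogeneous_induct[of 1])
  fix i r w assume *: "i < d" "1 \<le> r" "r \<le> 1" "w \<in> homogeneous_space (int (1 - r))"
  then have "r = 1" by simp
  then show "\<alpha> i (- int r) w \<in> P" using \<alpha>_homogeneous_0[OF P assms(2)[OF *(1)], of w] *(4) by simp
qed (use assms in auto)

lemma homogeneous_2_induct:
  assumes P: "subspace P" and P1: "\<And>i j. i < d \<Longrightarrow> j < d \<Longrightarrow> \<alpha> i (-1) (\<alpha> j (-1) vac) \<in> P"
    and P2: "\<And>i. i < d \<Longrightarrow> \<alpha> i (-2) vac \<in> P" and "v \<in> homogeneous_space 2"
  shows "v \<in> P"
proof (rule homogeneous_induct[of 2])
  fix i r w assume *: "i < d" "1 \<le> r" "r \<le> 2" "w \<in> homogeneous_space (int (2 - r))"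
  then consider "r = 1" | "r = 2" by linarith
  then show "\<alpha> i (- int r) w \<in> P"
  proof cases
    case 1
    have "w \<in> {w. \<alpha> i (-1) w \<in> P}"
      by (rule homogeneous_1_induct) (use 1 * P1 in \<open>auto simp: subspace_\<alpha>_vimage P\<close>)
    then show ?thesis using 1 by simp
  next
    case 2
    then show ?thesis using \<alpha>_homogeneous_0[OF P P2[OF *(1)], of w] *(4) by simp
  qed
qed (use assms in auto)

lemma homogeneous_3_induct:
  assumes P: "subspace P"
    and P1: "\<And>i j l. i < d \<Longrightarrow> j < d \<Longrightarrow> l < d \<Longrightarrow> \<alpha> i (-1) (\<alpha> j (-1) (\<alpha> l (-1) vac)) \<in> P"
    and P2: "\<And>i j. i < d \<Longrightarrow> j < d \<Longrightarrow> \<alpha> i (-1) (\<alpha> j (-2) vac) \<in> P"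
    and P3: "\<And>i. i < d \<Longrightarrow> \<alpha> i (-3) vac \<in> P" and "v \<in> homogeneous_space 3"
  shows "v \<in> P"
proof (rule homogeneous_induct[of 3])
  fix i r w assume *: "i < d" "1 \<le> r" "r \<le> 3" "w \<in> homogeneous_space (int (3 - r))"
  then consider "r = 1" | "r = 2" | "r = 3" by linarith
  then show "\<alpha> i (- int r) w \<in> P"
  proof cases
    case 1
    have "w \<in> {w. \<alpha> i (-1) w \<in> P}"
      by (rule homogeneous_2_induct) (use 1 * P1 P2 in \<open>auto simp: subspace_\<alpha>_vimage P\<close>)
    then show ?thesis using 1 by simp
  next
    case 2
    have "w \<in> {w. \<alpha> i (-2) w \<in> P}"
    proof (rule homogeneous_1_induct)
      show "\<alpha> j (-1) vac \<in> {w. \<alpha> i (-2) w \<in> P}" if "j < d" for j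
        \<comment> \<open>Creation modes commute, so this vector is an instance of \<open>P2\<close>
          with the two indices exchanged.\<close>
        using P2[OF that *(1)] \<alpha>_commutator[OF *(1) that, of "-2" "-1" vac] by simp
    qed (use 2 * in \<open>auto simp: subspace_\<alpha>_vimage P\<close>)
    then show ?thesis using 2 by simp
  next
    case 3
    then show ?thesis using \<alpha>_homogeneous_0[OF P P3[OF *(1)], of w] *(4) by simp
  qed
qed (use assms in auto)

subsection \<open>The design property in degrees up to three\<close>

text \<open>Hypothesis \<open>Yy\<close> captures vectors such as
  \<open>\<alpha> i (-3) vac\<close>, whose modes are modes of \<open>\<alpha> i\<close> with
  polynomial coefficients. At \<open>b = n - 1 + s\<close> and \<open>b = n - 1 - s\<close> both
  halves of \<open>zero_mode_product\<close> become the same number operator.\<close>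

lemma zero_trace_quadratic:
  assumes i: "i < d" and y: "y \<in> homogeneous_space (int n)"
    and Yy: "\<And>b v. Y y b v = c b *\<^sub>V \<alpha> i (b - int n + 1) v"
  shows "zero_trace k (Suc n) (\<alpha> i (-1) y) =
    (\<Sum>s\<in>{1..k}. (c (int n - 1 + int s) + c (int n - 1 - int s)) * of_nat s *
      (\<Sum>m | m \<in> {1..k} \<and> s dvd m. of_nat (graded_dim (k - m))))"
proof -
  let ?c = "\<lambda>s. c (int n - 1 + int s) + c (int n - 1 - int s)"
  let ?N = "\<lambda>s v. \<alpha> i (- int s) (\<alpha> i (int s) v)"
  have N: "?N s ` homogeneous_space (int k) \<subseteq> homogeneous_space (int k)" for s
    using \<alpha>_homogeneous[OF i \<alpha>_homogeneous[OF i], of _ "int k" "- int s" "int s"] by auto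
  have "zero_trace k (Suc n) (\<alpha> i (-1) y) = tr k (\<lambda>v. \<Sum>s\<in>{1..k}. ?c s *\<^sub>V ?N s v)"
    unfolding zero_trace_def
  proof (intro trace_on_cong fin_subspace_homogeneous)
    fix v assume v: "v \<in> homogeneous_space (int k)"
    have "int (Suc n) - 1 = int n" by simp
    then show "Y (\<alpha> i (-1) y) (int (Suc n) - 1) v = (\<Sum>s\<in>{1..k}. ?c s *\<^sub>V ?N s v)"
      unfolding zero_mode_product[OF i y v] by (simp only:)
        (simp add: zero_mode_product[OF i y v] Yy \<alpha>_scale scale_left_distrib)
  qed
  also have "\<dots> = (\<Sum>s\<in>{1..k}. tr k (\<lambda>v. ?c s *\<^sub>V ?N s v))"
    using N by (intro trace_on_sum[OF fin_subspace_homogeneous])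
      (auto simp: image_subset_iff intro: subspace_scale homogeneous_subspace)
  also have "\<dots> = (\<Sum>s\<in>{1..k}. ?c s * (of_nat s * (\<Sum>m | m \<in> {1..k} \<and> s dvd m. of_nat (graded_dim (k - m)))))"
    by (intro sum.cong refl, subst trace_on_scale[OF fin_subspace_homogeneous N], subst trace_\<alpha>\<alpha>[OF i]) auto
  finally show ?thesis by (simp add: mult.assoc)
qed

lemma Y_\<alpha>_vac:
  assumes "i < d"
  shows "Y (\<alpha> i (-1) vac) n v = \<alpha> i n v"
    "Y (\<alpha> i (-2) vac) n v = (- of_int n) *\<^sub>V \<alpha> i (n - 1) v"
    "Y (\<alpha> i (-3) vac) n v = (of_int (n * (n - 1)) / 2) *\<^sub>V \<alpha> i (n - 2) v"
proof -
  show 1: "Y (\<alpha> i (-1) vac) n v = \<alpha> i n v" for n by (simp flip: \<alpha>_eq_Y)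
  have "L (-1) (\<alpha> i (-1) vac) = \<alpha> i (-2) vac" using assms by (simp add: vac_simps)
  then show 2: "Y (\<alpha> i (-2) vac) n v = (- of_int n) *\<^sub>V \<alpha> i (n - 1) v" for n
    using L_derivative[of "\<alpha> i (-1) vac" n v] by (simp add: 1)
  have "\<alpha> i (-3) vac = (1/2) *\<^sub>V L (-1) (\<alpha> i (-2) vac)" using assms by (simp add: vac_simps)
  then show "Y (\<alpha> i (-3) vac) n v = (of_int (n * (n - 1)) / 2) *\<^sub>V \<alpha> i (n - 2) v"
    by (simp add: Y_scale_left L_derivative 2)
      (simp add: right_diff_distrib minus_divide_left flip: scale_minus_left)
qed

text \<open>Names the projection by a witness instead of \<open>\<pi>\<close>. The property is then
  visibly closed under sums, scalars and \<open>L (-1)\<close>, so it can be checked on spanning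
  vectors before \<open>\<pi>_eq\<close> translates it.\<close>

definition trace_matched :: "nat \<Rightarrow> 'v \<Rightarrow> bool" where
  "trace_matched n v \<longleftrightarrow> v \<in> homogeneous_space (int n) \<and>
     (\<exists>w\<in>V\<^sub>\<omega> \<inter> homogeneous_space (int n). v - w \<in> nonvac_space \<and>
       (\<forall>k. zero_trace k n v = zero_trace k n w))"

lemma trace_matched_V\<^sub>\<omega>: "v \<in> V\<^sub>\<omega> \<Longrightarrow> v \<in> homogeneous_space (int n) \<Longrightarrow> trace_matched n v"
  using nonvac_subspace by (auto simp: trace_matched_def subspace_0 intro!: bexI[of _ v])

lemma trace_matched_nonvac:
  "v \<in> nonvac_space \<Longrightarrow> v \<in> homogeneous_space (int n) \<Longrightarrow> (\<And>k. zero_trace k n v = 0) \<Longrightarrow> trace_matched n v"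
  using V\<^sub>\<omega>_closed(3) homogeneous_subspace
  by (auto simp: trace_matched_def subspace_0 zero_trace_zero intro!: bexI[of _ 0])

lemma trace_matched_add:
  assumes "trace_matched n u" "trace_matched n v"
  shows "trace_matched n (u + v)"
proof -
  obtain w w' where w: "w \<in> V\<^sub>\<omega>" "w \<in> homogeneous_space (int n)" "u - w \<in> nonvac_space"
      "\<And>k. zero_trace k n u = zero_trace k n w"
    and w': "w' \<in> V\<^sub>\<omega>" "w' \<in> homogeneous_space (int n)" "v - w' \<in> nonvac_space"
      "\<And>k. zero_trace k n v = zero_trace k n w'"
    using assms unfolding trace_matched_def by blast
  have "u + v - (w + w') \<in> nonvac_space"
    using subspace_add[OF nonvac_subspace w(3) w'(3)] by (simp add: algebra_simps)
  then show ?thesis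
    using assms w w' subspace_add[OF V\<^sub>\<omega>_closed(3)] subspace_add[OF homogeneous_subspace]
    by (auto simp: trace_matched_def zero_trace_add intro!: bexI[of _ "w + w'"])
qed

lemma trace_matched_scale:
  assumes "trace_matched n v"
  shows "trace_matched n (c *\<^sub>V v)"
proof -
  obtain w where w: "w \<in> V\<^sub>\<omega>" "w \<in> homogeneous_space (int n)" "v - w \<in> nonvac_space"
      "\<And>k. zero_trace k n v = zero_trace k n w"
    using assms unfolding trace_matched_def by blast
  have "c *\<^sub>V v - c *\<^sub>V w \<in> nonvac_space"
    using subspace_scale[OF nonvac_subspace w(3)] by (simp add: scale_right_diff_distrib)
  then show ?thesis
    using assms w subspace_scale[OF V\<^sub>\<omega>_closed(3)] subspace_scale[OF homogeneous_subspace]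
    by (auto simp: trace_matched_def zero_trace_scale intro!: bexI[of _ "c *\<^sub>V w"])
qed

lemma trace_matched_subspace: "subspace {v. trace_matched n v}"
  using trace_matched_V\<^sub>\<omega>[of 0 n] V\<^sub>\<omega>_closed(3) homogeneous_subspace trace_matched_add trace_matched_scale
  by (auto simp: subspace_def)

lemma trace_matched_L_minus_1:
  assumes "trace_matched n v"
  shows "trace_matched (Suc n) (L (-1) v)"
proof -
  obtain w where w: "w \<in> V\<^sub>\<omega>" "w \<in> homogeneous_space (int n)" "v - w \<in> nonvac_space"
      "\<And>k. zero_trace k n v = zero_trace k n w" and v: "v \<in> homogeneous_space (int n)"
    using assms unfolding trace_matched_def by blast
  have deg: "L (-1) v \<in> homogeneous_space (int (Suc n))" "L (-1) w \<in> homogeneous_space (int (Suc n))"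
    using L_homogeneous[OF v, of "-1"] L_homogeneous[OF w(2), of "-1"] by (simp_all add: add.commute)
  moreover have "L (-1) v - L (-1) w \<in> nonvac_space"
    using L_nonvac[OF w(3), of "-1"] by (simp add: L_diff)
  ultimately show ?thesis
    using L_V\<^sub>\<omega>[OF w(1)] w(4) zero_trace_L_minus_1[OF v] zero_trace_L_minus_1[OF w(2)]
    by (auto simp: trace_matched_def intro!: bexI[of _ "L (-1) w"])
qed

lemma trace_matched_trace:
  assumes "trace_matched n v"
  shows "zero_trace k n v = zero_trace k n (\<pi> v)"
  using assms \<pi>_eq unfolding trace_matched_def by (metis Int_iff)

lemma trace_matched_0: "v \<in> homogeneous_space 0 \<Longrightarrow> trace_matched 0 v"
  using trace_matched_scale[OF trace_matched_V\<^sub>\<omega>[OF V\<^sub>\<omega>_closed(1)], of 0 "herm v vac"] homogeneous_zero[of v] vac_homogeneous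
  by simp

lemma trace_matched_1:
  assumes "v \<in> homogeneous_space 1"
  shows "trace_matched 1 v"
proof -
  have "\<alpha> i (-1) vac \<in> {v. trace_matched 1 v}" if i: "i < d" for i
  proof -
    have deg: "\<alpha> i (-1) vac \<in> homogeneous_space (int 1)" using \<alpha>_vac_homogeneous[OF i, of 1] by simp
    have "\<alpha> i (-1) vac \<in> nonvac_space"
      by (rule highest_weight_in_nonvac[OF deg]) (simp_all add: vac_simps i)
    moreover have "zero_trace k 1 (\<alpha> i (-1) vac) = 0" for k
      unfolding zero_trace_def
      by (intro trace_on_zero fin_subspace_homogeneous) (simp add: Y_\<alpha>_vac[OF i] \<alpha>_0)
    ultimately show ?thesis using trace_matched_nonvac[OF _ deg] by blast
  qed
  then show ?thesis using homogeneous_1_induct[OF trace_matched_subspace _ assms] by blast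
qed

lemma pair_homogeneous:
  assumes "i < d" "j < d"
  shows "\<alpha> i (-1) (\<alpha> j (-1) vac) \<in> homogeneous_space 2"
  using \<alpha>_creation_homogeneous[OF assms(1) \<alpha>_vac_homogeneous[OF assms(2), of 1], of 1] by simp

lemma trace_matched_2:
  assumes "v \<in> homogeneous_space 2"
  shows "trace_matched 2 v"
proof -
  let ?u = "\<lambda>i j. \<alpha> i (-1) (\<alpha> j (-1) vac)"
  have "trace_matched 2 (?u i j)" if i: "i < d" and j: "j < d" for i j
  proof (cases "i = j")
    case False
    have deg: "?u i j \<in> homogeneous_space (int 2)" using pair_homogeneous[OF i j] by simp
    have "?u i j \<in> nonvac_space"
      by (rule highest_weight_in_nonvac[OF deg]) (use i j False in \<open>simp_all add: vac_simps\<close>)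
    moreover have "zero_trace k 2 (?u i j) = 0" for k
      using zero_trace_commuting[OF i, of "\<alpha> j (-1) vac" 1 k] \<alpha>_vac_homogeneous[OF j, of 1]
        \<alpha>_commutator[OF i j] False by (simp add: Y_\<alpha>_vac[OF j] numeral_2_eq_2)
    ultimately show ?thesis using trace_matched_nonvac[OF _ deg] by blast
  next
    case True
    \<comment> \<open>The trace does not depend on the index \<open>l\<close>, so each diagonal
      vector carries \<open>2 / d\<close> of the trace of \<open>\<omega>\<close>.\<close>
    define X where "X k = (\<Sum>s\<in>{1..k}. 2 * of_nat s *
      (\<Sum>m | m \<in> {1..k} \<and> s dvd m. of_nat (graded_dim (k - m)) :: complex))" for k
    have X: "zero_trace k 2 (?u l l) = X k" if "l < d" for l k
      using zero_trace_quadratic[OF that, of "\<alpha> l (-1) vac" 1 "\<lambda>_. 1" k] \<alpha>_vac_homogeneous[OF that, of 1]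
      by (simp add: Y_\<alpha>_vac[OF that] X_def numeral_2_eq_2)
    have \<omega>: "zero_trace k 2 \<omega> = of_nat d / 2 * X k" for k
    proof -
      have "zero_trace k 2 \<omega> = 1/2 * zero_trace k 2 (\<Sum>l<d. ?u l l)"
        by (subst \<omega>_eq, rule zero_trace_scale)
          (auto intro!: subspace_sum homogeneous_subspace simp: pair_homogeneous)
      also have "zero_trace k 2 (\<Sum>l<d. ?u l l) = (\<Sum>l<d. zero_trace k 2 (?u l l))"
        by (rule zero_trace_sum) (auto simp: pair_homogeneous)
      finally show ?thesis by (simp add: X)
    qed
    have d0: "(of_nat d :: complex) \<noteq> 0" using i by simp
    \<comment> \<open>The factor is forced by \<open>L 2\<close>, which sends the diagonal vector to
      \<open>vac\<close> and \<open>\<omega>\<close> to \<open>d / 2\<close> times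
      \<open>vac\<close>.\<close>
    let ?w = "(2 / of_nat d) *\<^sub>V \<omega>"
    have w: "?w \<in> V\<^sub>\<omega>" "?w \<in> homogeneous_space (int 2)"
      using V\<^sub>\<omega>_closed(2,3) \<omega>_homogeneous homogeneous_subspace by (auto intro: subspace_scale)
    have deg: "?u i i - ?w \<in> homogeneous_space (int 2)"
      using w(2) pair_homogeneous[OF i i] subspace_diff[OF homogeneous_subspace] by simp
    have "?u i i - ?w \<in> nonvac_space"
      by (rule highest_weight_in_nonvac[OF deg])
        (use i d0 in \<open>simp_all add: vac_simps L_diff L_scale L_L_vac\<close>)
    moreover have "zero_trace k 2 (?u i i) = zero_trace k 2 ?w" for k
      using zero_trace_scale[of \<omega> 2 k "2 / of_nat d"] \<omega>_homogeneous d0 by (simp add: X[OF i] \<omega>)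
    ultimately show ?thesis
      using True w pair_homogeneous[OF i i] unfolding trace_matched_def by auto
  qed
  moreover have "trace_matched 2 (\<alpha> i (-2) vac)" if i: "i < d" for i
  proof -
    have "trace_matched (Suc 1) (L (-1) (\<alpha> i (-1) vac))"
      using \<alpha>_vac_homogeneous[OF i, of 1] by (intro trace_matched_L_minus_1 trace_matched_1) simp
    then show ?thesis using i by (simp add: vac_simps numeral_2_eq_2)
  qed
  ultimately have "v \<in> {v. trace_matched 2 v}"
    by (intro homogeneous_2_induct[OF trace_matched_subspace _ _ assms]) auto
  then show ?thesis by simp
qed

text \<open>For \<open>q\<close> of degree one, \<open>L (-2) q - (1/2) L (-1)\<^sup>2 q\<close> is annihilated by \<open>L 1\<close>, and \<open>L 2\<close> sends it
  to \<open>(1 + d/2) q\<close>; subtracting a multiple of it turns the cubic vectors into primary ones.\<close>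

lemma degree_3_in_nonvac:
  assumes v: "v \<in> homogeneous_space 3" "L 1 v = 0"
  shows "v \<in> nonvac_space"
proof -
  define q where "q = L 2 v"
  have q: "q \<in> homogeneous_space 1" using L_homogeneous[OF v(1), of 2] by (simp add: q_def)
  \<comment> \<open>\<open>L 1\<close> sends \<open>\<alpha> i (-1) vac\<close> to
    \<open>\<alpha> i 0 vac = 0\<close>, so it kills all of degree one.\<close>
  have "subspace {v. L 1 v = 0}" by (auto simp: subspace_def L_add L_scale L_zero)
  from homogeneous_1_induct[OF this _ q] have L1q: "L 1 q = 0" by (simp add: vac_simps)
  have L2q: "L 2 q = 0" by (rule L_above_degree[OF q]) simp
  have L0q: "L 0 q = q" using q by (simp add: homogeneous_space_def)
  have q_nonvac: "q \<in> nonvac_space" by (rule highest_weight_in_nonvac[OF q]) (simp_all add: L1q L2q)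
  define z where "z = L (-2) q - (1/2) *\<^sub>V L (-1) (L (-1) q)"
  have L1L: "L 1 (L (-1) q) = 2 *\<^sub>V q" "L 2 (L (-1) q) = 0"
    using virasoro_central_charge[of 1 "-1" q] virasoro_central_charge[of 2 "-1" q]
    by (simp_all add: L1q L2q L0q L_zero)
  have L0L: "L 0 (L (-1) q) = 2 *\<^sub>V L (-1) q"
    using L_homogeneous[OF q, of "-1"] by (simp add: homogeneous_space_def)
  have "L 1 (L (-1) (L (-1) q)) = 6 *\<^sub>V L (-1) q" "L 2 (L (-1) (L (-1) q)) = 6 *\<^sub>V q"
    "L 1 (L (-2) q) = 3 *\<^sub>V L (-1) q" "L 2 (L (-2) q) = (4 + of_nat d / 2) *\<^sub>V q"
    using virasoro_central_charge[of 1 "-1" "L (-1) q"] virasoro_central_charge[of 2 "-1" "L (-1) q"]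
      virasoro_central_charge[of 1 "-2" q] virasoro_central_charge[of 2 "-2" q]
    by (simp_all add: L1q L2q L0q L1L L0L L_zero L_scale flip: scale_left_distrib)
  then have z1: "L 1 z = 0" and z2: "L 2 z = (1 + of_nat d / 2) *\<^sub>V q"
    by (simp_all add: z_def L_diff L_scale flip: scale_left_diff_distrib)
  have z_deg: "z \<in> homogeneous_space 3"
    using L_homogeneous[OF q, of "-2"] L_homogeneous[OF L_homogeneous[OF q], of "-1" "-1"]
    unfolding z_def by (auto intro!: subspace_diff subspace_scale homogeneous_subspace)
  have z_nonvac: "z \<in> nonvac_space"
    unfolding z_def
    by (intro subspace_diff[OF nonvac_subspace] subspace_scale[OF nonvac_subspace] L_nonvac q_nonvac)
  define c :: complex where "c = 1 / (1 + of_nat d / 2)"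
  have c0: "(1 + of_nat d / 2 :: complex) \<noteq> 0"
    using of_nat_neq_0[of "Suc d", where 'a = complex] by (simp add: add_divide_eq_iff flip: of_nat_add)
  have "v - c *\<^sub>V z \<in> nonvac_space"
  proof (rule highest_weight_in_nonvac)
    show "v - c *\<^sub>V z \<in> homogeneous_space 3"
      using v(1) z_deg by (intro subspace_diff subspace_scale homogeneous_subspace)
    show "L 1 (v - c *\<^sub>V z) = 0" by (simp add: L_diff L_scale v(2) z1)
    show "L 2 (v - c *\<^sub>V z) = 0" using c0 by (simp add: L_diff L_scale z2 c_def flip: q_def)
  qed simp
  from subspace_add[OF nonvac_subspace this subspace_scale[OF nonvac_subspace z_nonvac, of c]]
  show ?thesis by simp
qed

lemma trace_matched_3:
  assumes "v \<in> homogeneous_space 3"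
  shows "trace_matched 3 v"
proof -
  let ?u = "\<lambda>i j. \<alpha> i (-1) (\<alpha> j (-1) vac)"
  have "trace_matched 3 (\<alpha> i (-1) (?u j l))" if i: "i < d" and j: "j < d" and l: "l < d" for i j l
  proof -
    have u: "?u j l \<in> homogeneous_space (int 2)" using pair_homogeneous[OF j l] by simp
    have deg: "\<alpha> i (-1) (?u j l) \<in> homogeneous_space (int 3)"
      using \<alpha>_creation_homogeneous[OF i u, of 1] by simp
    have "\<alpha> i (-1) (?u j l) \<in> nonvac_space"
      using deg by (intro degree_3_in_nonvac) (use i j l in \<open>simp_all add: vac_simps\<close>)
    moreover have "zero_trace k (Suc 2) (\<alpha> i (-1) (?u j l)) = 0" for k
    proof (rule zero_trace_commuting[OF i u])
      \<comment> \<open>The commutator need not vanish for arbitrary modes; for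
        \<open>a + b = 1\<close> it is a combination of \<open>\<alpha> l 0\<close> and
        \<open>\<alpha> j 0\<close>, hence zero.\<close>
      fix a b v assume ab: "a + b = int 2 - 1"
      have "Y (\<alpha> i (-1) vac) a (Y (?u j l) b v) - Y (?u j l) b (Y (\<alpha> i (-1) vac) a v) =
        Sum_any (\<lambda>r::nat. (of_int a gchoose r) *\<^sub>V Y (Y (\<alpha> i (-1) vac) (int r) (?u j l)) (a + b - int r) v)"
        by (rule commutator_formula)
      also have "\<dots> = Sum_any (\<lambda>r::nat. 0 :: 'v)"
      proof (intro arg_cong[of _ _ Sum_any] ext)
        fix r :: nat
        have "\<alpha> i (int r) (?u j l) = (if r = 1 then (if i = j then \<alpha> l (-1) vac else 0) + (if i = l then \<alpha> j (-1) vac else 0) else 0)"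
          using i j l by (auto simp: vac_simps)
        then show "(of_int a gchoose r) *\<^sub>V Y (Y (\<alpha> i (-1) vac) (int r) (?u j l)) (a + b - int r) v = 0"
          using ab i j l by (simp add: Y_\<alpha>_vac Y_zero_left Y_add_left \<alpha>_0)
      qed
      finally show "\<alpha> i a (Y (?u j l) b v) = Y (?u j l) b (\<alpha> i a v)"
        by (simp add: Y_\<alpha>_vac i)
    qed
    ultimately show ?thesis using trace_matched_nonvac[OF _ deg] by simp
  qed
  moreover have "trace_matched 3 (\<alpha> i (-1) (\<alpha> j (-2) vac))" if i: "i < d" and j: "j < d" for i j
  proof -
    \<comment> \<open>The antisymmetric part. The symmetric part is the derivative of
      \<open>?u i j\<close>, already treated in degree two, while \<open>L 1\<close> kills
      \<open>a\<close>, whose trace vanishes.\<close>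
    define a where "a = \<alpha> i (-1) (\<alpha> j (-2) vac) - \<alpha> i (-2) (\<alpha> j (-1) vac)"
    have deg: "\<alpha> i (-1) (\<alpha> j (-2) vac) \<in> homogeneous_space (int 3)"
        "\<alpha> i (-2) (\<alpha> j (-1) vac) \<in> homogeneous_space (int 3)" if "i < d" "j < d" for i j
      using \<alpha>_creation_homogeneous[OF that(1) \<alpha>_vac_homogeneous[OF that(2), of 2], of 1]
        \<alpha>_creation_homogeneous[OF that(1) \<alpha>_vac_homogeneous[OF that(2), of 1], of 2] by simp_all
    then have deg_a: "a \<in> homogeneous_space (int 3)"
      unfolding a_def using i j by (intro subspace_diff homogeneous_subspace) auto
    have swap: "\<alpha> i (-2) (\<alpha> j (-1) vac) = \<alpha> j (-1) (\<alpha> i (-2) vac)"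
      using \<alpha>_commutator[OF i j, of "-2" "-1" vac] by simp
    have "a \<in> nonvac_space"
      using deg_a by (intro degree_3_in_nonvac) (use i j in \<open>simp_all add: a_def vac_simps L_diff\<close>)
    moreover have "zero_trace k 3 a = 0" for k
    proof (cases "i = j")
      case True
      then show ?thesis using swap by (simp add: a_def zero_trace_zero)
    next
      case False
      have "zero_trace k (Suc 2) (\<alpha> i (-1) (\<alpha> j (-2) vac)) = 0" if "i < d" "j < d" "i \<noteq> j" for i j
        using \<alpha>_vac_homogeneous[OF that(2), of 2] that
        by (intro zero_trace_commuting) (auto simp: Y_\<alpha>_vac \<alpha>_scale \<alpha>_uminus \<alpha>_commutator[of i j])
      from this[OF i j False] this[OF j i] False show ?thesis
        unfolding a_def using deg[OF i j] by (subst zero_trace_diff) (simp_all add: swap)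
    qed
    ultimately have "trace_matched 3 a" using deg_a by (intro trace_matched_nonvac) auto
    moreover have "trace_matched (Suc 2) (L (-1) (?u i j))"
      using pair_homogeneous[OF i j] by (intro trace_matched_L_minus_1 trace_matched_2)
    ultimately have "trace_matched 3 ((1/2) *\<^sub>V (L (-1) (?u i j) + a))"
      by (intro trace_matched_scale trace_matched_add) simp_all
    moreover have "L (-1) (?u i j) + a = 2 *\<^sub>V \<alpha> i (-1) (\<alpha> j (-2) vac)"
      using i j scale_left_distrib[of 1 1 "\<alpha> i (-1) (\<alpha> j (-2) vac)"] by (simp add: a_def vac_simps)
    ultimately show ?thesis by simp
  qed
  moreover have "trace_matched 3 (\<alpha> i (-3) vac)" if i: "i < d" for i
  proof -
    have "trace_matched (Suc 2) (L (-1) (\<alpha> i (-2) vac))"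
      using \<alpha>_vac_homogeneous[OF i, of 2] by (intro trace_matched_L_minus_1 trace_matched_2) simp
    then have "trace_matched 3 (2 *\<^sub>V \<alpha> i (-3) vac)"
      using i by (simp add: vac_simps)
    from trace_matched_scale[OF this, of "1/2"] show ?thesis by simp
  qed
  ultimately have "v \<in> {v. trace_matched 3 v}"
    by (intro homogeneous_3_induct[OF trace_matched_subspace _ _ _ assms]) auto
  then show ?thesis by simp
qed

subsection \<open>Failure in degree four\<close>

text \<open>Being quadratic, it has a trace made of number operators; summing over \<open>i\<close>
  makes its images under \<open>L 1\<close> and \<open>L 2\<close> lie in
  \<open>V\<^sub>\<omega>\<close>, so its projection can be solved for.\<close>

definition B\<^sub>4 :: 'v where
  "B\<^sub>4 = (\<Sum>i<d. \<alpha> i (-1) (\<alpha> i (-3) vac))"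

lemma \<alpha>\<alpha>_4_homogeneous: "i < d \<Longrightarrow> \<alpha> i (-1) (\<alpha> i (-3) vac) \<in> homogeneous_space (int 4)"
  using \<alpha>_creation_homogeneous[OF _ \<alpha>_vac_homogeneous[of i 3], of i 1] by simp

lemma B\<^sub>4_homogeneous: "B\<^sub>4 \<in> homogeneous_space (int 4)"
  unfolding B\<^sub>4_def by (intro subspace_sum homogeneous_subspace \<alpha>\<alpha>_4_homogeneous) simp

lemma virasoro_4_homogeneous:
  "L (-2) \<omega> \<in> homogeneous_space (int 4)" "L (-4) vac \<in> homogeneous_space (int 4)"
  using L_homogeneous[OF \<omega>_homogeneous, of "-2"] L_homogeneous[OF vac_homogeneous, of "-4"] by simp_all

text \<open>For a candidate \<open>x L (-2) \<omega> + y L (-4) vac\<close>, matching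
  \<open>L 1\<close> gives \<open>3 x + 5 y = 3\<close> and matching \<open>L 2\<close> gives
  \<open>(8 + d) x + 6 y = 6\<close>. Eliminating \<open>y\<close> leaves
  \<open>(5 d + 22) x = 12\<close>.\<close>

lemma \<pi>_B\<^sub>4:
  fixes c :: complex
  defines "c \<equiv> 12 / of_nat (5 * d + 22)"
  shows "\<pi> B\<^sub>4 = c *\<^sub>V L (-2) \<omega> + (3 * (1 - c) / 5) *\<^sub>V L (-4) vac" (is "_ = ?w")
proof (rule \<pi>_eq)
  show "?w \<in> V\<^sub>\<omega>"
    by (intro subspace_add subspace_scale V\<^sub>\<omega>_closed(3) L_V\<^sub>\<omega> V\<^sub>\<omega>_closed(1,2))
  have deg: "B\<^sub>4 - ?w \<in> homogeneous_space 4"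
    using virasoro_4_homogeneous B\<^sub>4_homogeneous
    by (intro subspace_diff subspace_add subspace_scale homogeneous_subspace) simp_all
  have \<omega>3: "L (-3) vac = (\<Sum>i<d. \<alpha> i (-1) (\<alpha> i (-2) vac))"
  proof -
    have "L (-1) (\<alpha> i (-1) (\<alpha> i (-1) vac)) = 2 *\<^sub>V \<alpha> i (-1) (\<alpha> i (-2) vac)" if "i < d" for i
      using that \<alpha>_commutator[OF that that, of "-2" "-1" vac]
        scale_left_distrib[of 1 1 "\<alpha> i (-1) (\<alpha> i (-2) vac)"] by (simp add: vac_simps)
    then show ?thesis
      using arg_cong[OF \<omega>_eq, of "L (-1)"] by (simp add: L_L_vac L_scale L_sum scale_sum_right)
  qed
  have B1: "L 1 B\<^sub>4 = 3 *\<^sub>V L (-3) vac"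
    unfolding B\<^sub>4_def \<omega>3 by (simp add: L_sum vac_simps scale_sum_right)
  have B2: "L 2 B\<^sub>4 = 6 *\<^sub>V \<omega>"
  proof -
    have "L 2 B\<^sub>4 = 3 *\<^sub>V (\<Sum>i<d. \<alpha> i (-1) (\<alpha> i (-1) vac))"
      unfolding B\<^sub>4_def by (simp add: L_sum vac_simps scale_sum_right)
    also have "\<dots> = 6 *\<^sub>V \<omega>" by (subst \<omega>_eq) simp
    finally show ?thesis .
  qed
  have L1: "L 1 (L (-2) \<omega>) = 3 *\<^sub>V L (-3) vac" "L 1 (L (-4) vac) = 5 *\<^sub>V L (-3) vac"
    using virasoro_central_charge[of 1 "-2" \<omega>] virasoro_central_charge[of 1 "-4" vac]
    by (simp_all add: L_L_vac L_vac L_zero)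
  have "L 0 \<omega> = 2 *\<^sub>V \<omega>" using \<omega>_homogeneous by (simp add: homogeneous_space_def)
  then have L2: "L 2 (L (-2) \<omega>) = (8 + of_nat d) *\<^sub>V \<omega>" "L 2 (L (-4) vac) = 6 *\<^sub>V \<omega>"
    using virasoro_central_charge[of 2 "-2" \<omega>] virasoro_central_charge[of 2 "-4" vac]
    by (simp_all add: L_L_vac L_vac L_zero L_scale L_minus_2_vac flip: scale_left_distrib)
  have d0: "(of_nat (5 * d + 22) :: complex) \<noteq> 0" unfolding of_nat_eq_0_iff by simp
  have "c * of_nat (5 * d + 22) = 12"
    by (rule nonzero_eq_divide_eq[OF d0, THEN iffD1]) (simp only: c_def)
  then have c: "c * (5 * of_nat d + 22) = 12" by simp
  have "L 1 (B\<^sub>4 - ?w) = (3 - (c * 3 + 3 * (1 - c) / 5 * 5)) *\<^sub>V L (-3) vac"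
    by (simp add: L_diff L_add L_scale B1 L1 flip: scale_left_diff_distrib scale_left_distrib)
  moreover have "3 - (c * 3 + 3 * (1 - c) / 5 * 5) = 0" by (simp add: field_simps)
  ultimately have 1: "L 1 (B\<^sub>4 - ?w) = 0" by simp
  have "L 2 (B\<^sub>4 - ?w) = (6 - (c * (8 + of_nat d) + 3 * (1 - c) / 5 * 6)) *\<^sub>V \<omega>"
    by (simp add: L_diff L_add L_scale B2 L2 flip: scale_left_diff_distrib scale_left_distrib)
  moreover have "6 - (c * (8 + of_nat d) + 3 * (1 - c) / 5 * 6) = 12/5 - c * (5 * of_nat d + 22) / 5"
    by (simp add: field_simps)
  ultimately have 2: "L 2 (B\<^sub>4 - ?w) = 0" using c by simp
  show "B\<^sub>4 - ?w \<in> nonvac_space"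
    by (rule highest_weight_in_nonvac[OF deg _ 1 2]) simp
qed

lemma zero_trace_B\<^sub>4:
  "zero_trace k 4 B\<^sub>4 = of_real (real d * (\<Sum>m\<in>{1..k}. (sigma 3 m + 2 * sigma 1 m) * real (graded_dim (k - m))))"
proof -
  have "zero_trace k (Suc 3) (\<alpha> i (-1) (\<alpha> i (-3) vac)) =
      (\<Sum>m\<in>{1..k}. (\<Sum>s | s dvd m. of_nat s ^ 3 + 2 * of_nat s) * of_nat (graded_dim (k - m)))" if i: "i < d" for i
  proof -
    have "zero_trace k (Suc 3) (\<alpha> i (-1) (\<alpha> i (-3) vac)) =
      (\<Sum>s\<in>{1..k}. (of_int ((int 3 - 1 + int s) * (int 3 - 1 + int s - 1)) / 2 +
          of_int ((int 3 - 1 - int s) * (int 3 - 1 - int s - 1)) / 2) * of_nat s *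
        (\<Sum>m | m \<in> {1..k} \<and> s dvd m. of_nat (graded_dim (k - m))))"
      by (rule zero_trace_quadratic[OF i]) (use \<alpha>_vac_homogeneous[OF i, of 3] in \<open>simp_all add: Y_\<alpha>_vac i\<close>)
    \<comment> \<open>The coefficients \<open>n (n - 1) / 2\<close> at \<open>n = 2 + s\<close> and
      \<open>n = 2 - s\<close> add up to \<open>s^2 + 2\<close>.\<close>
    also have "\<dots> = (\<Sum>s\<in>{1..k}. (of_nat s ^ 3 + 2 * of_nat s) *
        (\<Sum>m | m \<in> {1..k} \<and> s dvd m. of_nat (graded_dim (k - m))))"
      by (intro sum.cong refl arg_cong2[of _ _ _ _ "(*)"]) (simp add: field_simps power3_eq_cube)
    finally show ?thesis unfolding sum_divisors_swap .
  qed
  then have "zero_trace k 4 B\<^sub>4 = (\<Sum>i<d. \<Sum>m\<in>{1..k}. (\<Sum>s | s dvd m. of_nat s ^ 3 + 2 * of_nat s) * of_nat (graded_dim (k - m)))"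
    unfolding B\<^sub>4_def by (subst zero_trace_sum) (auto simp: \<alpha>\<alpha>_4_homogeneous[simplified])
  then show ?thesis by (simp add: sigma_def sum.distrib sum_distrib_left)
qed

lemma zero_trace_\<omega>: "zero_trace k 2 \<omega> = of_nat k * of_nat (graded_dim k)"
proof -
  have "zero_trace k 2 \<omega> = tr k (\<lambda>v. of_nat k *\<^sub>V v)"
    unfolding zero_trace_def
    by (intro trace_on_cong fin_subspace_homogeneous) (simp add: homogeneous_space_def L_def)
  then show ?thesis by (simp add: trace_on_const fin_subspace_homogeneous graded_dim_def)
qed

text \<open>\<open>L (-4) vac\<close> is half the second derivative of \<open>\<omega>\<close>; the
  two derivative factors \<open>-3\<close> and \<open>-2\<close> then give \<open>3\<close>.\<close>

lemma zero_trace_L_minus_4: "zero_trace k 4 (L (-4) vac) = 3 * of_nat k * of_nat (graded_dim k)"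
proof -
  have "L (-1) \<omega> \<in> homogeneous_space (int 3)" using L_homogeneous[OF \<omega>_homogeneous, of "-1"] by simp
  then have "zero_trace k (Suc 3) (L (-1) (L (-1) \<omega>)) = - of_nat 3 * zero_trace k (Suc 2) (L (-1) \<omega>)"
    by (subst zero_trace_L_minus_1) simp_all
  also have "zero_trace k (Suc 2) (L (-1) \<omega>) = - of_nat 2 * zero_trace k 2 \<omega>"
    using \<omega>_homogeneous by (subst zero_trace_L_minus_1) simp_all
  finally have "zero_trace k 4 (2 *\<^sub>V L (-4) vac) = 6 * of_nat k * of_nat (graded_dim k)"
    by (simp add: L_L_vac zero_trace_\<omega>)
  then show ?thesis by (simp add: zero_trace_scale virasoro_4_homogeneous[simplified])
qed

lemma zero_mode_L_minus_2_\<omega>: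
  assumes v: "v \<in> homogeneous_space (int k)"
  shows "Y (L (-2) \<omega>) 3 v =
    (of_nat k ^ 2 + 2 * of_nat k) *\<^sub>V v + 2 *\<^sub>V (\<Sum>s\<in>{1..k}. L (- int s) (L (int s) v))"
proof -
  let ?N = "\<lambda>s. L (- int s) (L (int s) v)"
  have L0v: "L 0 v = of_nat k *\<^sub>V v" using v by (simp add: homogeneous_space_def)
  have "Y (Y \<omega> (-1) \<omega>) 3 v = Sum_any (\<lambda>r::nat. L (- 2 - int r) (L (2 + int r) v) + L (1 - int r) (L (int r - 1) v))"
    by (subst iterate_formula) (simp add: gchoose_minus_one, simp add: L_def algebra_simps)
  also have "\<dots> = (\<Sum>r<k + 2. L (- 2 - int r) (L (2 + int r) v) + L (1 - int r) (L (int r - 1) v))"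
    by (rule Sum_any_nat_eq) (simp add: L_above_degree[OF v] L_zero)
  also have "\<dots> = (\<Sum>r<k + 2. ?N (r + 2)) + (\<Sum>r<k + 2. L (1 - int r) (L (int r - 1) v))"
  proof -
    have "- 2 - int r = - int (r + 2)" "2 + int r = int (r + 2)" for r by simp_all
    then show ?thesis unfolding sum.distrib by (simp only:)
  qed
  \<comment> \<open>The first two terms are in the wrong order or diagonal:
    \<open>L 1 L (-1)\<close> is \<open>?N 1\<close> plus twice \<open>L 0\<close>, and
    \<open>L 0 L 0\<close> gives \<open>k^2\<close>. This extra \<open>?N 1\<close> completes the
    other half, which starts at \<open>s = 2\<close>.\<close>
  also have "(\<Sum>r<k + 2. L (1 - int r) (L (int r - 1) v)) =
      (of_nat k ^ 2 + 2 * of_nat k) *\<^sub>V v + ?N 1 + (\<Sum>s\<in>{1..k}. ?N s)"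
  proof -
    have "(\<Sum>r<k + 2. L (1 - int r) (L (int r - 1) v)) = L 1 (L (-1) v) + L 0 (L 0 v) + (\<Sum>r<k. ?N (Suc r))"
      using sum.lessThan_Suc_shift[of "\<lambda>r. L (1 - int r) (L (int r - 1) v)" "Suc k"]
        sum.lessThan_Suc_shift[of "\<lambda>r. L (1 - int (Suc r)) (L (int (Suc r) - 1) v)" k]
      by (simp add: add.assoc)
    moreover have "L 1 (L (-1) v) = ?N 1 + (2 * of_nat k) *\<^sub>V v"
      using virasoro_central_charge[of 1 "-1" v] by (simp add: L0v)
    ultimately show ?thesis
      by (simp add: L0v L_scale sum.atLeast1_atMost_eq power2_eq_square algebra_simps)
  qed
  finally have "Y (Y \<omega> (-1) \<omega>) 3 v = (\<Sum>r<k + 2. ?N (r + 2)) + ((of_nat k ^ 2 + 2 * of_nat k) *\<^sub>V v + ?N 1 + (\<Sum>s\<in>{1..k}. ?N s))" .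
  moreover have "(\<Sum>r<k + 2. ?N (r + 2)) + ?N 1 = (\<Sum>s\<in>{1..k}. ?N s)"
  proof -
    have "(\<Sum>r<k + 2. ?N (r + 2)) + ?N 1 = (\<Sum>r<k + 3. ?N (Suc r))"
      using sum.lessThan_Suc_shift[of "\<lambda>r. ?N (Suc r)" "k + 2"] by (simp add: add.commute eval_nat_numeral)
    also have "\<dots> = (\<Sum>s\<in>{1..k + 3}. ?N s)" by (simp add: sum.atLeast1_atMost_eq)
    also have "\<dots> = (\<Sum>s\<in>{1..k}. ?N s)"
      by (rule sum.mono_neutral_right) (auto simp: L_above_degree[OF v] L_zero)
    finally show ?thesis .
  qed
  ultimately have "Y (Y \<omega> (-1) \<omega>) 3 v = (of_nat k ^ 2 + 2 * of_nat k) *\<^sub>V v + ((\<Sum>s\<in>{1..k}. ?N s) + (\<Sum>s\<in>{1..k}. ?N s))"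
    by (simp add: algebra_simps)
  moreover have "L (-2) \<omega> = Y \<omega> (-1) \<omega>" by (simp add: L_def)
  ultimately show ?thesis
    using scale_left_distrib[of 1 1 "\<Sum>s\<in>{1..k}. ?N s"] by simp
qed

lemma zero_trace_L_minus_2_\<omega>:
  "zero_trace k 4 (L (-2) \<omega>) = of_real ((real k ^ 2 + 2 * real k) * real (graded_dim k) +
    4 * (\<Sum>m\<in>{1..k}. sigma 1 m * (real (k - m) * real (graded_dim (k - m)))) +
    real d / 6 * (\<Sum>m\<in>{1..k}. (sigma 3 m - sigma 1 m) * real (graded_dim (k - m))))"
proof -
  let ?N = "\<lambda>s v. L (- int s) (L (int s) v)"
  let ?V = "homogeneous_space (int k)"
  have N: "?N s ` ?V \<subseteq> ?V" for s
    using L_homogeneous[OF L_homogeneous, of _ "int k" "- int s" "int s"] by auto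
  have sN: "(\<lambda>v. \<Sum>s\<in>{1..k}. ?N s v) ` ?V \<subseteq> ?V"
    using N by (auto intro!: subspace_sum homogeneous_subspace)
  have trN: "tr k (?N s) = of_nat s * (\<Sum>m | m \<in> {1..k} \<and> s dvd m. 2 * (of_nat (k - m) * of_nat (graded_dim (k - m)))) +
      (of_nat s ^ 3 - of_nat s) * (\<Sum>m | m \<in> {1..k} \<and> s dvd m. of_nat d / 12 * of_nat (graded_dim (k - m)))"
    if "s \<ge> 1" for s
    unfolding trace_LL[OF that] sum_distrib_left sum.distrib[symmetric]
    by (intro sum.cong refl) (simp add: algebra_simps)
  have "zero_trace k 4 (L (-2) \<omega>) =
      tr k (\<lambda>v. (of_nat k ^ 2 + 2 * of_nat k) *\<^sub>V v + 2 *\<^sub>V (\<Sum>s\<in>{1..k}. ?N s v))"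
    unfolding zero_trace_def
    by (intro trace_on_cong fin_subspace_homogeneous) (use zero_mode_L_minus_2_\<omega> in simp)
  also have "\<dots> = (of_nat k ^ 2 + 2 * of_nat k) * of_nat (graded_dim k) + 2 * tr k (\<lambda>v. \<Sum>s\<in>{1..k}. ?N s v)"
  proof -
    have "(\<lambda>v. 2 *\<^sub>V (\<Sum>s\<in>{1..k}. ?N s v)) ` ?V \<subseteq> ?V" "(\<lambda>v. (of_nat k ^ 2 + 2 * of_nat k) *\<^sub>V v) ` ?V \<subseteq> ?V"
      using sN by (auto simp: image_subset_iff intro: subspace_scale homogeneous_subspace)
    then show ?thesis
      by (simp only: trace_on_add[OF fin_subspace_homogeneous] trace_on_const[OF fin_subspace_homogeneous]
          trace_on_scale[OF fin_subspace_homogeneous sN] graded_dim_def)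
  qed
  also have "tr k (\<lambda>v. \<Sum>s\<in>{1..k}. ?N s v) = (\<Sum>s\<in>{1..k}. tr k (?N s))"
    by (intro trace_on_sum[OF fin_subspace_homogeneous] N) simp
  also have "\<dots> = (\<Sum>s\<in>{1..k}. of_nat s * (\<Sum>m | m \<in> {1..k} \<and> s dvd m. 2 * (of_nat (k - m) * of_nat (graded_dim (k - m)))) +
      (of_nat s ^ 3 - of_nat s) * (\<Sum>m | m \<in> {1..k} \<and> s dvd m. of_nat d / 12 * of_nat (graded_dim (k - m))))"
    by (intro sum.cong refl trN) simp
  also have "\<dots> = of_real ((\<Sum>m\<in>{1..k}. sigma 1 m * (2 * (real (k - m) * real (graded_dim (k - m))))) +
      (\<Sum>m\<in>{1..k}. (sigma 3 m - sigma 1 m) * (real d / 12 * real (graded_dim (k - m)))))"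
    unfolding sum.distrib sum_divisors_swap by (simp add: sigma_def sum_subtractf)
  also have "(\<Sum>m\<in>{1..k}. sigma 1 m * (2 * (real (k - m) * real (graded_dim (k - m))))) =
      2 * (\<Sum>m\<in>{1..k}. sigma 1 m * (real (k - m) * real (graded_dim (k - m))))"
    unfolding sum_distrib_left by (intro sum.cong refl) simp
  also have "(\<Sum>m\<in>{1..k}. (sigma 3 m - sigma 1 m) * (real d / 12 * real (graded_dim (k - m)))) =
      real d / 12 * (\<Sum>m\<in>{1..k}. (sigma 3 m - sigma 1 m) * real (graded_dim (k - m)))"
    unfolding sum_distrib_left by (intro sum.cong refl) simp
  finally show ?thesis by (simp add: algebra_simps)
qed

text \<open>In \<open>k^2 dim V_k\<close> one factor \<open>k\<close> is absorbed by
  \<open>graded_dim_recursion\<close>; the other is split as \<open>m + (k - m)\<close>, and the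
  part with \<open>k - m\<close> is expanded again, producing the convolution \<open>C\<close>.
  After \<open>sigma_convolution\<close> the sums \<open>S3\<close> and \<open>S1\<close> cancel and
  only \<open>M\<close> remains.\<close>

lemma zero_trace_gap:
  "zero_trace k 4 B\<^sub>4 - zero_trace k 4 (\<pi> B\<^sub>4) =
    of_real (6 * real d * (real d + 2) / (5 * real d + 22) * (\<Sum>m\<in>{1..k}. real m * sigma 1 m * real (graded_dim (k - m))))"
proof -
  define S3 S1 M C K where "S3 = (\<Sum>m\<in>{1..k}. sigma 3 m * real (graded_dim (k - m)))"
    and "S1 = (\<Sum>m\<in>{1..k}. sigma 1 m * real (graded_dim (k - m)))"
    and "M = (\<Sum>m\<in>{1..k}. real m * sigma 1 m * real (graded_dim (k - m)))"
    and "C = (\<Sum>m\<in>{1..k}. (\<Sum>l\<in>{1..<m}. sigma 1 l * sigma 1 (m - l)) * real (graded_dim (k - m)))"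
    and "K = (\<Sum>m\<in>{1..k}. sigma 1 m * (real (k - m) * real (graded_dim (k - m))))"
  define c where "c = 12 / (5 * real d + 22)"
  \<comment> \<open>Eliminates \<open>d * c\<close>, so that the cancellation of \<open>S3\<close>
    and \<open>S1\<close> becomes an identity linear in \<open>c\<close>.\<close>
  have c: "real d * c = (12 - 22 * c) / 5" by (simp add: c_def field_simps)
  have kp: "real k * real (graded_dim k) = real d * S1" unfolding S1_def by (rule graded_dim_recursion)
  have "real k * S1 = M + K"
    unfolding S1_def M_def K_def sum.distrib[symmetric] sum_distrib_left
    by (intro sum.cong refl) (simp add: of_nat_diff algebra_simps)
  then have kkp: "real k ^ 2 * real (graded_dim k) = real d * (M + K)"
    using kp by (simp add: power2_eq_square mult.assoc mult.left_commute)
  have "K = (\<Sum>m\<in>{1..k}. \<Sum>l\<in>{1..k - m}. real d * (sigma 1 m * sigma 1 l * real (graded_dim (k - (m + l)))))"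
    unfolding K_def graded_dim_recursion by (simp add: sum_distrib_left mult_ac)
  also have "\<dots> = (\<Sum>(m, l)\<in>Sigma {1..k} (\<lambda>m. {1..k - m}). real d * (sigma 1 m * sigma 1 l * real (graded_dim (k - (m + l)))))"
    by (subst sum.Sigma) auto
  also have "\<dots> = (\<Sum>(n, m)\<in>Sigma {1..k} (\<lambda>n. {1..<n}). real d * (sigma 1 m * sigma 1 (n - m) * real (graded_dim (k - n))))"
    by (rule sum.reindex_bij_witness[where i = "\<lambda>(n, m). (m, n - m)" and j = "\<lambda>(m, l). (m + l, m)"]) auto
  also have "\<dots> = (\<Sum>n\<in>{1..k}. \<Sum>m\<in>{1..<n}. real d * (sigma 1 m * sigma 1 (n - m) * real (graded_dim (k - n))))"
    by (subst sum.Sigma) auto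
  also have "\<dots> = real d * C"
    by (simp add: C_def sum_distrib_left sum_distrib_right)
  finally have K: "K = real d * C" .
  have "C = (\<Sum>m\<in>{1..k}. (5 / 12 * sigma 3 m + sigma 1 m / 12 - real m * sigma 1 m / 2) * real (graded_dim (k - m)))"
    unfolding C_def by (intro sum.cong refl, subst sigma_convolution) auto
  also have "\<dots> = 5 / 12 * S3 + S1 / 12 - M / 2"
    by (simp add: S3_def S1_def M_def sum_distrib_left sum_divide_distrib sum.distrib sum_subtractf algebra_simps)
  finally have C: "C = 5 / 12 * S3 + S1 / 12 - M / 2" .
  have B: "zero_trace k 4 B\<^sub>4 = of_real (real d * (S3 + 2 * S1))"
    unfolding zero_trace_B\<^sub>4 S3_def S1_def by (simp add: sum.distrib sum_distrib_left algebra_simps)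
  have "(real k ^ 2 + 2 * real k) * real (graded_dim k) + 4 * K + real d / 6 * (S3 - S1) =
      real d * (M + K + 2 * S1 + 4 * C + (S3 - S1) / 6)"
    unfolding distrib_right kkp using kp K by (simp add: algebra_simps)
  moreover have "(\<Sum>m\<in>{1..k}. (sigma 3 m - sigma 1 m) * real (graded_dim (k - m))) = S3 - S1"
    by (simp add: S3_def S1_def sum_subtractf algebra_simps)
  ultimately have LL: "zero_trace k 4 (L (-2) \<omega>) = of_real (real d * (M + K + 2 * S1 + 4 * C + (S3 - S1) / 6))"
    unfolding zero_trace_L_minus_2_\<omega> K_def[symmetric] by simp
  have L4: "zero_trace k 4 (L (-4) vac) = of_real (real d * (3 * S1))"
  proof -
    have "zero_trace k 4 (L (-4) vac) = of_real (3 * (real k * real (graded_dim k)))"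
      by (simp add: zero_trace_L_minus_4)
    then show ?thesis unfolding kp by (simp add: mult.left_commute)
  qed
  have cc: "12 / of_nat (5 * d + 22) = complex_of_real c" by (simp add: c_def)
  have "zero_trace k 4 (\<pi> B\<^sub>4) = of_real c * zero_trace k 4 (L (-2) \<omega>) +
      3 * (1 - of_real c) / 5 * zero_trace k 4 (L (-4) vac)"
    unfolding \<pi>_B\<^sub>4 cc using virasoro_4_homogeneous
    by (subst zero_trace_add)
      (auto simp: zero_trace_scale intro: subspace_scale[OF homogeneous_subspace])
  then have "zero_trace k 4 B\<^sub>4 - zero_trace k 4 (\<pi> B\<^sub>4) = of_real (real d *
      (S3 + 2 * S1 - (c * (M + 2 * S1 + (S3 - S1) / 6) + (real d * c + 4 * c) * C) - 9 * (1 - c) / 5 * S1))"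
    unfolding B LL L4 by (simp add: K algebra_simps)
  also have "S3 + 2 * S1 - (c * (M + 2 * S1 + (S3 - S1) / 6) + (real d * c + 4 * c) * C) - 9 * (1 - c) / 5 * S1 =
      (real d * c + 2 * c) / 2 * M"
    unfolding c C by (simp add: field_simps)
  also have "real d * ((real d * c + 2 * c) / 2 * M) = 6 * real d * (real d + 2) / (5 * real d + 22) * M"
  proof -
    define e where "e = 6 / (5 * real d + 22)"
    have "6 * real d * (real d + 2) / (5 * real d + 22) * M = e * (real d * (real d + 2) * M)"
      by (simp add: e_def)
    moreover have "c = 2 * e" by (simp add: c_def e_def)
    ultimately show ?thesis by (simp add: algebra_simps)
  qed
  finally show ?thesis unfolding M_def .
qed

lemma zero_trace_gap_nonzero:
  assumes "d \<ge> 1" "k \<ge> 1"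
  shows "zero_trace k 4 B\<^sub>4 \<noteq> zero_trace k 4 (\<pi> B\<^sub>4)"
proof -
  let ?a = "6 * real d * (real d + 2) / (5 * real d + 22)"
  let ?M = "\<Sum>m\<in>{1..k}. real m * sigma 1 m * real (graded_dim (k - m))"
  have "?M > 0"
    \<comment> \<open>The term \<open>m = k\<close> involves \<open>graded_dim 0\<close>, positive
      because \<open>vac\<close> is nonzero.\<close>
    by (rule sum_pos2[where i = k]) (use assms graded_dim_0 sigma_pos[of k 1] sigma_nonneg in auto)
  moreover have "?a > 0"
    using assms by (simp add: divide_pos_pos)
  ultimately have "?a * ?M > 0" by (intro mult_pos_pos)
  then have "?a * ?M \<noteq> 0" by (rule less_imp_neq[THEN not_sym])
  then have "zero_trace k 4 B\<^sub>4 - zero_trace k 4 (\<pi> B\<^sub>4) \<noteq> 0"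
    unfolding zero_trace_gap of_real_eq_0_iff .
  then show ?thesis by simp
qed

lemma conformal_design_iff:
  "adjoint.conformal_design t (homogeneous_space (int k)) \<longleftrightarrow>
    0 < t \<and> (\<forall>n\<le>t. \<forall>v\<in>homogeneous_space (int n). zero_trace k n v = zero_trace k n (\<pi> v))"
  unfolding adjoint.conformal_design_def adjoint.zero_mode_def zero_trace_def
  using degree_subspace_adjoint[of "int k"] by blast

lemma strength_3:
  assumes "d \<ge> 1" "k > 0"
  shows "has_strength k 3"
proof -
  obtain k' where k': "k = int k'" "k' \<ge> 1"
    using assms(2) by (metis One_nat_def Suc_leI pos_int_cases)
  have "zero_trace k' n v = zero_trace k' n (\<pi> v)" if "n \<le> 3" "v \<in> homogeneous_space (int n)" for n v
  proof (rule trace_matched_trace)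
    consider "n = 0" | "n = 1" | "n = 2" | "n = 3" using \<open>n \<le> 3\<close> by linarith
    then show "trace_matched n v"
      by cases (use that trace_matched_0 trace_matched_1 trace_matched_2 trace_matched_3 in auto)
  qed
  then have "adjoint.conformal_design 3 (homogeneous_space k)"
    unfolding k' conformal_design_iff by simp
  moreover have "\<not> adjoint.conformal_design (3 + 1) (homogeneous_space k)"
    unfolding k' conformal_design_iff
    using zero_trace_gap_nonzero[OF assms(1) k'(2)] B\<^sub>4_homogeneous
    by (auto intro!: exI[of _ 4] bexI[of _ B\<^sub>4])
  ultimately show ?thesis by (simp add: has_strength_def)
qed

end

theorem theorem1p3:
  fixes scaleh :: "complex \<Rightarrow> 'h \<Rightarrow> 'h::ab_group_add"
    and form :: "'h \<Rightarrow> 'h \<Rightarrow> complex"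
    and scale :: "complex \<Rightarrow> 'v \<Rightarrow> 'v::ab_group_add"
    and Y :: "'v \<Rightarrow> int \<Rightarrow> 'v \<Rightarrow> 'v"
    and vac \<omega> :: 'v
    and act :: "'h affine \<Rightarrow> 'v \<Rightarrow> 'v"
    and hs :: "nat \<Rightarrow> 'h"
    and d :: nat
    and k :: int
  assumes "d \<ge> 1"
    and "free_boson_voa scaleh d form scale Y vac \<omega> act hs"
    and "k > 0"
  shows "voa.has_strength scale Y vac \<omega> k 3"
proof -
  interpret free_boson_voa scaleh d form scale Y vac \<omega> act hs by (rule assms)
  show ?thesis by (rule strength_3) (rule assms)+
qed

end
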